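(* There exists a parallel algorithm which, given $\varepsilon\in(0,1)$ and an instance of the mixed packing-covering problem consisting of matrices $P\in[0,1]^{p\times n}$ and $C\in[0,1]^{c\times n}$, is an $\varepsilon$-approximation algorithm for this problem (it either outputs an $\varepsilon$-approximate solution or correctly reports infeasibility), and which runs in $\widetilde{O}(w\cdot\varepsilon^{-1})$ parallel time while performing $\widetilde{O}(w\cdot N\cdot\varepsilon^{-1})$ total work, where $N$ is the total number of nonzero entries of $P$ and $C$, and $w$ is the width of the instance.
   Context: Mixed packing-covering problem (MPC): given entrywise nonnegative matrices $P\in\mathbb{R}^{p\times n}$ and $C\in\mathbb{R}^{c\times n}$, all of whose entries are at most $1$, find $x\in\mathbb{R}^n$ with $x\ge 0$, $\|x\|_\infty\le 1$, $Px\le \mathbf{1}_p$ and $Cx\ge \mathbf{1}_c$ (componentwise) if such an $x$ exists, and otherwise report infeasibility. Here $\mathbf{1}_k$ is the all-ones vector in $\mathbb{R}^k$. A vector $x\in\mathbb{R}^n$ is an $\varepsilon$-approximate solution if $x\ge 0$, $\|x\|_\infty\le 1$, $Px\le(1+\varepsilon)\mathbf{1}_p$ and $Cx\ge(1-\varepsilon)\mathbf{1}_c$. An $\varepsilon$-approximation algorithm outputs either an $\varepsilon$-approximate solution or a correct report that no $x$ satisfies the exact constraints. Width: $w=\max(w_P,w_C)$, where $w_P$ (resp. $w_C$) is the maximum number of nonzero entries in any row of $P$ (resp. $C$). Parallel time (depth) is the length of the longest chain of dependent operations, and total work is the total number of operations; operations are unit-cost real operations (arithmetic, comparison, $\exp$,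 $\log$). The notation $\widetilde{O}(\cdot)$ hides factors polylogarithmic in $n,p,c,N$ and $1/\varepsilon$. *)

theory Defs
  imports Complex_Main "Jordan_Normal_Form.Matrix"
begin

section \<open>Mixed packing-covering\<close>

text \<open>The dimensions vary with the instance, so matrices and vectors are the explicitly sized
  ones of \<^theory>\<open>Jordan_Normal_Form.Matrix\<close>, whose order on vectors is componentwise.\<close>

abbreviation ones :: "nat \<Rightarrow> real vec" where
  "ones k \<equiv> vec k (\<lambda>_. 1)"

definition mpc_instance :: "nat \<Rightarrow> nat \<Rightarrow> nat \<Rightarrow> real mat \<Rightarrow> real mat \<Rightarrow> bool" where
  "mpc_instance n p c P C \<longleftrightarrow>
     P \<in> carrier_mat p n \<and> (\<forall>i<p. \<forall>j<n. 0 \<le> P $$ (i, j) \<and> P $$ (i, j) \<le> 1) \<and>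
     C \<in> carrier_mat c n \<and> (\<forall>i<c. \<forall>j<n. 0 \<le> C $$ (i, j) \<and> C $$ (i, j) \<le> 1)"

text \<open>The clause \<open>\<forall>j<n. \<bar>x $ j\<bar> \<le> 1\<close> is the bound \<open>1\<close> on the maximum norm of \<open>x\<close>.\<close>

definition mpc_solution :: "nat \<Rightarrow> nat \<Rightarrow> nat \<Rightarrow> real mat \<Rightarrow> real mat \<Rightarrow> real vec \<Rightarrow> bool" where
  "mpc_solution n p c P C x \<longleftrightarrow>
     x \<in> carrier_vec n \<and> 0\<^sub>v n \<le> x \<and> (\<forall>j<n. \<bar>x $ j\<bar> \<le> 1) \<and>
     P *\<^sub>v x \<le> ones p \<and> ones c \<le> C *\<^sub>v x"

definition mpc_approx_solution ::
  "real \<Rightarrow> nat \<Rightarrow> nat \<Rightarrow> nat \<Rightarrow> real mat \<Rightarrow> real mat \<Rightarrow> real vec \<Rightarrow> bool" where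
  "mpc_approx_solution \<epsilon> n p c P C x \<longleftrightarrow>
     x \<in> carrier_vec n \<and> 0\<^sub>v n \<le> x \<and> (\<forall>j<n. \<bar>x $ j\<bar> \<le> 1) \<and>
     P *\<^sub>v x \<le> (1 + \<epsilon>) \<cdot>\<^sub>v ones p \<and> (1 - \<epsilon>) \<cdot>\<^sub>v ones c \<le> C *\<^sub>v x"

definition row_nnz :: "real mat \<Rightarrow> nat \<Rightarrow> nat" where
  "row_nnz A i = card {j. j < dim_col A \<and> A $$ (i, j) \<noteq> 0}"

text \<open>A matrix without rows has width \<open>0\<close>.\<close>

definition mat_width :: "real mat \<Rightarrow> nat" where
  "mat_width A = Max (insert 0 (row_nnz A ` {..<dim_row A}))"

definition width :: "real mat \<Rightarrow> real mat \<Rightarrow> nat" where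
  "width P C = max (mat_width P) (mat_width C)"

definition mat_nnz :: "real mat \<Rightarrow> nat" where
  "mat_nnz A = card {(i, j). i < dim_row A \<and> j < dim_col A \<and> A $$ (i, j) \<noteq> 0}"

definition nnz :: "real mat \<Rightarrow> real mat \<Rightarrow> nat" where
  "nnz P C = mat_nnz P + mat_nnz C"


section \<open>A work-depth model of parallel computation\<close>

text \<open>Parallel algorithms are programs of a small purely functional language on natural numbers
  (used as indices and counters), exact reals, pairs and immutable arrays. The only source of
  unbounded parallelism is \<open>Tab e b\<close>, the parallel loop that builds the array whose \<open>i\<close>-th entry is
  the value of \<open>b\<close> for \<open>i\<close>. The operands of a binary operation are also independent of each other.
  Everything else is sequential.

  The operations are deliberately few, so that no power is gained from the unit-cost convention:
  no conversion from reals to naturals (hence no rounding), no multiplication, division or bit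
  operations on naturals except halving, and no real constants except those computed from naturals.

  Variables are de Bruijn indices into the environment. Conditions are naturals, nonzero meaning
  true.\<close>

datatype val = NatV nat | RealV real | PairV val val | ArrV "val list"

datatype op1 = RealOf | Half | Exp | Ln | Fst | Snd | Length

datatype op2 = NAdd | NSub | NLess | RAdd | RSub | RMul | RDiv | RLess | MkPair | Index

datatype prg =
    Var nat
  | NConst nat
  | Op1 op1 prg
  | Op2 op2 prg prg
  | LetIn prg prg
  | Cond prg prg prg
  | Tab prg prg
  | While prg prg

text \<open>\<open>None\<close> means that the computation is stuck. In particular division by zero, logarithms of
  nonpositive numbers and out-of-bounds accesses have no result.\<close>

primrec app1 :: "op1 \<Rightarrow> val \<Rightarrow> val option" where
  "app1 RealOf u = (case u of NatV m \<Rightarrow> Some (RealV (real m)) | _ \<Rightarrow> None)"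
| "app1 Half u = (case u of NatV m \<Rightarrow> Some (NatV (m div 2)) | _ \<Rightarrow> None)"
| "app1 Exp u = (case u of RealV x \<Rightarrow> Some (RealV (exp x)) | _ \<Rightarrow> None)"
| "app1 Ln u = (case u of RealV x \<Rightarrow> if 0 < x then Some (RealV (ln x)) else None | _ \<Rightarrow> None)"
| "app1 Fst u = (case u of PairV a b \<Rightarrow> Some a | _ \<Rightarrow> None)"
| "app1 Snd u = (case u of PairV a b \<Rightarrow> Some b | _ \<Rightarrow> None)"
| "app1 Length u = (case u of ArrV vs \<Rightarrow> Some (NatV (length vs)) | _ \<Rightarrow> None)"

primrec app2 :: "op2 \<Rightarrow> val \<Rightarrow> val \<Rightarrow> val option" where
  "app2 NAdd u v = (case (u, v) of (NatV m, NatV k) \<Rightarrow> Some (NatV (m + k)) | _ \<Rightarrow> None)"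
| "app2 NSub u v = (case (u, v) of (NatV m, NatV k) \<Rightarrow> Some (NatV (m - k)) | _ \<Rightarrow> None)"
| "app2 NLess u v =
    (case (u, v) of (NatV m, NatV k) \<Rightarrow> Some (NatV (if m < k then 1 else 0)) | _ \<Rightarrow> None)"
| "app2 RAdd u v = (case (u, v) of (RealV x, RealV y) \<Rightarrow> Some (RealV (x + y)) | _ \<Rightarrow> None)"
| "app2 RSub u v = (case (u, v) of (RealV x, RealV y) \<Rightarrow> Some (RealV (x - y)) | _ \<Rightarrow> None)"
| "app2 RMul u v = (case (u, v) of (RealV x, RealV y) \<Rightarrow> Some (RealV (x * y)) | _ \<Rightarrow> None)"
| "app2 RDiv u v = (case (u, v) of
      (RealV x, RealV y) \<Rightarrow> if y \<noteq> 0 then Some (RealV (x / y)) else None | _ \<Rightarrow> None)"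
| "app2 RLess u v =
    (case (u, v) of (RealV x, RealV y) \<Rightarrow> Some (NatV (if x < y then 1 else 0)) | _ \<Rightarrow> None)"
| "app2 MkPair u v = Some (PairV u v)"
| "app2 Index u v = (case (u, v) of
      (ArrV vs, NatV m) \<Rightarrow> if m < length vs then Some (vs ! m) else None | _ \<Rightarrow> None)"

text \<open>\<open>run env e v w d\<close>: in environment \<open>env\<close>, program \<open>e\<close> terminates with value \<open>v\<close>, performing \<open>w\<close>
  operations in total, the longest chain of dependent ones having length \<open>d\<close>. Every evaluation
  step, including variable access and each thread of a parallel loop, is charged as an operation.

  The state of a loop \<open>While b e\<close> is variable \<open>0\<close>: it is read by \<open>b\<close> and \<open>e\<close>, replaced by the value of
  \<open>e\<close> after each iteration, and returned at the end.\<close>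

inductive run :: "val list \<Rightarrow> prg \<Rightarrow> val \<Rightarrow> nat \<Rightarrow> nat \<Rightarrow> bool" where
  Var: "k < length env \<Longrightarrow> run env (Var k) (env ! k) 1 1"
| NConst: "run env (NConst m) (NatV m) 1 1"
| Op1: "\<lbrakk>run env e u w d; app1 f u = Some v\<rbrakk> \<Longrightarrow> run env (Op1 f e) v (w + 1) (d + 1)"
| Op2: "\<lbrakk>run env e1 u1 w1 d1; run env e2 u2 w2 d2; app2 f u1 u2 = Some v\<rbrakk>
    \<Longrightarrow> run env (Op2 f e1 e2) v (w1 + w2 + 1) (max d1 d2 + 1)"
| LetIn: "\<lbrakk>run env e1 u w1 d1; run (u # env) e2 v w2 d2\<rbrakk>
    \<Longrightarrow> run env (LetIn e1 e2) v (w1 + w2 + 1) (d1 + d2 + 1)"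
| CondT: "\<lbrakk>run env b (NatV m) w1 d1; m \<noteq> 0; run env e1 v w2 d2\<rbrakk>
    \<Longrightarrow> run env (Cond b e1 e2) v (w1 + w2 + 1) (d1 + d2 + 1)"
| CondF: "\<lbrakk>run env b (NatV 0) w1 d1; run env e2 v w2 d2\<rbrakk>
    \<Longrightarrow> run env (Cond b e1 e2) v (w1 + w2 + 1) (d1 + d2 + 1)"
| Tab: "\<lbrakk>run env e (NatV m) w d; \<And>i. i < m \<Longrightarrow> run (NatV i # env) b (vs i) (ws i) (ds i)\<rbrakk>
    \<Longrightarrow> run env (Tab e b) (ArrV (map vs [0..<m]))
          (w + (\<Sum>i<m. ws i) + 1) (d + Max (insert 0 (ds ` {..<m})) + 1)"
| WhileT: "\<lbrakk>run (s # env) b (NatV m) w1 d1; m \<noteq> 0; run (s # env) e t w2 d2;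
      run (t # env) (While b e) v w3 d3\<rbrakk>
    \<Longrightarrow> run (s # env) (While b e) v (w1 + w2 + w3 + 1) (d1 + d2 + d3 + 1)"
| WhileF: "run (s # env) b (NatV 0) w d \<Longrightarrow> run (s # env) (While b e) s (w + 1) (d + 1)"

inductive_cases run_VarE: "run env (Var k) v w d"
inductive_cases run_NConstE: "run env (NConst m) v w d"
inductive_cases run_Op1E: "run env (Op1 f e) v w d"
inductive_cases run_Op2E: "run env (Op2 f e1 e2) v w d"
inductive_cases run_LetInE: "run env (LetIn e1 e2) v w d"
inductive_cases run_CondE: "run env (Cond b e1 e2) v w d"
inductive_cases run_TabE: "run env (Tab e b) v w d"
inductive_cases run_WhileE: "run env (While b e) v w d"

lemma run_deterministic:
  assumes "run env e v w d" and "run env e v' w' d'"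
  shows "v' = v \<and> w' = w \<and> d' = d"
  using assms
proof (induction arbitrary: v' w' d' rule: run.induct)
  case (Var k env)
  then show ?case by (auto elim: run_VarE)
next
  case (NConst env m)
  then show ?case by (auto elim: run_NConstE)
next
  case (Op1 env e u w d f v)
  from Op1.prems show ?case
    by (rule run_Op1E) (use Op1.hyps in \<open>auto dest!: Op1.IH\<close>)
next
  case (Op2 env e1 u1 w1 d1 e2 u2 w2 d2 f v)
  from Op2.prems show ?case
    by (rule run_Op2E) (use Op2.hyps in \<open>auto dest!: Op2.IH\<close>)
next
  case (LetIn env e1 u w1 d1 e2 v w2 d2)
  from LetIn.prems show ?case
  proof (rule run_LetInE)
    fix u' w1' d1' w2' d2'
    assume eqs: "w' = Suc (w1' + w2')" "d' = Suc (d1' + d2')"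
      and e1: "run env e1 u' w1' d1'" and e2: "run (u' # env) e2 v' w2' d2'"
    from LetIn.IH(1)[OF e1] e2 eqs show ?thesis by (auto dest!: LetIn.IH(2))
  qed
next
  case (CondT env b m w1 d1 e1 v w2 d2 e2)
  from CondT.prems show ?case
    by (rule run_CondE) (use CondT.hyps in \<open>auto dest!: CondT.IH\<close>)
next
  case (CondF env b w1 d1 e2 v w2 d2 e1)
  from CondF.prems show ?case
    by (rule run_CondE) (auto dest!: CondF.IH)
next
  case (Tab env e m w d b vs ws ds)
  from Tab.prems show ?case
  proof (rule run_TabE)
    fix m' w0 d0 vs' ws' ds'
    assume eqs: "v' = ArrV (map vs' [0..<m'])" "w' = Suc (w0 + sum ws' {..<m'})"
      "d' = Suc (d0 + Max (insert 0 (ds' ` {..<m'})))"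
      and e: "run env e (NatV m') w0 d0"
      and b: "\<And>i. i < m' \<Longrightarrow> run (NatV i # env) b (vs' i) (ws' i) (ds' i)"
    from Tab.IH(1)[OF e] have m: "m' = m" "w0 = w" "d0 = d" by auto
    have i: "vs' i = vs i \<and> ws' i = ws i \<and> ds' i = ds i" if "i < m" for i
      using Tab.IH(2)[OF that b] that m by blast
    then have "ds' ` {..<m} = ds ` {..<m}" "sum ws' {..<m} = sum ws {..<m}"
      by (auto intro: sum.cong)
    with i m eqs show ?thesis by simp
  qed
next
  case (WhileT s env b m w1 d1 e t w2 d2 v w3 d3)
  from WhileT.prems show ?case
  proof (rule run_WhileE)
    fix s' env' m' w1' d1' t' w2' d2' w3' d3'
    assume eqs: "w' = Suc (w1' + w2' + w3')" "d' = Suc (d1' + d2' + d3')"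
      and env: "s # env = s' # env'" and b: "run (s' # env') b (NatV m') w1' d1'"
      and e: "run (s' # env') e t' w2' d2'"
      and rest: "run (t' # env') (While b e) v' w3' d3'"
    from WhileT.IH(1) b env have 1: "w1' = w1" "d1' = d1" by auto
    from WhileT.IH(2) e env have 2: "t' = t" "w2' = w2" "d2' = d2" by auto
    from WhileT.IH(3) rest 2 env have "v' = v" "w3' = w3" "d3' = d3" by auto
    with 1 2 eqs show ?thesis by simp
  next
    fix env' w0 d0
    assume "s # env = v' # env'" and "run (v' # env') b (NatV 0) w0 d0"
    with WhileT.IH(1) WhileT.hyps show ?thesis by auto
  qed
next
  case (WhileF s env b w d e)
  from WhileF.prems show ?case
    by (rule run_WhileE) (use WhileF.IH in auto)
qed


section \<open>Input and output conventions\<close>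

text \<open>Both are sparse, since the work bound refers only to the number of nonzero entries. A matrix
  is given by its nonzero entries, each once, in arbitrary order.\<close>

definition lists_entries :: "real mat \<Rightarrow> (nat \<times> nat \<times> real) list \<Rightarrow> bool" where
  "lists_entries A es \<longleftrightarrow> distinct es \<and>
     set es = {(i, j, A $$ (i, j)) | i j. i < dim_row A \<and> j < dim_col A \<and> A $$ (i, j) \<noteq> 0}"

definition entriesV :: "(nat \<times> nat \<times> real) list \<Rightarrow> val" where
  "entriesV es = ArrV (map (\<lambda>(i, j, a). PairV (NatV i) (PairV (NatV j) (RealV a))) es)"

definition mpc_input ::
  "real \<Rightarrow> nat \<Rightarrow> nat \<Rightarrow> nat \<Rightarrow> (nat \<times> nat \<times> real) list \<Rightarrow> (nat \<times> nat \<times> real) list \<Rightarrow> val list" where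
  "mpc_input \<epsilon> n p c es fs =
     [RealV \<epsilon>, NatV n, NatV p, NatV c, entriesV es, entriesV fs]"

text \<open>A vector is output as an array of index-value pairs with distinct indices; the coordinates
  that do not occur are \<open>0\<close>.\<close>

definition outputs_vec :: "nat \<Rightarrow> val \<Rightarrow> real vec \<Rightarrow> bool" where
  "outputs_vec n v x \<longleftrightarrow> (\<exists>js.
     v = ArrV (map (\<lambda>(j, r). PairV (NatV j) (RealV r)) js) \<and>
     distinct (map fst js) \<and> (\<forall>(j, r) \<in> set js. j < n) \<and>
     x = vec n (\<lambda>j. case map_of js j of None \<Rightarrow> 0 | Some r \<Rightarrow> r))"

definition outputs_infeasible :: "val \<Rightarrow> bool" where
  "outputs_infeasible v \<longleftrightarrow> v = NatV 0"

definition mpc_correct_output ::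
  "real \<Rightarrow> nat \<Rightarrow> nat \<Rightarrow> nat \<Rightarrow> real mat \<Rightarrow> real mat \<Rightarrow> val \<Rightarrow> bool" where
  "mpc_correct_output \<epsilon> n p c P C v \<longleftrightarrow>
     (\<exists>x. outputs_vec n v x \<and> mpc_approx_solution \<epsilon> n p c P C x) \<or>
     (outputs_infeasible v \<and> (\<nexists>x. mpc_solution n p c P C x))"

text \<open>The argument of the suppressed polylogarithmic factors. As it is at least \<open>1\<close>, a polynomial in
  the logarithms of \<open>n\<close>, \<open>p\<close>, \<open>c\<close>, \<open>N\<close> and \<open>1/\<epsilon>\<close> is at most a constant times a power of it. The summand
  \<open>2\<close> only matters for small parameters.\<close>

definition log_size :: "real \<Rightarrow> nat \<Rightarrow> nat \<Rightarrow> nat \<Rightarrow> nat \<Rightarrow> real" where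
  "log_size \<epsilon> n p c N = ln (real n + real p + real c + real N + 1 / \<epsilon> + 2)"

end

theory Submission
  imports Defs
begin

text \<open>The instance is viewed as a game: \<open>x\<close> in the unit box minimizes and a probability vector \<open>y\<close> on the
  constraints maximizes \<open>y \<bullet> (A x - b)\<close>, where the rows of \<open>A\<close> are the packing rows and the negated
  covering rows. If the instance is feasible, then iterates whose average regret against \<open>y\<close> is
  at most \<open>\<epsilon>\<close> average to an \<open>\<epsilon>\<close>-approximate solution. So the algorithm runs a regret-minimizing method
  long enough, checks the average directly, and reports infeasibility if the check fails.

  The number of steps is of order \<open>w / \<epsilon>\<close> up to logarithms, instead of \<open>w / \<epsilon>\<^sup>2\<close>, because the method is
  Sherman's dual extrapolation with an area-convex regularizer (\<open>dual_extrapolation\<close>). The regularizer is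
  \<open>6 \<Sum> \<bar>A\<^sub>i\<^sub>j\<bar> y\<^sub>i x\<^sub>j\<^sup>2 + 360 w \<Sum> y\<^sub>i ln y\<^sub>i\<close>. Strong convexity on the box would make the range grow with
  the dimension. Instead, the Jensen gap of any three points bounds the area that the bilinear form assigns to
  their triangle, and that is all the regret analysis uses. As the regularizer and the form are
  sums over the matrix entries, this reduces to an inequality about three points of the plane
  (\<open>area_convexity_entry\<close>). The range of the regularizer is
  of order \<open>w ln N\<close>.

  Each step minimizes the regularizer plus a linear function twice. Neither minimum has a closed
  form, but alternating between the two blocks of variables, each of which does, halves the error bound in
  every round (\<open>alternating_minimization\<close>), so logarithmically many rounds suffice.

  It remains to implement a round with polylogarithmic depth and nearly linear work, in a language
  without scatter operations and with matrices given as unordered lists of entries. All vectors are stored per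
  entry, so that entrywise operations are single parallel loops. A product with the matrix or its
  transpose is a sum over all entries with the same key. The keys are sorted once, by radix
  sort; afterwards such sums are differences of prefix sums. As all loops are flat, a single number
  \<open>X\<close> bounds the depth by \<open>X\<close> and the work by \<open>N X\<close>, which explains why the two bounds of the
  theorem differ by the factor \<open>N\<close>.\<close>

section \<open>Entropy and area inequalities\<close>

abbreviation xlnx :: "real \<Rightarrow> real" where "xlnx u \<equiv> u * ln u"

text \<open>With \<open>s\<close> and \<open>t\<close> the square roots of \<open>u\<close> and \<open>v\<close>, the divergence is at least the Hellinger
  distance \<open>(s - t)\<^sup>2\<close>, by \<open>ln r \<le> r - 1\<close> for \<open>r = t / s\<close>; and \<open>u - v = (s - t) (s + t)\<close> with
  \<open>(s + t)\<^sup>2 \<le> 4 m\<close>.\<close>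

lemma kl_lower_bound:
  fixes u v :: real
  assumes "0 \<le> u" "0 < v" "u \<le> m" "v \<le> m"
  shows "(u - v)\<^sup>2 / (4 * m) \<le> xlnx u - u * ln v - u + v"
proof -
  define s t where "s = sqrt u" and "t = sqrt v"
  have st: "0 \<le> s" "0 < t" "u = s\<^sup>2" "v = t\<^sup>2" using assms by (auto simp: s_def t_def)
  have sm: "s \<le> sqrt m" "t \<le> sqrt m" using assms by (auto simp: s_def t_def)
  have m: "0 < m" using assms by linarith
  have "(s + t)\<^sup>2 \<le> (2 * sqrt m)\<^sup>2" using st sm by (intro power_mono) auto
  then have 1: "(s + t)\<^sup>2 \<le> 4 * m" using m by (simp add: power_mult_distrib)
  have "(u - v)\<^sup>2 = (s - t)\<^sup>2 * (s + t)\<^sup>2"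
    unfolding st(3,4) by (simp add: power2_eq_square algebra_simps)
  also have "\<dots> \<le> (s - t)\<^sup>2 * (4 * m)" using 1 by (intro mult_left_mono) auto
  finally have 2: "(u - v)\<^sup>2 / (4 * m) \<le> (s - t)\<^sup>2" using m by (simp add: divide_le_eq)
  have 3: "(s - t)\<^sup>2 \<le> xlnx u - u * ln v - u + v"
  proof (cases "s = 0")
    case True
    then show ?thesis using st by simp
  next
    case False
    then have s: "0 < s" using st by simp
    have "ln (t / s) \<le> t / s - 1" using s st by (intro ln_le_minus_one) auto
    then have "2 * s\<^sup>2 * ln (t / s) \<le> 2 * s\<^sup>2 * (t / s - 1)" by (intro mult_left_mono) auto
    also have "\<dots> = 2 * s * t - 2 * s\<^sup>2" using s by (simp add: field_simps power2_eq_square)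
    finally have "2 * s\<^sup>2 * (ln t - ln s) \<le> 2 * s * t - 2 * s\<^sup>2"
      using s st by (simp add: ln_div)
    moreover have "xlnx u - u * ln v = - (2 * s\<^sup>2 * (ln t - ln s))"
      unfolding st(3,4) using s st by (simp add: ln_realpow algebra_simps)
    ultimately show ?thesis unfolding st(3,4) by (simp add: power2_eq_square algebra_simps)
  qed
  from 2 3 show ?thesis by linarith
qed

lemma kl_nonneg:
  fixes u v :: real
  assumes "0 \<le> u" "0 < v"
  shows "0 \<le> xlnx u - u * ln v - u + v"
proof -
  have "0 \<le> (u - v)\<^sup>2 / (4 * max u v)" using assms by auto
  also have "\<dots> \<le> xlnx u - u * ln v - u + v" by (rule kl_lower_bound) (use assms in auto)
  finally show ?thesis .
qed

text \<open>The gap in Jensen's inequality for three points is the sum of their divergences from the mean,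
  and none of them exceeds three times the mean.\<close>

lemma entropy_gap:
  fixes y1 y2 y3 :: real
  assumes "0 \<le> y1" "0 \<le> y2" "0 \<le> y3"
  defines "m \<equiv> (y1 + y2 + y3) / 3"
  shows "((y1 - m)\<^sup>2 + (y2 - m)\<^sup>2 + (y3 - m)\<^sup>2) / (12 * m) \<le> xlnx y1 + xlnx y2 + xlnx y3 - 3 * xlnx m"
proof (cases "m = 0")
  case True
  then have "y1 = 0 \<and> y2 = 0 \<and> y3 = 0" using assms by auto
  then show ?thesis using True by simp
next
  case False
  have m: "0 < m" using False assms by (auto simp: m_def)
  have le: "y1 \<le> 3 * m" "y2 \<le> 3 * m" "y3 \<le> 3 * m" using assms by (auto simp: m_def)
  have "(y - m)\<^sup>2 / (12 * m) \<le> xlnx y - y * ln m - y + m" if "0 \<le> y" "y \<le> 3 * m" for y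
    using kl_lower_bound[OF that(1) m that(2)] m by simp
  from this[OF assms(1) le(1)] this[OF assms(2) le(2)] this[OF assms(3) le(3)]
  have "((y1 - m)\<^sup>2 + (y2 - m)\<^sup>2 + (y3 - m)\<^sup>2) / (12 * m)
     \<le> xlnx y1 + xlnx y2 + xlnx y3 - (y1 + y2 + y3) * ln m - (y1 + y2 + y3) + 3 * m"
    by (simp add: add_divide_distrib algebra_simps)
  moreover have "y1 + y2 + y3 = 3 * m" by (simp add: m_def)
  ultimately show ?thesis by simp
qed

lemma entropy_gap_nonneg:
  fixes y1 y2 y3 :: real
  assumes "0 \<le> y1" "0 \<le> y2" "0 \<le> y3"
  shows "0 \<le> xlnx y1 + xlnx y2 + xlnx y3 - 3 * xlnx ((y1 + y2 + y3) / 3)"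
proof -
  have "0 \<le> ((y1 - (y1 + y2 + y3) / 3)\<^sup>2 + (y2 - (y1 + y2 + y3) / 3)\<^sup>2
    + (y3 - (y1 + y2 + y3) / 3)\<^sup>2) / (12 * ((y1 + y2 + y3) / 3))"
    using assms by (intro divide_nonneg_nonneg) auto
  then show ?thesis using entropy_gap[OF assms] by linarith
qed

lemma weighted_amgm:
  fixes m s t k :: real
  assumes "0 < m" "0 < k"
  shows "2 * k * \<bar>s * t\<bar> \<le> m * s\<^sup>2 + k\<^sup>2 * t\<^sup>2 / m"
proof -
  have "0 \<le> (m * \<bar>s\<bar> - k * \<bar>t\<bar>)\<^sup>2 / m" using assms by simp
  also have "\<dots> = m * s\<^sup>2 + k\<^sup>2 * t\<^sup>2 / m - 2 * k * \<bar>s * t\<bar>"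
    using assms by (simp add: power2_diff power_mult_distrib abs_mult field_simps power2_eq_square)
  finally show ?thesis by simp
qed

text \<open>This is the heart of the convergence rate: the Jensen gap over three points bounds the area of
  their triangle, although \<open>y x\<^sup>2\<close> alone is not even convex. Around the centroid, the term
  \<open>y x\<^sup>2\<close> contributes \<open>m \<Sum> a\<^sub>k\<^sup>2\<close> up to an error of \<open>3 \<Sum> \<bar>a\<^sub>k b\<^sub>k\<bar>\<close> because \<open>x\<close> stays in the unit interval,
  and the entropy contributes a large multiple of \<open>\<Sum> b\<^sub>k\<^sup>2 / m\<close>. By the inequality of the arithmetic and
  geometric means these dominate both the error and the products that make up the area.\<close>

lemma area_convexity_entry:
  fixes x1 x2 x3 y1 y2 y3 :: real
  assumes x: "0 \<le> x1" "x1 \<le> 1" "0 \<le> x2" "x2 \<le> 1" "0 \<le> x3" "x3 \<le> 1"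
    and y: "0 \<le> y1" "0 \<le> y2" "0 \<le> y3"
  shows "2 * \<bar>(y2 - y1) * (x2 - x3) - (x2 - x1) * (y2 - y3)\<bar>
    \<le> 6 * (y1 * x1\<^sup>2 + y2 * x2\<^sup>2 + y3 * x3\<^sup>2 - 3 * ((y1 + y2 + y3) / 3 * ((x1 + x2 + x3) / 3)\<^sup>2))
      + 360 * (xlnx y1 + xlnx y2 + xlnx y3 - 3 * xlnx ((y1 + y2 + y3) / 3))"
proof (cases "y1 + y2 + y3 = 0")
  case True
  then have "y1 = 0 \<and> y2 = 0 \<and> y3 = 0" using y by auto
  then show ?thesis by simp
next
  case False
  define m c where "m = (y1 + y2 + y3) / 3" and "c = (x1 + x2 + x3) / 3"
  have m: "0 < m" using False y by (auto simp: m_def)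
  define a1 a2 a3 where "a1 = x1 - c" and "a2 = x2 - c" and "a3 = x3 - c"
  define b1 b2 b3 where "b1 = y1 - m" and "b2 = y2 - m" and "b3 = y3 - m"
  have sums: "a1 + a2 + a3 = 0" "b1 + b2 + b3 = 0"
    by (simp_all add: a1_def a2_def a3_def b1_def b2_def b3_def m_def c_def field_simps)
  have c: "0 \<le> c" "c \<le> 1" and a: "\<bar>a1\<bar> \<le> 1" "\<bar>a2\<bar> \<le> 1" "\<bar>a3\<bar> \<le> 1"
    using x unfolding c_def a1_def a2_def a3_def by (auto simp: abs_le_iff field_simps)
  have xs: "x1 = c + a1" "x2 = c + a2" "x3 = c + a3" and ys: "y1 = m + b1" "y2 = m + b2" "y3 = m + b3"
    by (auto simp: a1_def a2_def a3_def b1_def b2_def b3_def)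
  have ent: "(b1\<^sup>2 + b2\<^sup>2 + b3\<^sup>2) / (12 * m) \<le> xlnx y1 + xlnx y2 + xlnx y3 - 3 * xlnx m"
    using entropy_gap[OF y] by (simp add: m_def b1_def b2_def b3_def)
  have a3: "a3 = - a1 - a2" and b3: "b3 = - b1 - b2" using sums by auto
  have quad: "y1 * x1\<^sup>2 + y2 * x2\<^sup>2 + y3 * x3\<^sup>2 - 3 * (m * c\<^sup>2)
    = m * (a1\<^sup>2 + a2\<^sup>2 + a3\<^sup>2) + ((2 * c + a1) * (a1 * b1) + (2 * c + a2) * (a2 * b2) + (2 * c + a3) * (a3 * b3))"
    unfolding xs ys a3 b3 by (simp add: power2_eq_square algebra_simps)
  have t: "- (3 * \<bar>s * r\<bar>) \<le> (2 * c + s) * (s * r)" if "\<bar>s\<bar> \<le> 1" for s r :: real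
  proof -
    have "\<bar>(2 * c + s) * (s * r)\<bar> \<le> 3 * \<bar>s * r\<bar>"
      unfolding abs_mult[of "2 * c + s"] using that c by (intro mult_right_mono) auto
    then show ?thesis by linarith
  qed
  have "2 * ((y2 - y1) * (x2 - x3) - (x2 - x1) * (y2 - y3)) = 6 * (a1 * b2 - a2 * b1)"
    unfolding xs ys a3 b3 by (simp add: algebra_simps)
  then have "(y2 - y1) * (x2 - x3) - (x2 - x1) * (y2 - y3) = 3 * (a1 * b2 - a2 * b1)" by simp
  then have det: "2 * \<bar>(y2 - y1) * (x2 - x3) - (x2 - x1) * (y2 - y3)\<bar> \<le> 6 * (\<bar>a1 * b2\<bar> + \<bar>a2 * b1\<bar>)"
    using abs_triangle_ineq4[of "a1 * b2" "a2 * b1"] by (simp only: abs_mult[of 3]) simp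
  \<comment> \<open>The entropy provides \<open>30 r\<^sup>2 / m\<close> per point. The error term \<open>18 \<bar>s r\<bar>\<close> takes \<open>27 r\<^sup>2 / m\<close> of it, by the
    second inequality, and the area takes the rest, by the first.\<close>
  have am1: "2 * \<bar>s * r\<bar> \<le> m * s\<^sup>2 + r\<^sup>2 / m" for s r
    using weighted_amgm[OF m, of 1 s r] by simp
  have am3: "6 * \<bar>s * r\<bar> \<le> m * s\<^sup>2 + 9 * r\<^sup>2 / m" for s r
    using weighted_amgm[OF m, of 3 s r] by simp
  have pos: "0 \<le> m * a3\<^sup>2" "0 \<le> b3\<^sup>2 / m" using m by auto
  have e: "360 * ((b1\<^sup>2 + b2\<^sup>2 + b3\<^sup>2) / (12 * m)) = 30 * (b1\<^sup>2 / m) + 30 * (b2\<^sup>2 / m) + 30 * (b3\<^sup>2 / m)"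
    using m by (simp add: field_simps)
  have "6 * (\<bar>a1 * b2\<bar> + \<bar>a2 * b1\<bar>) \<le>
    6 * (m * (a1\<^sup>2 + a2\<^sup>2 + a3\<^sup>2) + ((2 * c + a1) * (a1 * b1) + (2 * c + a2) * (a2 * b2) + (2 * c + a3) * (a3 * b3)))
    + 360 * ((b1\<^sup>2 + b2\<^sup>2 + b3\<^sup>2) / (12 * m))"
    using am1[of a1 b2] am1[of a2 b1] am3[of a1 b1] am3[of a2 b2] am3[of a3 b3]
      t[OF a(1), of b1] t[OF a(2), of b2] t[OF a(3), of b3] pos
    unfolding e distrib_left by simp
  also have "\<dots> \<le> 6 * (y1 * x1\<^sup>2 + y2 * x2\<^sup>2 + y3 * x3\<^sup>2 - 3 * (m * c\<^sup>2))
      + 360 * (xlnx y1 + xlnx y2 + xlnx y3 - 3 * xlnx m)"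
    unfolding quad by (intro add_left_mono mult_left_mono ent) auto
  finally show ?thesis using det unfolding m_def c_def by linarith
qed

text \<open>If \<open>u\<close> is not much smaller than \<open>y\<close>, the term \<open>- u d\<^sup>2\<close> completes a square; otherwise \<open>\<bar>d\<bar> \<le> 1\<close>
  and the divergence itself is of the order of \<open>y\<close>.\<close>

lemma quadratic_vs_kl:
  fixes u y d s :: real
  assumes u: "0 \<le> u" and y: "0 < y" and s: "0 \<le> s" "s \<le> 1" and d: "\<bar>d\<bar> \<le> 1"
  shows "2 * (y - u) * s * d - u * d\<^sup>2 \<le> 16 * (xlnx u - u * ln y - u + y)"
proof -
  define m where "m = max u y"
  have m: "0 < m" "u \<le> m" "y \<le> m" using y by (auto simp: m_def)
  have sd: "\<bar>s * d\<bar> \<le> \<bar>d\<bar>" unfolding abs_mult using s by (intro mult_left_le_one_le) auto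
  have "2 * (y - u) * s * d \<le> 2 * (\<bar>y - u\<bar> * \<bar>s * d\<bar>)"
  proof -
    have "2 * (y - u) * s * d = 2 * ((y - u) * (s * d))" by simp
    also have "\<dots> \<le> 2 * \<bar>(y - u) * (s * d)\<bar>" by (intro mult_left_mono abs_ge_self) auto
    finally show ?thesis by (simp only: abs_mult)
  qed
  also have "\<dots> \<le> 2 * (\<bar>y - u\<bar> * \<bar>d\<bar>)" using sd by (intro mult_left_mono) auto
  finally have 1: "2 * (y - u) * s * d \<le> 2 * \<bar>d * (y - u)\<bar>" by (simp add: abs_mult mult.commute)
  have "2 * \<bar>d * (y - u)\<bar> - u * d\<^sup>2 \<le> 4 * ((u - y)\<^sup>2 / m)"
  proof (cases "y \<le> 2 * u")
    case True
    then have up: "0 < u" "m \<le> 2 * u" using y by (auto simp: m_def)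
    have "2 * \<bar>d * (y - u)\<bar> \<le> u * d\<^sup>2 + (y - u)\<^sup>2 / u" using weighted_amgm[OF up(1), of 1 d "y - u"] by simp
    moreover have "(y - u)\<^sup>2 / u \<le> 4 * ((u - y)\<^sup>2 / m)"
    proof -
      have "(y - u)\<^sup>2 * m \<le> (y - u)\<^sup>2 * (4 * u)" using up by (intro mult_left_mono) auto
      then show ?thesis using up m by (simp add: field_simps power2_commute)
    qed
    ultimately show ?thesis by linarith
  next
    case False
    then have my: "m = y" and h: "y \<le> 2 * (y - u)" "0 < y - u" using u by (auto simp: m_def)
    have "2 * \<bar>d * (y - u)\<bar> \<le> 2 * (y - u)"
    proof -
      have "\<bar>d\<bar> * (y - u) \<le> 1 * (y - u)" using d h by (intro mult_right_mono) auto
      moreover have "\<bar>d * (y - u)\<bar> = \<bar>d\<bar> * (y - u)" using h by (simp add: abs_mult)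
      ultimately show ?thesis by linarith
    qed
    also have "\<dots> \<le> 4 * ((u - y)\<^sup>2 / m)"
    proof -
      have "(y - u) * y \<le> (y - u) * (2 * (y - u))" using h by (intro mult_left_mono) auto
      then have "(y - u) * y \<le> 2 * (u - y)\<^sup>2" by (simp add: power2_eq_square algebra_simps)
      then show ?thesis using my y by (simp add: field_simps)
    qed
    finally show ?thesis using u by (smt (verit) mult_nonneg_nonneg zero_le_power2)
  qed
  moreover have "4 * ((u - y)\<^sup>2 / m) \<le> 16 * (xlnx u - u * ln y - u + y)"
    using kl_lower_bound[OF u y m(2,3)] m by (simp add: field_simps)
  ultimately show ?thesis using 1 by linarith
qed

section \<open>An area-convex saddle-point problem\<close>

text \<open>A matrix is a family of \<open>N\<close> entries with row and column keys. Both matrix-vector products are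
  then sums over all entries that share a key, so no dense indexing ever appears.\<close>

definition gsum :: "nat \<Rightarrow> (nat \<Rightarrow> nat) \<Rightarrow> (nat \<Rightarrow> real) \<Rightarrow> nat \<Rightarrow> real" where
  "gsum N key v k = (\<Sum>e | e < N \<and> key e = k. v e)"

lemma sum_mult_gsum:
  "(\<Sum>k\<in>key ` {..<N}. g k * gsum N key v k) = (\<Sum>e<N. g (key e) * v e)"
proof -
  have "(\<Sum>e<N. g (key e) * v e) = (\<Sum>k\<in>key ` {..<N}. \<Sum>e\<in>{e\<in>{..<N}. key e = k}. g (key e) * v e)"
    by (rule sum.image_gen) simp
  also have "\<dots> = (\<Sum>k\<in>key ` {..<N}. g k * gsum N key v k)"
    by (auto simp: gsum_def sum_distrib_left intro!: sum.cong)
  finally show ?thesis by simp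
qed

text \<open>The constraints are \<open>(A x)\<^sub>i \<le> b\<^sub>i\<close> for \<open>x\<close> in the unit box, where entry \<open>e\<close> puts the coefficient
  \<open>co e\<close> into row \<open>ri e\<close> and column \<open>ci e\<close>. Their feasibility is the game in which \<open>x\<close> minimizes and a
  probability vector \<open>y\<close> on the rows maximizes \<open>y \<bullet> (A x - b)\<close>.\<close>

locale sparse_game =
  fixes N :: nat and ri ci :: "nat \<Rightarrow> nat" and co b :: "nat \<Rightarrow> real" and W :: real
  assumes N_pos: "0 < N"
    and co_nonzero: "e < N \<Longrightarrow> co e \<noteq> 0"
    and co_le: "e < N \<Longrightarrow> \<bar>co e\<bar> \<le> 1"
    and row_card: "real (card {e. e < N \<and> ri e = i}) \<le> W"
begin

definition R where "R = ri ` {..<N}"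
definition J where "J = ci ` {..<N}"

lemma finite_RJ [simp]: "finite R" "finite J" by (simp_all add: R_def J_def)
lemma ri_R [simp]: "e < N \<Longrightarrow> ri e \<in> R" and ci_J [simp]: "e < N \<Longrightarrow> ci e \<in> J"
  by (simp_all add: R_def J_def)

lemma sum_R: "(\<Sum>i\<in>R. y i * gsum N ri v i) = (\<Sum>e<N. y (ri e) * v e)"
  unfolding R_def by (rule sum_mult_gsum)

lemma sum_J: "(\<Sum>j\<in>J. x j * gsum N ci v j) = (\<Sum>e<N. x (ci e) * v e)"
  unfolding J_def by (rule sum_mult_gsum)

lemma W_ge_1: "1 \<le> W"
proof -
  have "card {e. e < N \<and> ri e = ri 0} > 0" using N_pos by (subst card_gt_0_iff) auto
  then show ?thesis using row_card[of "ri 0"] by linarith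
qed

lemma row_abs_sum: "gsum N ri (\<lambda>e. \<bar>co e\<bar>) i \<le> W"
proof -
  have "gsum N ri (\<lambda>e. \<bar>co e\<bar>) i \<le> (\<Sum>e | e < N \<and> ri e = i. 1)"
    unfolding gsum_def by (intro sum_mono) (auto simp: co_le)
  also have "\<dots> \<le> W" using row_card[of i] by simp
  finally show ?thesis .
qed

lemma sum_rows_le:
  assumes "\<And>i. i \<in> R \<Longrightarrow> 0 \<le> g i"
  shows "(\<Sum>e<N. \<bar>co e\<bar> * g (ri e)) \<le> W * (\<Sum>i\<in>R. g i)"
proof -
  have "(\<Sum>e<N. \<bar>co e\<bar> * g (ri e)) = (\<Sum>i\<in>R. g i * gsum N ri (\<lambda>e. \<bar>co e\<bar>) i)"
    unfolding sum_R by (simp add: mult.commute)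
  also have "\<dots> \<le> (\<Sum>i\<in>R. g i * W)"
    by (intro sum_mono mult_left_mono row_abs_sum assms)
  finally show ?thesis by (simp add: sum_distrib_left mult.commute)
qed

definition feas :: "(nat \<Rightarrow> real) \<Rightarrow> (nat \<Rightarrow> real) \<Rightarrow> bool" where
  "feas x y \<longleftrightarrow> (\<forall>j. 0 \<le> x j \<and> x j \<le> 1) \<and> (\<forall>i. 0 \<le> y i) \<and> (\<Sum>i\<in>R. y i) = 1"

text \<open>The bilinear form \<open>y \<bullet> A x\<close> of the game.\<close>

definition bil :: "(nat \<Rightarrow> real) \<Rightarrow> (nat \<Rightarrow> real) \<Rightarrow> real" where
  "bil x y = (\<Sum>e<N. co e * (y (ri e) * x (ci e)))"

text \<open>The box has no strongly convex regularizer of small range in the maximum norm. Weighting \<open>x\<^sub>j\<^sup>2\<close> by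
  the mass that \<open>y\<close> puts on column \<open>j\<close> keeps the range of order \<open>W ln N\<close>; the price is that only a
  three-point form of strong convexity is available, which relates \<open>x\<close> and \<open>y\<close>.\<close>

definition reg :: "(nat \<Rightarrow> real) \<Rightarrow> (nat \<Rightarrow> real) \<Rightarrow> real" where
  "reg x y = 6 * (\<Sum>e<N. \<bar>co e\<bar> * (y (ri e) * (x (ci e))\<^sup>2)) + 360 * W * (\<Sum>i\<in>R. xlnx (y i))"

definition lin :: "(nat \<Rightarrow> real) \<Rightarrow> (nat \<Rightarrow> real) \<Rightarrow> (nat \<Rightarrow> real) \<Rightarrow> (nat \<Rightarrow> real) \<Rightarrow> real" where
  "lin l q x y = (\<Sum>j\<in>J. l j * x j) + (\<Sum>i\<in>R. q i * y i)"

definition obj where "obj l q x y = lin l q x y + reg x y"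

text \<open>The pair of \<open>gx\<close> and \<open>gy\<close> is the gradient operator of the game: the gradient in \<open>x\<close> and the
  negated gradient in \<open>y\<close>.\<close>

definition gx :: "(nat \<Rightarrow> real) \<Rightarrow> nat \<Rightarrow> real" where
  "gx y = gsum N ci (\<lambda>e. co e * y (ri e))"

definition gy :: "(nat \<Rightarrow> real) \<Rightarrow> nat \<Rightarrow> real" where
  "gy x i = b i - gsum N ri (\<lambda>e. co e * x (ci e)) i"

lemma lin_g: "lin (gx y) (gy x) x' y' = bil x' y - bil x y' + (\<Sum>i\<in>R. b i * y' i)"
proof -
  have 1: "(\<Sum>j\<in>J. gx y j * x' j) = bil x' y"
    using sum_J[of x' "\<lambda>e. co e * y (ri e)"] unfolding gx_def bil_def by (simp add: mult_ac)
  have "(\<Sum>i\<in>R. gsum N ri (\<lambda>e. co e * x (ci e)) i * y' i) = bil x y'"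
    using sum_R[of y' "\<lambda>e. co e * x (ci e)"] unfolding bil_def by (simp add: mult_ac)
  then have "(\<Sum>i\<in>R. gy x i * y' i) = (\<Sum>i\<in>R. b i * y' i) - bil x y'"
    unfolding gy_def by (simp add: left_diff_distrib sum_subtractf)
  then show ?thesis unfolding lin_def 1 by simp
qed

lemma lin_add: "lin (\<lambda>j. l j + c * l' j) (\<lambda>i. q i + c * q' i) x y = lin l q x y + c * lin l' q' x y"
  unfolding lin_def by (simp add: distrib_right sum.distrib sum_distrib_left mult.assoc distrib_left)

lemma lin_mean: "3 * lin l q (\<lambda>j. (x1 j + x2 j + x3 j) / 3) (\<lambda>i. (y1 i + y2 i + y3 i) / 3)
   = lin l q x1 y1 + lin l q x2 y2 + lin l q x3 y3"
  unfolding lin_def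
  by (simp add: sum_distrib_left sum.distrib[symmetric] distrib_left[symmetric] add_divide_distrib
      flip: add.assoc)
     (simp add: distrib_left sum.distrib)

lemma feas_mean:
  assumes "feas x1 y1" "feas x2 y2" "feas x3 y3"
  shows "feas (\<lambda>j. (x1 j + x2 j + x3 j) / 3) (\<lambda>i. (y1 i + y2 i + y3 i) / 3)"
proof -
  have "(\<Sum>i\<in>R. (y1 i + y2 i + y3 i) / 3) = ((\<Sum>i\<in>R. y1 i) + (\<Sum>i\<in>R. y2 i) + (\<Sum>i\<in>R. y3 i)) / 3"
    by (simp add: sum.distrib sum_divide_distrib add_divide_distrib)
  moreover have "(x1 j + x2 j + x3 j) / 3 \<le> 1" for j
  proof -
    have "x1 j \<le> 1" "x2 j \<le> 1" "x3 j \<le> 1" using assms by (auto simp: feas_def)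
    then show ?thesis by simp
  qed
  ultimately show ?thesis using assms by (simp add: feas_def)
qed

text \<open>Both the regularizer and the area decompose over the entries, up to a convex surplus: row \<open>i\<close> carries
  entropy with weight \<open>360 W\<close> while its entries only consume \<open>360 \<Sum> \<bar>co e\<bar> \<le> 360 W\<close> of it.\<close>

lemma area_convexity:
  assumes z: "feas xz yz" and w: "feas xw yw" and v: "feas xv yv"
  shows "2 * (bil (\<lambda>j. xw j - xv j) (\<lambda>i. yw i - yz i) - bil (\<lambda>j. xw j - xz j) (\<lambda>i. yw i - yv i))
   \<le> reg xz yz + reg xw yw + reg xv yv
      - 3 * reg (\<lambda>j. (xz j + xw j + xv j) / 3) (\<lambda>i. (yz i + yw i + yv i) / 3)"
    (is "?L \<le> ?Rhs")
proof -
  define gap where "gap i = xlnx (yz i) + xlnx (yw i) + xlnx (yv i) - 3 * xlnx ((yz i + yw i + yv i) / 3)" for i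
  define qd where "qd e = yz (ri e) * (xz (ci e))\<^sup>2 + yw (ri e) * (xw (ci e))\<^sup>2 + yv (ri e) * (xv (ci e))\<^sup>2
     - 3 * ((yz (ri e) + yw (ri e) + yv (ri e)) / 3 * ((xz (ci e) + xw (ci e) + xv (ci e)) / 3)\<^sup>2)" for e
  define dt where "dt e = (yw (ri e) - yz (ri e)) * (xw (ci e) - xv (ci e))
     - (xw (ci e) - xz (ci e)) * (yw (ri e) - yv (ri e))" for e
  have gap0: "0 \<le> gap i" for i
    unfolding gap_def by (rule entropy_gap_nonneg) (use z w v in \<open>auto simp: feas_def\<close>)
  have entry: "2 * (co e * dt e) \<le> \<bar>co e\<bar> * (6 * qd e) + 360 * (\<bar>co e\<bar> * gap (ri e))" for e
  proof -
    have "2 * \<bar>dt e\<bar> \<le> 6 * qd e + 360 * gap (ri e)"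
      unfolding dt_def qd_def gap_def
      by (rule area_convexity_entry) (use z w v in \<open>auto simp: feas_def\<close>)
    then have "\<bar>co e\<bar> * (2 * \<bar>dt e\<bar>) \<le> \<bar>co e\<bar> * (6 * qd e + 360 * gap (ri e))"
      by (intro mult_left_mono) auto
    moreover have "co e * dt e \<le> \<bar>co e\<bar> * \<bar>dt e\<bar>" by (metis abs_ge_self abs_mult)
    ultimately show ?thesis by (simp add: algebra_simps)
  qed
  have "?L = (\<Sum>e<N. 2 * (co e * dt e))"
    unfolding bil_def dt_def by (simp add: sum_distrib_left sum_subtractf[symmetric] algebra_simps)
  also have "\<dots> \<le> (\<Sum>e<N. \<bar>co e\<bar> * (6 * qd e)) + 360 * (\<Sum>e<N. \<bar>co e\<bar> * gap (ri e))"
    using sum_mono[of "{..<N}", OF entry] by (simp add: sum.distrib sum_distrib_left)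
  also have "\<dots> \<le> (\<Sum>e<N. \<bar>co e\<bar> * (6 * qd e)) + 360 * (W * (\<Sum>i\<in>R. gap i))"
    using sum_rows_le[of gap] gap0 by simp
  also have "\<dots> = ?Rhs"
  proof -
    have "(\<Sum>e<N. \<bar>co e\<bar> * (6 * qd e)) =
        6 * (\<Sum>e<N. \<bar>co e\<bar> * (yz (ri e) * (xz (ci e))\<^sup>2)) + 6 * (\<Sum>e<N. \<bar>co e\<bar> * (yw (ri e) * (xw (ci e))\<^sup>2))
      + 6 * (\<Sum>e<N. \<bar>co e\<bar> * (yv (ri e) * (xv (ci e))\<^sup>2))
      - 3 * (6 * (\<Sum>e<N. \<bar>co e\<bar> * ((yz (ri e) + yw (ri e) + yv (ri e)) / 3
           * ((xz (ci e) + xw (ci e) + xv (ci e)) / 3)\<^sup>2)))"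
      unfolding sum_distrib_left sum.distrib[symmetric] sum_subtractf[symmetric] qd_def
      by (intro sum.cong refl) (simp only: algebra_simps)
    moreover have "(\<Sum>i\<in>R. gap i) = (\<Sum>i\<in>R. xlnx (yz i)) + (\<Sum>i\<in>R. xlnx (yw i)) + (\<Sum>i\<in>R. xlnx (yv i))
      - 3 * (\<Sum>i\<in>R. xlnx ((yz i + yw i + yv i) / 3))"
      unfolding sum_distrib_left sum.distrib[symmetric] sum_subtractf[symmetric] gap_def by simp
    moreover have "360 * (W * (s1 + s2 + s3 - 3 * s4))
      = 360 * W * s1 + 360 * W * s2 + 360 * W * s3 - 3 * (360 * W * s4)" for s1 s2 s3 s4
      by (simp add: algebra_simps)
    ultimately show ?thesis unfolding reg_def by simp
  qed
  finally show ?thesis .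
qed

section \<open>Dual extrapolation\<close>

text \<open>An approximate minimizer of the regularized linear function, with additive error \<open>\<delta>\<close>. Both
  oracle calls of the method below tolerate such an error.\<close>

definition near_min :: "(nat \<Rightarrow> real) \<Rightarrow> (nat \<Rightarrow> real) \<Rightarrow> real \<Rightarrow> (nat \<Rightarrow> real) \<Rightarrow> (nat \<Rightarrow> real) \<Rightarrow> bool" where
  "near_min l q \<delta> x y \<longleftrightarrow> feas x y \<and> (\<forall>x' y'. feas x' y' \<longrightarrow> obj l q x y \<le> obj l q x' y' + \<delta>)"

text \<open>Evaluating the near-minimality of \<open>z\<close> at the centroid of \<open>z\<close>, \<open>w\<close> and \<open>v\<close>, that of \<open>w\<close> at \<open>v\<close>, and
  using area convexity for the triangle, all terms that contain \<open>g z\<close> cancel. What remains says that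
  adding the gradient at \<open>w\<close> to the dual vector raises the minimum of the regularized function by at
  least the payoff of \<open>w\<close>, up to \<open>2 \<delta>\<close>.\<close>

lemma extrapolation_step:
  fixes \<delta> :: real
  assumes z: "near_min l q \<delta> xz yz"
    and w: "near_min (\<lambda>j. l j + 2 * gx yz j) (\<lambda>i. q i + 2 * gy xz i) \<delta> xw yw"
    and v: "feas xv yv"
  shows "obj l q xz yz - 2 * \<delta> + (\<Sum>i\<in>R. b i * yw i)
    \<le> obj (\<lambda>j. l j + 1 * gx yw j) (\<lambda>i. q i + 1 * gy xw i) xv yv"
proof -
  define xm ym where "xm = (\<lambda>j. (xz j + xw j + xv j) / 3)" and "ym = (\<lambda>i. (yz i + yw i + yv i) / 3)"
  have fz: "feas xz yz" and fw: "feas xw yw" using z w by (auto simp: near_min_def)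
  have fm: "feas xm ym" unfolding xm_def ym_def by (rule feas_mean[OF fz fw v])
  have 1: "obj l q xz yz \<le> obj l q xm ym + \<delta>" using z fm by (auto simp: near_min_def)
  have 2: "obj (\<lambda>j. l j + 2 * gx yz j) (\<lambda>i. q i + 2 * gy xz i) xw yw
    \<le> obj (\<lambda>j. l j + 2 * gx yz j) (\<lambda>i. q i + 2 * gy xz i) xv yv + \<delta>"
    using w v by (auto simp: near_min_def)
  have 3: "3 * lin l q xm ym = lin l q xz yz + lin l q xw yw + lin l q xv yv"
    unfolding xm_def ym_def by (rule lin_mean)
  have 4: "2 * (bil (\<lambda>j. xw j - xv j) (\<lambda>i. yw i - yz i) - bil (\<lambda>j. xw j - xz j) (\<lambda>i. yw i - yv i))
    \<le> reg xz yz + reg xw yw + reg xv yv - 3 * reg xm ym"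
    unfolding xm_def ym_def by (rule area_convexity[OF fz fw v])
  have bil_diff: "bil (\<lambda>j. x j - x' j) (\<lambda>i. y i - y' i) = bil x y - bil x y' - bil x' y + bil x' y'"
    for x x' y y'
    unfolding bil_def by (simp add: sum_subtractf[symmetric] sum.distrib[symmetric] algebra_simps)
  show ?thesis
    using 1 2 3 4 unfolding obj_def lin_add lin_g bil_diff by argo
qed

lemma reg_upper:
  assumes "\<And>j. 0 \<le> x j \<and> x j \<le> 1" "i \<in> R"
  shows "reg x (\<lambda>k. if k = i then 1 else 0) \<le> 6 * W"
proof -
  have "(\<Sum>e<N. \<bar>co e\<bar> * ((if ri e = i then 1 else 0) * (x (ci e))\<^sup>2))
    \<le> (\<Sum>e<N. \<bar>co e\<bar> * (if ri e = i then 1 else 0))"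
    using assms(1) by (intro sum_mono mult_left_mono) (auto simp: power_le_one)
  also have "\<dots> \<le> W * (\<Sum>k\<in>R. if k = i then 1 else 0)" by (rule sum_rows_le) auto
  also have "\<dots> = W" using assms(2) by simp
  finally have 1: "(\<Sum>e<N. \<bar>co e\<bar> * ((if ri e = i then 1 else 0) * (x (ci e))\<^sup>2)) \<le> W" .
  have 2: "(\<Sum>k\<in>R. xlnx (if k = i then 1 else 0)) = 0" by (intro sum.neutral) auto
  show ?thesis unfolding reg_def 2 using 1 by simp
qed

text \<open>Starting proportionally to the row sizes instead of uniformly avoids counting the rows, and its
  divergence from every distribution is still at most \<open>ln N\<close>.\<close>

definition y0 :: "nat \<Rightarrow> real" where "y0 i = real (card {e. e < N \<and> ri e = i}) / real N"

lemma y0_pos: "i \<in> R \<Longrightarrow> 0 < y0 i"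
  using N_pos by (auto simp: y0_def R_def card_gt_0_iff intro!: divide_pos_pos)

lemma sum_y0: "(\<Sum>i\<in>R. y0 i) = 1"
proof -
  have "(\<Sum>i\<in>R. 1 * gsum N ri (\<lambda>e. 1) i) = real N" unfolding sum_R by simp
  then show ?thesis using N_pos by (simp add: y0_def gsum_def sum_divide_distrib[symmetric])
qed

lemma kl_sum_nonneg:
  assumes "\<And>i. i \<in> R \<Longrightarrow> 0 \<le> u i" "\<And>i. i \<in> R \<Longrightarrow> 0 < y i" "(\<Sum>i\<in>R. u i) = 1" "(\<Sum>i\<in>R. y i) = 1"
  shows "0 \<le> (\<Sum>i\<in>R. xlnx (u i) - u i * ln (y i))"
proof -
  have "0 \<le> (\<Sum>i\<in>R. xlnx (u i) - u i * ln (y i) - u i + y i)"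
    using assms by (intro sum_nonneg kl_nonneg) auto
  then show ?thesis using assms by (simp add: sum.distrib sum_subtractf)
qed

lemma kl_y0:
  assumes "feas x u"
  shows "(\<Sum>i\<in>R. xlnx (u i) - u i * ln (y0 i)) \<le> ln N"
proof -
  have u1: "u i \<le> 1" if "i \<in> R" for i
  proof -
    have "u i \<le> (\<Sum>i\<in>R. u i)" using that assms by (intro member_le_sum) (auto simp: feas_def)
    then show ?thesis using assms by (simp add: feas_def)
  qed
  have "xlnx (u i) - u i * ln (y0 i) \<le> u i * ln N" if "i \<in> R" for i
  proof -
    have "1 \<le> card {e. e < N \<and> ri e = i}"
      using that by (auto simp: R_def Suc_le_eq card_gt_0_iff)
    then have "ln (1 / N) \<le> ln (y0 i)" using N_pos y0_pos[OF that]
      by (subst ln_le_cancel_iff) (auto simp: y0_def divide_right_mono)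
    then have "- ln N \<le> ln (y0 i)" using N_pos by (simp add: ln_div)
    then have "u i * (- ln N) \<le> u i * ln (y0 i)" using assms by (intro mult_left_mono) (auto simp: feas_def)
    moreover have "xlnx (u i) \<le> 0"
    proof (cases "u i = 0")
      case False
      then have "0 < u i" using assms by (auto simp: feas_def less_le)
      then have "ln (u i) \<le> 0" using u1[OF that] by simp
      then show ?thesis using \<open>0 < u i\<close> by (simp add: mult_nonneg_nonpos)
    qed simp
    ultimately show ?thesis by simp
  qed
  then have "(\<Sum>i\<in>R. xlnx (u i) - u i * ln (y0 i)) \<le> (\<Sum>i\<in>R. u i * ln N)" by (rule sum_mono)
  also have "\<dots> = ln N" using assms by (simp add: feas_def sum_distrib_right[symmetric])
  finally show ?thesis .
qed

lemma reg_lower: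
  assumes f: "feas x y"
  shows "- 360 * W * ln N \<le> reg x y"
proof -
  have cR: "0 < card R" using N_pos by (auto simp: R_def card_gt_0_iff)
  have "card R \<le> N" unfolding R_def using card_image_le[of "{..<N}" ri] by simp
  then have "ln (card R) \<le> ln N" using cR by simp
  have "0 \<le> (\<Sum>i\<in>R. xlnx (y i) - y i * ln (1 / card R))"
    by (rule kl_sum_nonneg) (use f cR in \<open>auto simp: feas_def\<close>)
  also have "\<dots> = (\<Sum>i\<in>R. xlnx (y i)) + ln (card R)"
    using f cR by (simp add: feas_def sum_subtractf sum_distrib_right[symmetric] ln_div sum_negf)
  finally have "- ln N \<le> (\<Sum>i\<in>R. xlnx (y i))" using \<open>ln (card R) \<le> ln N\<close> by simp
  then have "360 * W * (- ln N) \<le> 360 * W * (\<Sum>i\<in>R. xlnx (y i))"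
    using W_ge_1 by (intro mult_left_mono) auto
  moreover have "0 \<le> (\<Sum>e<N. \<bar>co e\<bar> * (y (ri e) * (x (ci e))\<^sup>2))"
    using f by (intro sum_nonneg mult_nonneg_nonneg) (auto simp: feas_def)
  ultimately show ?thesis unfolding reg_def by simp
qed

text \<open>Summing the steps, the accumulated payoff is at most the value of the final regularized function
  at the pair of a feasible \<open>x\<close> and the indicator of row \<open>i\<close>. This pair costs \<open>6 W\<close>, the initial minimum
  is at least \<open>- 360 W ln N\<close>, and \<open>y \<bullet> (A x - b) \<le> 0\<close> for feasible \<open>x\<close> and every \<open>y\<close>. So the total
  violation of row \<open>i\<close> by the iterates is bounded independently of the number of steps, apart from the
  oracle errors.\<close>

theorem dual_extrapolation:
  fixes T :: nat and \<delta> :: real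
  assumes z: "\<And>t. t < T \<Longrightarrow> near_min (l t) (q t) \<delta> (xz t) (yz t)"
    and w: "\<And>t. t < T \<Longrightarrow> near_min (\<lambda>j. l t j + 2 * gx (yz t) j) (\<lambda>i. q t i + 2 * gy (xz t) i) \<delta> (xw t) (yw t)"
    and l0: "l 0 = (\<lambda>_. 0)" "q 0 = (\<lambda>_. 0)"
    and l: "\<And>t. t < T \<Longrightarrow> l (Suc t) = (\<lambda>j. l t j + 1 * gx (yw t) j)"
    and q: "\<And>t. t < T \<Longrightarrow> q (Suc t) = (\<lambda>i. q t i + 1 * gy (xw t) i)"
    and x: "\<And>j. 0 \<le> x j \<and> x j \<le> 1"
    and sol: "\<And>k. k \<in> R \<Longrightarrow> gsum N ri (\<lambda>e. co e * x (ci e)) k \<le> b k"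
    and i: "i \<in> R"
  shows "(\<Sum>t<T. gsum N ri (\<lambda>e. co e * xw t (ci e)) i)
    \<le> real T * b i + 6 * W + 360 * W * ln N + 2 * \<delta> * T"
proof -
  define u where "u = (\<lambda>k. if k = i then 1 else 0 :: real)"
  have fu: "feas x u" using x i by (simp add: feas_def u_def)
  have lower: "- 360 * W * ln N - 2 * \<delta> * t + (\<Sum>s<t. \<Sum>k\<in>R. b k * yw s k) \<le> obj (l t) (q t) x' y'"
    if "t \<le> T" "feas x' y'" for t x' y'
    using that
  proof (induction t arbitrary: x' y')
    case 0
    have "obj (l 0) (q 0) x' y' = reg x' y'" by (simp add: obj_def lin_def l0)
    then show ?case using reg_lower[OF 0(2)] by simp
  next
    case (Suc t)
    then have t: "t < T" by simp
    have "feas (xz t) (yz t)" using z[OF t] by (simp add: near_min_def)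
    then have IH: "- 360 * W * ln N - 2 * \<delta> * t + (\<Sum>s<t. \<Sum>k\<in>R. b k * yw s k) \<le> obj (l t) (q t) (xz t) (yz t)"
      using Suc.IH t by simp
    have "obj (l t) (q t) (xz t) (yz t) - 2 * \<delta> + (\<Sum>k\<in>R. b k * yw t k) \<le> obj (l (Suc t)) (q (Suc t)) x' y'"
      unfolding l[OF t] q[OF t] by (rule extrapolation_step[OF z[OF t] w[OF t] Suc.prems(2)])
    then show ?case using IH by (simp add: algebra_simps)
  qed
  have lin_T: "lin (l t) (q t) x u = (\<Sum>s<t. bil x (yw s) - bil (xw s) u + (\<Sum>k\<in>R. b k * u k))" if "t \<le> T" for t
    using that
  proof (induction t)
    case 0
    show ?case by (simp add: l0 lin_def)
  next
    case (Suc t)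
    then have t: "t < T" by simp
    show ?case unfolding l[OF t] q[OF t] lin_add lin_g using Suc by simp
  qed
  have bu: "(\<Sum>k\<in>R. b k * u k) = b i" using i by (simp add: u_def if_distrib cong: if_cong)
  have bil_u: "bil (xw s) u = gsum N ri (\<lambda>e. co e * xw s (ci e)) i" for s
  proof -
    have "bil (xw s) u = (\<Sum>k\<in>R. u k * gsum N ri (\<lambda>e. co e * xw s (ci e)) k)"
      unfolding sum_R bil_def by (simp add: mult_ac)
    also have "\<dots> = gsum N ri (\<lambda>e. co e * xw s (ci e)) i"
      using i by (simp add: u_def if_distrib[where f = "\<lambda>c. c * _"] cong: if_cong)
    finally show ?thesis .
  qed
  have bx: "bil x (yw s) \<le> (\<Sum>k\<in>R. b k * yw s k)" if "s < T" for s
  proof -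
    have "feas (xw s) (yw s)" using w[OF that] by (simp add: near_min_def)
    then have "(\<Sum>k\<in>R. yw s k * gsum N ri (\<lambda>e. co e * x (ci e)) k) \<le> (\<Sum>k\<in>R. yw s k * b k)"
      by (intro sum_mono mult_left_mono sol) (auto simp: feas_def)
    then show ?thesis unfolding sum_R bil_def by (simp add: mult_ac)
  qed
  have "(\<Sum>s<T. bil x (yw s)) \<le> (\<Sum>s<T. \<Sum>k\<in>R. b k * yw s k)" by (intro sum_mono bx) auto
  moreover have "reg x u \<le> 6 * W" unfolding u_def using x i by (rule reg_upper)
  moreover note lower[OF order_refl fu, unfolded obj_def lin_T[OF order_refl]]
  ultimately show ?thesis
    unfolding bu bil_u by (simp add: sum.distrib sum_subtractf)
qed

section \<open>Alternating minimization\<close>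

text \<open>For fixed \<open>y\<close> the function separates into one parabola per coordinate of \<open>x\<close>, minimized by
  clipping its vertex; for fixed \<open>x\<close> it is linear in \<open>y\<close> plus entropy, minimized by a softmax.\<close>

definition best_x :: "(nat \<Rightarrow> real) \<Rightarrow> (nat \<Rightarrow> real) \<Rightarrow> nat \<Rightarrow> real" where
  "best_x l y j = (let v = - l j / (12 * gsum N ci (\<lambda>e. \<bar>co e\<bar> * y (ri e)) j) in
     if v < 0 then 0 else if 1 < v then 1 else v)"

definition weight_y :: "(nat \<Rightarrow> real) \<Rightarrow> (nat \<Rightarrow> real) \<Rightarrow> nat \<Rightarrow> real" where
  "weight_y q x i = exp (- (q i + 6 * gsum N ri (\<lambda>e. \<bar>co e\<bar> * (x (ci e))\<^sup>2) i) / (360 * W))"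

definition best_y :: "(nat \<Rightarrow> real) \<Rightarrow> (nat \<Rightarrow> real) \<Rightarrow> nat \<Rightarrow> real" where
  "best_y q x i = weight_y q x i / (\<Sum>k\<in>R. weight_y q x k)"

lemma best_x_box: "0 \<le> best_x l y j \<and> best_x l y j \<le> 1"
  by (auto simp: best_x_def Let_def)

lemma R_nonempty: "R \<noteq> {}" using N_pos by (auto simp: R_def)

lemma sum_weight_pos: "0 < (\<Sum>k\<in>R. weight_y q x k)"
  using R_nonempty by (intro sum_pos) (auto simp: weight_y_def)

lemma best_y_pos: "0 < best_y q x i"
  using sum_weight_pos by (simp add: best_y_def weight_y_def)

lemma sum_best_y: "(\<Sum>i\<in>R. best_y q x i) = 1"
  using sum_weight_pos[of q x] by (simp add: best_y_def sum_divide_distrib[symmetric])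

text \<open>The function differs from a multiple of the divergence from its minimizer only by a constant, so
  the decrease is exact rather than an inequality.\<close>

lemma best_y_optimal:
  assumes "(\<Sum>i\<in>R. u i) = 1"
  shows "obj l q x u = obj l q x (best_y q x) + 360 * W * (\<Sum>i\<in>R. xlnx (u i) - u i * ln (best_y q x i))"
proof -
  define Z where "Z = (\<Sum>k\<in>R. weight_y q x k)"
  have lnb: "360 * W * ln (best_y q x i) = - (q i + 6 * gsum N ri (\<lambda>e. \<bar>co e\<bar> * (x (ci e))\<^sup>2) i) - 360 * W * ln Z" for i
  proof -
    have "ln (best_y q x i) = ln (weight_y q x i) - ln Z"
      using sum_weight_pos[of q x] unfolding best_y_def Z_def by (simp add: ln_div weight_y_def)
    moreover have "360 * W * ln (weight_y q x i) = - (q i + 6 * gsum N ri (\<lambda>e. \<bar>co e\<bar> * (x (ci e))\<^sup>2) i)"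
      using W_ge_1 unfolding weight_y_def by simp
    ultimately show ?thesis by (simp add: right_diff_distrib)
  qed
  have obj: "obj l q x y = (\<Sum>j\<in>J. l j * x j) - 360 * W * ln Z
     + 360 * W * (\<Sum>i\<in>R. xlnx (y i) - y i * ln (best_y q x i))" if "(\<Sum>i\<in>R. y i) = 1" for y
  proof -
    have "(\<Sum>i\<in>R. q i * y i) + 6 * (\<Sum>e<N. \<bar>co e\<bar> * (y (ri e) * (x (ci e))\<^sup>2))
      = (\<Sum>i\<in>R. y i * (q i + 6 * gsum N ri (\<lambda>e. \<bar>co e\<bar> * (x (ci e))\<^sup>2) i))"
    proof -
      have "(\<Sum>e<N. \<bar>co e\<bar> * (y (ri e) * (x (ci e))\<^sup>2))
        = (\<Sum>i\<in>R. y i * gsum N ri (\<lambda>e. \<bar>co e\<bar> * (x (ci e))\<^sup>2) i)"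
        unfolding sum_R by (simp add: mult_ac)
      then show ?thesis by (simp add: distrib_left sum.distrib sum_distrib_left mult_ac)
    qed
    also have "\<dots> = (\<Sum>i\<in>R. y i * (- 360 * W * ln (best_y q x i) - 360 * W * ln Z))"
    proof (intro sum.cong refl)
      fix i
      have "q i + 6 * gsum N ri (\<lambda>e. \<bar>co e\<bar> * (x (ci e))\<^sup>2) i = - 360 * W * ln (best_y q x i) - 360 * W * ln Z"
        using lnb[of i] by linarith
      then show "y i * (q i + 6 * gsum N ri (\<lambda>e. \<bar>co e\<bar> * (x (ci e))\<^sup>2) i)
        = y i * (- 360 * W * ln (best_y q x i) - 360 * W * ln Z)" by simp
    qed
    also have "\<dots> = - 360 * W * (\<Sum>i\<in>R. y i * ln (best_y q x i)) - 360 * W * ln Z * (\<Sum>i\<in>R. y i)"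
      by (simp add: sum_distrib_left sum_distrib_right sum_subtractf algebra_simps sum_negf)
    finally show ?thesis unfolding obj_def lin_def reg_def that
      by (simp add: sum_subtractf algebra_simps)
  qed
  show ?thesis unfolding obj[OF assms] obj[OF sum_best_y] by simp
qed

text \<open>The partial minimizer for \<open>y\<close> is almost as good for any other distribution \<open>u\<close>, up to half of the
  entropy weight times the divergence of \<open>u\<close> from \<open>y\<close>: the first-order condition in \<open>x\<close> replaces the linear
  part by \<open>y\<close>-weighted products, and entry by entry \<open>quadratic_vs_kl\<close> applies. This is relative strong
  convexity of the function after \<open>x\<close> has been minimized out.\<close>

lemma best_x_near_optimal:
  assumes u: "feas x' u" and y: "\<And>i. i \<in> R \<Longrightarrow> 0 < y i" "(\<Sum>i\<in>R. y i) = 1"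
  shows "obj l q (best_x l y) u \<le> obj l q x' u + 180 * W * (\<Sum>i\<in>R. xlnx (u i) - u i * ln (y i))"
proof -
  define x where "x = best_x l y"
  define d where "d j = x' j - x j" for j
  define a where "a = gsum N ci (\<lambda>e. \<bar>co e\<bar> * y (ri e))"
  define kt where "kt i = xlnx (u i) - u i * ln (y i) - u i + y i" for i
  have a: "0 < a j" if "j \<in> J" for j
    unfolding a_def gsum_def using that y co_nonzero by (intro sum_pos) (auto simp: J_def)
  have first_order: "l j * (x j - x' j) \<le> d j * x j * 12 * a j" if j: "j \<in> J" for j
  proof -
    define v where "v = - l j / (12 * a j)"
    have lv: "l j = - (12 * a j * v)" using a[OF j] by (simp add: v_def)
    have xj: "x j = (if v < 0 then 0 else if 1 < v then 1 else v)"
      by (simp add: x_def best_x_def Let_def v_def a_def)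
    have x': "0 \<le> x' j" "x' j \<le> 1" using u by (auto simp: feas_def)
    have "0 \<le> (x j - v) * (x' j - x j)"
    proof (cases "v < 0 \<or> 1 < v")
      case True
      then show ?thesis using xj x' by (auto intro: mult_nonneg_nonneg mult_nonpos_nonpos mult_nonpos_nonneg)
    qed (simp add: xj)
    then have "0 \<le> (12 * a j) * ((x j - v) * (x' j - x j))" using a[OF j] by simp
    then show ?thesis unfolding lv d_def by (simp add: algebra_simps)
  qed
  have "(\<Sum>j\<in>J. l j * x j) - (\<Sum>j\<in>J. l j * x' j) = (\<Sum>j\<in>J. l j * (x j - x' j))"
    by (simp add: right_diff_distrib sum_subtractf)
  also have "\<dots> \<le> (\<Sum>j\<in>J. (12 * d j * x j) * a j)"
    using first_order by (intro sum_mono) (simp add: mult_ac)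
  also have "\<dots> = (\<Sum>e<N. \<bar>co e\<bar> * (12 * y (ri e) * x (ci e) * d (ci e)))"
    unfolding a_def by (subst sum_J) (simp add: mult_ac)
  finally have 1: "(\<Sum>j\<in>J. l j * x j) - (\<Sum>j\<in>J. l j * x' j)
    \<le> (\<Sum>e<N. \<bar>co e\<bar> * (12 * y (ri e) * x (ci e) * d (ci e)))" .
  have "obj l q x u - obj l q x' u = (\<Sum>j\<in>J. l j * x j) - (\<Sum>j\<in>J. l j * x' j)
     + 6 * ((\<Sum>e<N. \<bar>co e\<bar> * (u (ri e) * (x (ci e))\<^sup>2)) - (\<Sum>e<N. \<bar>co e\<bar> * (u (ri e) * (x' (ci e))\<^sup>2)))"
    unfolding obj_def lin_def reg_def by simp
  also have "\<dots> \<le> (\<Sum>e<N. \<bar>co e\<bar> * (12 * y (ri e) * x (ci e) * d (ci e)))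
     + 6 * ((\<Sum>e<N. \<bar>co e\<bar> * (u (ri e) * (x (ci e))\<^sup>2)) - (\<Sum>e<N. \<bar>co e\<bar> * (u (ri e) * (x' (ci e))\<^sup>2)))"
    using 1 by simp
  also have "\<dots> = (\<Sum>e<N. \<bar>co e\<bar> * (6 * (2 * (y (ri e) - u (ri e)) * x (ci e) * d (ci e) - u (ri e) * (d (ci e))\<^sup>2)))"
    unfolding sum_distrib_left sum_subtractf[symmetric] sum.distrib[symmetric]
    by (intro sum.cong refl) (simp add: d_def power2_eq_square algebra_simps)
  also have "\<dots> \<le> (\<Sum>e<N. \<bar>co e\<bar> * (96 * kt (ri e)))"
  proof (intro sum_mono mult_left_mono)
    fix e assume "e \<in> {..<N}"
    then have "2 * (y (ri e) - u (ri e)) * x (ci e) * d (ci e) - u (ri e) * (d (ci e))\<^sup>2 \<le> 16 * kt (ri e)"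
      unfolding kt_def
    proof (intro quadratic_vs_kl)
      have "0 \<le> x' (ci e)" "x' (ci e) \<le> 1" "0 \<le> x (ci e)" "x (ci e) \<le> 1"
        using u best_x_box[of l y "ci e"] by (auto simp: feas_def x_def)
      then show "0 \<le> x (ci e)" "x (ci e) \<le> 1" "\<bar>d (ci e)\<bar> \<le> 1" by (auto simp: d_def)
    qed (use u y in \<open>auto simp: feas_def\<close>)
    then show "6 * (2 * (y (ri e) - u (ri e)) * x (ci e) * d (ci e) - u (ri e) * (d (ci e))\<^sup>2) \<le> 96 * kt (ri e)"
      by simp
  qed auto
  also have "\<dots> \<le> W * (\<Sum>i\<in>R. 96 * kt i)"
  proof (rule sum_rows_le)
    fix i assume "i \<in> R"
    then show "0 \<le> 96 * kt i" unfolding kt_def using kl_nonneg[of "u i" "y i"] u y by (auto simp: feas_def)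
  qed
  also have "\<dots> \<le> 180 * W * (\<Sum>i\<in>R. kt i)"
  proof -
    have "0 \<le> (\<Sum>i\<in>R. kt i)" unfolding kt_def using u y by (intro sum_nonneg kl_nonneg) (auto simp: feas_def)
    then have "96 * (W * (\<Sum>i\<in>R. kt i)) \<le> 180 * (W * (\<Sum>i\<in>R. kt i))"
      using W_ge_1 by (intro mult_right_mono) auto
    moreover have "(\<Sum>i\<in>R. 96 * kt i) = 96 * (\<Sum>i\<in>R. kt i)" by (simp add: sum_distrib_left)
    ultimately show ?thesis by simp
  qed
  also have "(\<Sum>i\<in>R. kt i) = (\<Sum>i\<in>R. xlnx (u i) - u i * ln (y i))"
    unfolding kt_def using u y by (simp add: feas_def sum.distrib sum_subtractf)
  finally show ?thesis unfolding x_def by simp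
qed

fun alt :: "(nat \<Rightarrow> real) \<Rightarrow> (nat \<Rightarrow> real) \<Rightarrow> nat \<Rightarrow> (nat \<Rightarrow> real) \<times> (nat \<Rightarrow> real)" where
  "alt l q 0 = (y0, y0)"
| "alt l q (Suc k) = (let x = best_x l (snd (alt l q k)) in (x, best_y q x))"

lemma alt_y: "0 < snd (alt l q k) i" if "i \<in> R"
  using that by (cases k) (auto simp: Let_def best_y_pos y0_pos)

lemma alt_y_sum: "(\<Sum>i\<in>R. snd (alt l q k) i) = 1"
  by (cases k) (auto simp: Let_def sum_best_y sum_y0)

lemma alt_feas: "feas (fst (alt l q (Suc k))) (snd (alt l q (Suc k)))"
  by (simp add: feas_def Let_def best_x_box sum_best_y best_y_pos less_imp_le)

text \<open>As a function of \<open>y\<close> alone, one round is a mirror descent step for a function that is relatively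
  smooth with constant \<open>360 W\<close> and relatively strongly convex with constant \<open>180 W\<close> with respect to the
  entropy. Hence the divergence from any competitor \<open>u\<close> halves in every round, as long as the
  current value is not already below that of \<open>u\<close>; comparing with arbitrary competitors avoids having to
  show that a minimizer exists.\<close>

theorem alternating_minimization:
  "near_min l q (360 * W * ln N / 2 ^ Suc k) (fst (alt l q (Suc k))) (snd (alt l q (Suc k)))"
proof -
  define \<beta> where "\<beta> = 360 * W"
  have \<beta>: "0 < \<beta>" using W_ge_1 by (simp add: \<beta>_def)
  define x y where "x k = fst (alt l q k)" and "y k = snd (alt l q k)" for k
  have xS: "x (Suc k) = best_x l (y k)" and yS: "y (Suc k) = best_y q (x (Suc k))" for k
    by (simp_all add: x_def y_def Let_def)
  have ypos: "0 < y k i" if "i \<in> R" for k i unfolding y_def using that by (rule alt_y)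
  have ysum: "(\<Sum>i\<in>R. y k i) = 1" for k unfolding y_def by (rule alt_y_sum)
  have feasS: "feas (x (Suc k)) (y (Suc k))" for k unfolding x_def y_def by (rule alt_feas)
  have "obj l q (x (Suc k)) (y (Suc k)) \<le> obj l q x' u + \<beta> * ln N / 2 ^ Suc k" if u: "feas x' u" for x' u
  proof -
    define D where "D k = obj l q (x k) (y k) - obj l q x' u" for k
    define KL where "KL k = (\<Sum>i\<in>R. xlnx (u i) - u i * ln (y k i))" for k
    have us: "(\<Sum>i\<in>R. u i) = 1" "\<And>i. 0 \<le> u i" using u by (auto simp: feas_def)
    have KL0: "0 \<le> KL k" for k
      unfolding KL_def by (rule kl_sum_nonneg) (use us ypos ysum in auto)
    \<comment> \<open>The smoothness constant enters exactly on the left, the strong convexity on the right.\<close>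
    have step: "D (Suc k) + \<beta> * KL (Suc k) \<le> \<beta> / 2 * KL k" for k
    proof -
      have "obj l q (x (Suc k)) u = obj l q (x (Suc k)) (y (Suc k)) + \<beta> * KL (Suc k)"
        unfolding KL_def \<beta>_def yS by (rule best_y_optimal[OF us(1)])
      moreover have "obj l q (x (Suc k)) u \<le> obj l q x' u + \<beta> / 2 * KL k"
        using best_x_near_optimal[OF u, of "y k" l q] ypos ysum unfolding xS KL_def \<beta>_def by simp
      ultimately show ?thesis by (simp add: D_def)
    qed
    have mono: "D (Suc (Suc k)) \<le> D (Suc k)" for k
    proof -
      have "obj l q (x (Suc (Suc k))) (y (Suc k)) = obj l q (x (Suc (Suc k))) (y (Suc (Suc k)))
        + 360 * W * (\<Sum>i\<in>R. xlnx (y (Suc k) i) - y (Suc k) i * ln (y (Suc (Suc k)) i))"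
        unfolding yS[of "Suc k"] by (rule best_y_optimal[OF ysum])
      moreover have "0 \<le> 360 * W * (\<Sum>i\<in>R. xlnx (y (Suc k) i) - y (Suc k) i * ln (y (Suc (Suc k)) i))"
        using W_ge_1 by (intro mult_nonneg_nonneg kl_sum_nonneg ysum less_imp_le[OF ypos] ypos) auto
      moreover have "obj l q (x (Suc (Suc k))) (y (Suc k)) \<le> obj l q (x (Suc k)) (y (Suc k))"
        using best_x_near_optimal[OF feasS[of k], of "y (Suc k)" l q] ypos ysum unfolding xS[of "Suc k"] by simp
      ultimately show ?thesis by (simp add: D_def)
    qed
    have "D (Suc k) \<le> 0 \<or> \<beta> * KL (Suc k) \<le> \<beta> * ln N / 2 ^ Suc k \<and> D (Suc k) \<le> \<beta> * ln N / 2 ^ Suc k"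
    proof (induction k)
      case 0
      have "KL 0 \<le> ln N" unfolding KL_def y_def using kl_y0[OF u] by simp
      then have "\<beta> / 2 * KL 0 \<le> \<beta> / 2 * ln N" using \<beta> by (intro mult_left_mono) auto
      then have "D (Suc 0) + \<beta> * KL (Suc 0) \<le> \<beta> * ln N / 2" using step[of 0] by simp
      moreover have "0 \<le> \<beta> * KL (Suc 0)" using KL0 \<beta> by simp
      ultimately show ?case by auto
    next
      case (Suc k)
      show ?case
      proof (cases "D (Suc (Suc k)) \<le> 0")
        case False
        then have "\<not> D (Suc k) \<le> 0" using mono[of k] by linarith
        then have "\<beta> / 2 * KL (Suc k) \<le> \<beta> * ln N / 2 ^ Suc (Suc k)" using Suc by (simp add: field_simps)
        then have "D (Suc (Suc k)) + \<beta> * KL (Suc (Suc k)) \<le> \<beta> * ln N / 2 ^ Suc (Suc k)"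
          using step[of "Suc k"] by linarith
        moreover have "0 \<le> \<beta> * KL (Suc (Suc k))" using KL0 \<beta> by simp
        ultimately show ?thesis using False by auto
      qed simp
    qed
    moreover have "0 \<le> \<beta> * ln N / 2 ^ Suc k" using \<beta> N_pos by simp
    ultimately show ?thesis unfolding D_def by linarith
  qed
  then show ?thesis using feasS[of k] by (auto simp: near_min_def x_def y_def \<beta>_def)
qed

end

section \<open>Work and depth of flat parallel programs\<close>

text \<open>The programs here are flat: parallel loops over at most \<open>M\<close> indices whose bodies are sequential. Then
  one number \<open>X\<close> describes both resources, depth \<open>X\<close> and work \<open>M X\<close>, and it is additive under all
  constructs. Bodies of parallel loops are the case \<open>M = 1\<close>.\<close>

definition ev :: "nat \<Rightarrow> val list \<Rightarrow> prg \<Rightarrow> val \<Rightarrow> nat \<Rightarrow> bool" where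
  "ev M env e v X \<longleftrightarrow> (\<exists>w d. run env e v w d \<and> w \<le> M * X \<and> d \<le> X)"

lemma ev_mono: "ev M env e v X \<Longrightarrow> M \<le> M' \<Longrightarrow> X \<le> X' \<Longrightarrow> ev M' env e v X'"
  unfolding ev_def by (meson le_trans mult_le_mono)

lemma ev_Let:
  assumes "0 < M" "ev M env e1 u X1" "ev M (u # env) e2 v X2"
  shows "ev M env (LetIn e1 e2) v (X1 + X2 + 1)"
proof -
  obtain w1 d1 w2 d2 where r: "run env e1 u w1 d1" "run (u # env) e2 v w2 d2"
    and b: "w1 \<le> M * X1" "d1 \<le> X1" "w2 \<le> M * X2" "d2 \<le> X2"
    using assms by (auto simp: ev_def)
  have "w1 + w2 + 1 \<le> M * (X1 + X2 + 1)" using b assms(1) by (simp add: distrib_left)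
  with run.LetIn[OF r] b show ?thesis unfolding ev_def by (metis add_le_mono le_refl)
qed

lemma ev_Op1:
  assumes "0 < M" "ev M env e u X" "app1 f u = Some v"
  shows "ev M env (Op1 f e) v (X + 1)"
proof -
  obtain w d where r: "run env e u w d" and b: "w \<le> M * X" "d \<le> X"
    using assms by (auto simp: ev_def)
  have "w + 1 \<le> M * (X + 1)" using b assms(1) by (simp add: distrib_left)
  with run.Op1[OF r assms(3)] b show ?thesis unfolding ev_def by (metis add_le_mono le_refl)
qed

lemma ev_Op2:
  assumes "0 < M" "ev M env e1 u1 X1" "ev M env e2 u2 X2" "app2 f u1 u2 = Some v"
  shows "ev M env (Op2 f e1 e2) v (X1 + X2 + 1)"
proof -
  obtain w1 d1 w2 d2 where r: "run env e1 u1 w1 d1" "run env e2 u2 w2 d2"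
    and b: "w1 \<le> M * X1" "d1 \<le> X1" "w2 \<le> M * X2" "d2 \<le> X2"
    using assms by (auto simp: ev_def)
  have "w1 + w2 + 1 \<le> M * (X1 + X2 + 1)" using b assms(1) by (simp add: distrib_left)
  moreover have "max d1 d2 + 1 \<le> X1 + X2 + 1" using b by simp
  ultimately show ?thesis using run.Op2[OF r assms(4)] unfolding ev_def by blast
qed

lemma ev_Pair:
  assumes "0 < M" "ev M env e1 u1 X1" "ev M env e2 u2 X2"
  shows "ev M env (Op2 MkPair e1 e2) (PairV u1 u2) (X1 + X2 + 1)"
  using ev_Op2[OF assms] by simp

lemma ev_Cond:
  assumes "0 < M" "ev M env b (NatV m) X1" "ev M env (if m \<noteq> 0 then e1 else e2) v X2"
  shows "ev M env (Cond b e1 e2) v (X1 + X2 + 1)"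
proof -
  obtain w1 d1 w2 d2 where r: "run env b (NatV m) w1 d1" "run env (if m \<noteq> 0 then e1 else e2) v w2 d2"
    and b: "w1 \<le> M * X1" "d1 \<le> X1" "w2 \<le> M * X2" "d2 \<le> X2"
    using assms by (auto simp: ev_def)
  have "run env (Cond b e1 e2) v (w1 + w2 + 1) (d1 + d2 + 1)"
  proof (cases "m = 0")
    case True
    then show ?thesis using run.CondF[of env b w1 d1 e2 v w2 d2 e1] r by simp
  next
    case False
    then show ?thesis using run.CondT[of env b m w1 d1 e1 v w2 d2 e2] r by simp
  qed
  moreover have "w1 + w2 + 1 \<le> M * (X1 + X2 + 1)" using b assms(1) by (simp add: distrib_left)
  ultimately show ?thesis using b unfolding ev_def by (metis add_le_mono le_refl)
qed

lemma ev_Tab: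
  assumes M: "0 < M" "m \<le> M" and e: "ev M env e (NatV m) X1"
    and b: "\<And>i. i < m \<Longrightarrow> ev 1 (NatV i # env) b (vs i) X2"
  shows "ev M env (Tab e b) (ArrV (map vs [0..<m])) (X1 + X2 + 1)"
proof -
  obtain w d where r: "run env e (NatV m) w d" and wd: "w \<le> M * X1" "d \<le> X1"
    using e by (auto simp: ev_def)
  have "\<forall>i. \<exists>w d. i < m \<longrightarrow> run (NatV i # env) b (vs i) w d \<and> w \<le> X2 \<and> d \<le> X2"
    using b by (auto simp: ev_def)
  then obtain ws ds where i: "\<And>i. i < m \<Longrightarrow> run (NatV i # env) b (vs i) (ws i) (ds i)"
    and wsd: "\<And>i. i < m \<Longrightarrow> ws i \<le> X2 \<and> ds i \<le> X2" by metis
  have "(\<Sum>i<m. ws i) \<le> (\<Sum>i<m. X2)" by (intro sum_mono) (use wsd in auto)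
  also have "\<dots> \<le> M * X2" using M by simp
  finally have "w + (\<Sum>i<m. ws i) + 1 \<le> M * (X1 + X2 + 1)" using wd M by (simp add: distrib_left)
  moreover have "Max (insert 0 (ds ` {..<m})) \<le> X2" using wsd by auto
  then have "d + Max (insert 0 (ds ` {..<m})) + 1 \<le> X1 + X2 + 1" using wd by (intro add_mono) auto
  ultimately show ?thesis using run.Tab[OF r i] unfolding ev_def by blast
qed

text \<open>The loop is described by the sequence \<open>s\<close> of its states, which may continue beyond the exit; it
  stops at the first \<open>t\<close> with \<open>\<not> c t\<close>, at most at \<open>L\<close>.\<close>

lemma ev_While:
  assumes M: "0 < M"
    and cond: "\<And>t. ev M (s t # env) b (NatV (if c t then 1 else 0)) X1"
    and step: "\<And>t. c t \<Longrightarrow> ev M (s t # env) e (s (Suc t)) X2"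
    and stop: "\<not> c L"
  obtains T where "T \<le> L" "\<And>t. t < T \<Longrightarrow> c t" "\<not> c T"
    "ev M (s 0 # env) (While b e) (s T) (Suc L * (X1 + X2 + 1))"
proof -
  define T where "T = (LEAST t. \<not> c t)"
  have T: "\<not> c T" "T \<le> L" "\<And>t. t < T \<Longrightarrow> c t"
    unfolding T_def using LeastI[of "\<lambda>t. \<not> c t", OF stop] stop
    by (auto intro: Least_le dest: not_less_Least)
  have "ev M (s (T - k) # env) (While b e) (s T) (Suc k * (X1 + X2 + 1))" if "k \<le> T" for k
    using that
  proof (induction k)
    case 0
    obtain w d where "run (s T # env) b (NatV 0) w d" "w \<le> M * X1" "d \<le> X1"
      using cond[of T] T by (auto simp: ev_def)
    then have "run (s T # env) (While b e) (s T) (w + 1) (d + 1)" "w + 1 \<le> M * (X1 + X2 + 1)" "d + 1 \<le> X1 + X2 + 1"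
      using M run.WhileF[of "s T" env b w d e] by (auto simp: distrib_left)
    then show ?case unfolding ev_def by auto
  next
    case (Suc k)
    define t where "t = T - Suc k"
    have t: "Suc t = T - k" "c t" using Suc.prems T by (auto simp: t_def)
    obtain w1 d1 where 1: "run (s t # env) b (NatV 1) w1 d1" "w1 \<le> M * X1" "d1 \<le> X1"
      using cond[of t] t by (auto simp: ev_def)
    obtain w2 d2 where 2: "run (s t # env) e (s (Suc t)) w2 d2" "w2 \<le> M * X2" "d2 \<le> X2"
      using step[OF t(2)] by (auto simp: ev_def)
    obtain w3 d3 where 3: "run (s (Suc t) # env) (While b e) (s T) w3 d3"
      "w3 \<le> M * (Suc k * (X1 + X2 + 1))" "d3 \<le> Suc k * (X1 + X2 + 1)"
      using Suc t by (auto simp: ev_def)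
    have "run (s t # env) (While b e) (s T) (w1 + w2 + w3 + 1) (d1 + d2 + d3 + 1)"
      using run.WhileT[OF 1(1) _ 2(1) 3(1)] by simp
    moreover have "w1 + w2 + w3 + 1 \<le> M * (Suc (Suc k) * (X1 + X2 + 1))"
      using 1 2 3 M by (simp add: distrib_left)
    ultimately show ?case using 1 2 3 unfolding ev_def t_def by (intro exI conjI) auto
  qed
  from ev_mono[OF this[of T] order_refl mult_le_mono1[of "Suc T" "Suc L"]]
  have "ev M (s 0 # env) (While b e) (s T) (Suc L * (X1 + X2 + 1))"
    using T by (simp only: diff_self_eq_0 order_refl Suc_le_mono)
  with T that show ?thesis by blast
qed

text \<open>Straight-line code is executed by the simplifier: \<open>den\<close> is its denotation, and its cost is bounded by
  the program size \<open>cst\<close>. Loops have no denotation, they are composed by the rules above.\<close>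

primrec den :: "prg \<Rightarrow> val list \<Rightarrow> val option" where
  "den (Var k) env = (if k < length env then Some (env ! k) else None)"
| "den (NConst m) env = Some (NatV m)"
| "den (Op1 f e) env = Option.bind (den e env) (app1 f)"
| "den (Op2 f e1 e2) env = Option.bind (den e1 env) (\<lambda>u. Option.bind (den e2 env) (app2 f u))"
| "den (LetIn e1 e2) env = Option.bind (den e1 env) (\<lambda>u. den e2 (u # env))"
| "den (Cond b e1 e2) env =
    (case den b env of Some (NatV m) \<Rightarrow> if m \<noteq> 0 then den e1 env else den e2 env | _ \<Rightarrow> None)"
| "den (Tab e b) env = None"
| "den (While b e) env = None"

primrec cst :: "prg \<Rightarrow> nat" where
  "cst (Var k) = 1"
| "cst (NConst m) = 1"
| "cst (Op1 f e) = cst e + 1"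
| "cst (Op2 f e1 e2) = cst e1 + cst e2 + 1"
| "cst (LetIn e1 e2) = cst e1 + cst e2 + 1"
| "cst (Cond b e1 e2) = cst b + (cst e1 + cst e2) + 1"
| "cst (Tab e b) = cst e + cst b + 1"
| "cst (While b e) = cst b + cst e + 1"

lemma ev_den: "0 < M \<Longrightarrow> den e env = Some v \<Longrightarrow> ev M env e v (cst e)"
proof (induction e arbitrary: env v)
  case (Var k)
  then show ?case by (auto simp: ev_def split: if_splits intro!: exI[of _ 1] run.Var)
next
  case (NConst m)
  then show ?case by (auto simp: ev_def intro!: exI[of _ 1] run.NConst)
next
  case (Op1 f e)
  then show ?case by (auto simp: bind_eq_Some_conv simp del: One_nat_def intro!: ev_Op1)
next
  case (Op2 f e1 e2)
  then show ?case by (auto simp: bind_eq_Some_conv simp del: One_nat_def add_Suc_right intro!: ev_Op2)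
next
  case (LetIn e1 e2)
  then show ?case by (auto simp: bind_eq_Some_conv simp del: One_nat_def add_Suc_right intro!: ev_Let)
next
  case (Cond b e1 e2)
  then obtain m where b: "den b env = Some (NatV m)" and r: "(if m \<noteq> 0 then den e1 env else den e2 env) = Some v"
    by (auto split: option.splits val.splits)
  have "ev M env (if m \<noteq> 0 then e1 else e2) v (cst e1 + cst e2)"
  proof (cases "m = 0")
    case True
    then show ?thesis using r Cond.IH(3)[OF Cond.prems(1), of env v] by (auto elim: ev_mono)
  next
    case False
    then show ?thesis using r Cond.IH(2)[OF Cond.prems(1), of env v] by (auto elim: ev_mono)
  qed
  then show ?case unfolding cst.simps using Cond.IH(1)[OF Cond.prems(1) b] by (intro ev_Cond Cond.prems(1))
qed simp_all

lemma ev_Tab_den: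
  assumes "0 < M" "m \<le> M" "den e env = Some (NatV m)"
    and "\<And>i. i < m \<Longrightarrow> den b (NatV i # env) = Some (vs i)"
  shows "ev M env (Tab e b) (ArrV (map vs [0..<m])) (cst (Tab e b))"
  using ev_Tab[OF assms(1,2) ev_den[OF assms(1,3)] ev_den[OF _ assms(4)]] by simp

section \<open>Prefix sums, binary search and packing\<close>

definition arr :: "nat \<Rightarrow> (nat \<Rightarrow> val) \<Rightarrow> val" where "arr m f = ArrV (map f [0..<m])"

lemma app1_Length_arr [simp]: "app1 Length (arr m f) = Some (NatV m)"
  and app2_Index_arr [simp]: "i < m \<Longrightarrow> app2 Index (arr m f) (NatV i) = Some (f i)"
  by (simp_all add: arr_def)

lemma arr_cong: "(\<And>i. i < m \<Longrightarrow> f i = g i) \<Longrightarrow> arr m f = arr m g"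
  by (simp add: arr_def)

lemma arr_eq_ArrV: "arr (length us) (\<lambda>i. f (us ! i)) = ArrV (map f us)"
  unfolding arr_def by (intro arg_cong[of _ _ ArrV] nth_equalityI) auto

text \<open>All arrays are written as tabulated functions. The equations for lengths and accesses of
  such arrays replace list reasoning, so the unfolding of these two operations is switched off.\<close>

lemmas ev_Tab_arr = ev_Tab[folded arr_def] ev_Tab_den[folded arr_def]

declare app1.simps(7) [simp del]
declare app2.simps(10) [simp del]

abbreviation "fstP e \<equiv> Op1 Fst e"
abbreviation "sndP e \<equiv> Op1 Snd e"

text \<open>Inclusive prefix sums by recursive doubling: before round \<open>t\<close> the entry \<open>i\<close> holds the sum of the last
  \<open>2 ^ t\<close> elements up to \<open>i\<close>.\<close>

definition scanP :: "op2 \<Rightarrow> prg" where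
  "scanP f = LetIn (Op2 MkPair (NConst 1) (Var 0)) (sndP
     (While (Op2 NLess (fstP (Var 0)) (Op1 Length (sndP (Var 0))))
       (Op2 MkPair (Op2 NAdd (fstP (Var 0)) (fstP (Var 0)))
         (Tab (Op1 Length (sndP (Var 0)))
           (Cond (Op2 NLess (Var 0) (fstP (Var 1)))
             (Op2 Index (sndP (Var 1)) (Var 0))
             (Op2 f (Op2 Index (sndP (Var 1)) (Op2 NSub (Var 0) (fstP (Var 1))))
                    (Op2 Index (sndP (Var 1)) (Var 0))))))))"

lemma scan_run:
  fixes enc :: "'a::comm_monoid_add \<Rightarrow> val"
  assumes f: "\<And>a b. app2 f (enc a) (enc b) = Some (enc (a + b))"
    and M: "0 < M" "m \<le> M" and L: "m \<le> 2 ^ L"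
  shows "ev M (arr m (\<lambda>i. enc (g i)) # env) (scanP f) (arr m (\<lambda>i. enc (\<Sum>j\<le>i. g j))) (100 * (L + 1))"
proof -
  define s where "s t = PairV (NatV (2 ^ t)) (arr m (\<lambda>i. enc (\<Sum>j\<in>{Suc i - 2 ^ t..i}. g j)))" for t :: nat
  let ?env = "arr m (\<lambda>i. enc (g i)) # env"
  let ?b = "Op2 NLess (fstP (Var 0)) (Op1 Length (sndP (Var 0)))"
  let ?body = "Cond (Op2 NLess (Var 0) (fstP (Var 1)))
             (Op2 Index (sndP (Var 1)) (Var 0))
             (Op2 f (Op2 Index (sndP (Var 1)) (Op2 NSub (Var 0) (fstP (Var 1))))
                    (Op2 Index (sndP (Var 1)) (Var 0)))"
  let ?tab = "Tab (Op1 Length (sndP (Var 0))) ?body"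
  let ?e = "Op2 MkPair (Op2 NAdd (fstP (Var 0)) (fstP (Var 0))) ?tab"
  have split: "(\<Sum>j\<in>{Suc (i - 2 ^ t) - 2 ^ t..i - 2 ^ t}. g j) + (\<Sum>j\<in>{Suc i - 2 ^ t..i}. g j)
      = (\<Sum>j\<in>{Suc i - 2 ^ Suc t..i}. g j)" if "2 ^ t \<le> i" for i t
  proof -
    have "{Suc i - 2 ^ Suc t..i} = {Suc (i - 2 ^ t) - 2 ^ t..i - 2 ^ t} \<union> {Suc i - 2 ^ t..i}"
      using that by auto
    moreover have "{Suc (i - 2 ^ t) - 2 ^ t..i - 2 ^ t} \<inter> {Suc i - 2 ^ t..i} = {}" using that by auto
    ultimately show ?thesis by (simp add: sum.union_disjoint)
  qed
  have small: "{Suc i - 2 ^ t..i} = {Suc i - 2 ^ Suc t..i}" if "i < 2 ^ t" for i t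
    using that by auto
  obtain T where T: "T \<le> L" "\<not> 2 ^ T < m" and
    run: "ev M (s 0 # ?env) (While ?b ?e) (s T) (Suc L * (cst ?b + cst ?e + 1))"
  proof (rule ev_While[where c = "\<lambda>t. 2 ^ t < m" and s = s and b = ?b and e = ?e and env = ?env
      and M = M and L = L and ?X1.0 = "cst ?b" and ?X2.0 = "cst ?e"])
    show "0 < M" by fact
    show "ev M (s t # ?env) ?b (NatV (if 2 ^ t < m then 1 else 0)) (cst ?b)" for t
      by (rule ev_den) (use M in \<open>simp_all add: s_def\<close>)
    show "ev M (s t # ?env) ?e (s (Suc t)) (cst ?e)" for t
    proof -
      have "ev M (s t # ?env) ?tab (arr m (\<lambda>i. enc (\<Sum>j\<in>{Suc i - 2 ^ Suc t..i}. g j))) (cst ?tab)"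
      proof (rule ev_Tab_arr(2)[OF M])
        show "den (Op1 Length (sndP (Var 0))) (s t # ?env) = Some (NatV m)" by (simp add: s_def)
        fix i assume "i < m"
        then show "den ?body (NatV i # s t # ?env) = Some (enc (\<Sum>j\<in>{Suc i - 2 ^ Suc t..i}. g j))"
          using split[of t i] small[of i t] by (cases "i < 2 ^ t") (simp_all add: s_def f del: power_Suc)
      qed
      moreover have "ev M (s t # ?env) (Op2 NAdd (fstP (Var 0)) (fstP (Var 0))) (NatV (2 ^ Suc t))
         (cst (Op2 NAdd (fstP (Var 0)) (fstP (Var 0))))"
        using M by (intro ev_den) (simp_all add: s_def)
      ultimately show ?thesis
        unfolding s_def[of "Suc t"] cst.simps(4)[of MkPair] by (intro ev_Pair M(1))
    qed
    show "\<not> 2 ^ L < m" using L by simp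
  qed (use that in blast)
  have "ev M ?env (Op2 MkPair (NConst 1) (Var 0)) (s 0) 3"
    using ev_den[OF M(1), of "Op2 MkPair (NConst 1) (Var 0)" ?env] by (simp add: s_def numeral_3_eq_3)
  moreover have "app1 Snd (s T) = Some (arr m (\<lambda>i. enc (\<Sum>j\<le>i. g j)))"
  proof -
    have "{Suc i - 2 ^ T..i} = {..i}" if "i < m" for i using that T by auto
    then show ?thesis by (simp add: s_def cong: arr_cong)
  qed
  ultimately have "ev M ?env (scanP f) (arr m (\<lambda>i. enc (\<Sum>j\<le>i. g j))) (3 + (Suc L * (cst ?b + cst ?e + 1) + 1) + 1)"
    unfolding scanP_def by (rule ev_Let[OF M(1) _ ev_Op1[OF M(1) run]])
  then show ?thesis by (rule ev_mono) simp_all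
qed

abbreviation "narr m f \<equiv> arr m (\<lambda>i. NatV (f i))"
abbreviation "rarr m f \<equiv> arr m (\<lambda>i. RealV (f i))"

lemma card_less_iff:
  fixes K :: "nat \<Rightarrow> nat"
  assumes mono: "\<And>i j. i \<le> j \<Longrightarrow> j < m \<Longrightarrow> K i \<le> K j" and t: "t < m"
  shows "t < card {e. e < m \<and> K e < k} \<longleftrightarrow> K t < k"
proof -
  have fin: "finite {e. e < m \<and> K e < k}" by simp
  show ?thesis
  proof
    assume l: "t < card {e. e < m \<and> K e < k}"
    show "K t < k"
    proof (rule ccontr)
      assume n: "\<not> K t < k"
      have "{e. e < m \<and> K e < k} \<subseteq> {..<t}"
      proof
        fix e assume "e \<in> {e. e < m \<and> K e < k}"
        then show "e \<in> {..<t}" using mono[of t e] n by (cases "t \<le> e") auto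
      qed
      then have "card {e. e < m \<and> K e < k} \<le> t" using card_mono[of "{..<t}"] by fastforce
      then show False using l by simp
    qed
  next
    assume "K t < k"
    then have "{..t} \<subseteq> {e. e < m \<and> K e < k}" using mono t by fastforce
    then have "card {..t} \<le> card {e. e < m \<and> K e < k}" by (intro card_mono fin)
    then show "t < card {e. e < m \<and> K e < k}" by simp
  qed
qed

lemma card_initial:
  assumes "r \<le> m" "\<And>e. e < r \<Longrightarrow> P e" "\<And>e. r \<le> e \<Longrightarrow> e < m \<Longrightarrow> \<not> P e"
  shows "card {e. e < m \<and> P e} = r"
proof -
  have "{e. e < m \<and> P e} = {..<r}" using assms by (force simp: not_le[symmetric])
  then show ?thesis by simp
qed

text \<open>Binary search for the first position whose key is at least the second component of the argument.
  In a sorted array this is the number of smaller keys.\<close>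

definition searchP :: prg where
  "searchP = LetIn (Op2 MkPair (NConst 0) (Op1 Length (fstP (Var 0))))
    (fstP (While (Op2 NLess (fstP (Var 0)) (sndP (Var 0)))
      (LetIn (Op1 Half (Op2 NAdd (fstP (Var 0)) (sndP (Var 0))))
        (Cond (Op2 NLess (Op2 Index (fstP (Var 2)) (Var 0)) (sndP (Var 2)))
          (Op2 MkPair (Op2 NAdd (Var 0) (NConst 1)) (sndP (Var 1)))
          (Op2 MkPair (fstP (Var 1)) (Var 0))))))"

lemma search_run:
  assumes M: "0 < M" and mono: "\<And>i j. i \<le> j \<Longrightarrow> j < m \<Longrightarrow> K i \<le> K j" and L: "m < 2 ^ L"
  shows "ev M (PairV (narr m K) (NatV k) # env) searchP (NatV (card {e. e < m \<and> K e < k})) (100 * (L + 1))"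
proof -
  let ?env = "PairV (narr m K) (NatV k) # env"
  let ?b = "Op2 NLess (fstP (Var 0)) (sndP (Var 0))"
  let ?e = "LetIn (Op1 Half (Op2 NAdd (fstP (Var 0)) (sndP (Var 0))))
        (Cond (Op2 NLess (Op2 Index (fstP (Var 2)) (Var 0)) (sndP (Var 2)))
          (Op2 MkPair (Op2 NAdd (Var 0) (NConst 1)) (sndP (Var 1)))
          (Op2 MkPair (fstP (Var 1)) (Var 0)))"
  define step where "step = (\<lambda>(lo, hi). if lo < hi then
     (if K ((lo + hi) div 2) < k then ((lo + hi) div 2 + 1, hi) else (lo, (lo + hi) div 2)) else (lo, hi))"
  define s where "s t = (step ^^ t) (0, m)" for t
  define lo hi where "lo t = fst (s t)" and "hi t = snd (s t)" for t
  have inv: "lo t \<le> hi t \<and> hi t \<le> m \<and> (\<forall>e<lo t. K e < k) \<and> (\<forall>e. hi t \<le> e \<and> e < m \<longrightarrow> k \<le> K e)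
     \<and> hi t - lo t \<le> m div 2 ^ t" for t
  proof (induction t)
    case 0
    show ?case by (simp add: lo_def hi_def s_def)
  next
    case (Suc t)
    have sS: "s (Suc t) = step (lo t, hi t)" by (simp add: s_def lo_def hi_def)
    have d: "m div 2 ^ Suc t = m div 2 ^ t div 2" by (simp only: power_Suc2 div_mult2_eq)
    show ?case
    proof (cases "lo t < hi t")
      case False
      then show ?thesis using Suc by (simp add: lo_def hi_def sS[unfolded lo_def hi_def] step_def)
    next
      case lt: True
      define mid where "mid = (lo t + hi t) div 2"
      have mid: "lo t \<le> mid" "mid < hi t" using lt by (auto simp: mid_def)
      have dd: "hi t - (mid + 1) \<le> (hi t - lo t) div 2" "mid - lo t \<le> (hi t - lo t) div 2"
        using lt by (auto simp: mid_def)
      have "(hi t - lo t) div 2 \<le> m div 2 ^ Suc t" unfolding d using Suc by (intro div_le_mono) auto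
      note dd = dd[THEN le_trans, OF this]
      show ?thesis
      proof (cases "K mid < k")
        case True
        have "lo (Suc t) = mid + 1" "hi (Suc t) = hi t"
          using lt True unfolding lo_def[of "Suc t"] hi_def[of "Suc t"] sS by (simp_all add: step_def mid_def)
        moreover have "K e < k" if "e < mid + 1" for e
          using mono[of e mid] that True mid Suc by (auto simp: less_Suc_eq_le)
        ultimately show ?thesis using Suc mid dd by auto
      next
        case False
        have "lo (Suc t) = lo t" "hi (Suc t) = mid"
          using lt False unfolding lo_def[of "Suc t"] hi_def[of "Suc t"] sS by (simp_all add: step_def mid_def)
        moreover have "k \<le> K e" if "mid \<le> e" "e < m" for e
          using mono[of mid e] that False by auto
        ultimately show ?thesis using Suc mid dd by auto
      qed
    qed
  qed
  define v where "v t = PairV (NatV (lo t)) (NatV (hi t))" for t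
  obtain T where T: "\<not> lo T < hi T" and
    run: "ev M (v 0 # ?env) (While ?b ?e) (v T) (Suc L * (cst ?b + cst ?e + 1))"
  proof (rule ev_While[where c = "\<lambda>t. lo t < hi t" and s = v and b = ?b and e = ?e and env = ?env
      and M = M and L = L and ?X1.0 = "cst ?b" and ?X2.0 = "cst ?e"])
    show "0 < M" by fact
    show "ev M (v t # ?env) ?b (NatV (if lo t < hi t then 1 else 0)) (cst ?b)" for t
      by (rule ev_den) (use M in \<open>simp_all add: v_def\<close>)
    show "ev M (v t # ?env) ?e (v (Suc t)) (cst ?e)" if lt: "lo t < hi t" for t
    proof (rule ev_den[OF M])
      have sS: "s (Suc t) = step (lo t, hi t)" by (simp add: s_def lo_def hi_def)
      have "(lo t + hi t) div 2 < m" using lt inv[of t] by auto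
      then show "den ?e (v t # ?env) = Some (v (Suc t))"
        using lt unfolding v_def[of "Suc t"] lo_def[of "Suc t"] hi_def[of "Suc t"] sS
        by (simp add: v_def step_def)
    qed
    show "\<not> lo L < hi L" using inv[of L] L by simp
  qed (use that in blast)
  have "card {e. e < m \<and> K e < k} = lo T"
    by (rule card_initial) (use inv[of T] T in \<open>auto simp: not_less\<close>)
  moreover have "ev M ?env (Op2 MkPair (NConst 0) (Op1 Length (fstP (Var 0)))) (v 0)
     (cst (Op2 MkPair (NConst 0) (Op1 Length (fstP (Var 0)))))"
    using M by (intro ev_den) (simp_all add: v_def lo_def hi_def s_def)
  ultimately have "ev M ?env searchP (NatV (card {e. e < m \<and> K e < k}))
     (cst (Op2 MkPair (NConst 0) (Op1 Length (fstP (Var 0)))) + (Suc L * (cst ?b + cst ?e + 1) + 1) + 1)"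
    unfolding searchP_def by (intro ev_Let[OF M _ ev_Op1[OF M run]]) (simp_all add: v_def)
  then show ?thesis by (rule ev_mono) simp_all
qed

text \<open>Compaction of the flagged elements. Without scatter operations, the element at position \<open>t\<close> of the
  output has to be found from there: it sits where the prefix sums of the flags first reach \<open>t + 1\<close>.\<close>

definition packP :: prg where
  "packP = LetIn (LetIn (sndP (Var 0)) (scanP NAdd))
    (Tab (Cond (Op1 Length (Var 0)) (Op2 Index (Var 0) (Op2 NSub (Op1 Length (Var 0)) (NConst 1))) (NConst 0))
      (Op2 Index (fstP (Var 2)) (LetIn (Op2 MkPair (Var 1) (Op2 NAdd (Var 0) (NConst 1))) searchP)))"

text \<open>The prefix sum at \<open>e\<close> counts the flags up to and including \<open>e\<close>; it is at most \<open>t\<close> exactly for the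
  positions before the flagged element with number \<open>t\<close>, counting from \<open>0\<close>.\<close>

lemma filter_nth_count:
  assumes "t < length (filter Q [0..<m])"
  shows "card {e. e < m \<and> length (filter Q [0..<Suc e]) < Suc t} = filter Q [0..<m] ! t
    \<and> filter Q [0..<m] ! t < m"
  using assms
proof (induction m)
  case 0
  then show ?case by simp
next
  case (Suc m)
  have le: "length (filter Q [0..<Suc e]) \<le> length (filter Q [0..<m])" if "e < m" for e
  proof -
    have "[0..<m] = [0..<Suc e] @ [Suc e..<m]" using that upt_add_eq_append[of 0 "Suc e" "m - Suc e"] by simp
    then have "filter Q [0..<m] = filter Q [0..<Suc e] @ filter Q [Suc e..<m]" by (metis filter_append)
    then show ?thesis by simp
  qed
  show ?case
  proof (cases "t < length (filter Q [0..<m])")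
    case True
    have "{e. e < Suc m \<and> length (filter Q [0..<Suc e]) < Suc t}
      = {e. e < m \<and> length (filter Q [0..<Suc e]) < Suc t}"
      using True by (auto simp: less_Suc_eq)
    then show ?thesis using Suc.IH[OF True] True by (simp add: nth_append)
  next
    case False
    then have Q: "Q m" and t: "t = length (filter Q [0..<m])" using Suc.prems by (auto split: if_splits)
    have "card {e. e < Suc m \<and> length (filter Q [0..<Suc e]) < Suc t} = m"
    proof (rule card_initial)
      show "length (filter Q [0..<Suc e]) < Suc t" if "e < m" for e using le[OF that] t by simp
      show "\<not> length (filter Q [0..<Suc e]) < Suc t" if "m \<le> e" "e < Suc m" for e
      proof -
        have "e = m" using that by simp
        then show ?thesis using Q t by simp
      qed
    qed simp
    then show ?thesis using Q t by (simp add: nth_append)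
  qed
qed

lemma pack_run:
  assumes M: "0 < M" "m \<le> M" and L: "m < 2 ^ L"
  shows "ev M (PairV (arr m f) (narr m (\<lambda>i. if Q i then 1 else 0)) # env) packP
    (ArrV (map f (filter Q [0..<m]))) (300 * (L + 1))"
proof -
  let ?env = "PairV (arr m f) (narr m (\<lambda>i. if Q i then 1 else 0)) # env"
  define S where "S i = length (filter Q [0..<Suc i])" for i
  have S_sum: "(\<Sum>j\<le>i. if Q j then 1 else 0) = S i" for i
  proof (induction i)
    case (Suc i)
    then show ?case by (simp add: S_def)
  qed (simp add: S_def)
  have S_mono: "S i \<le> S j" if "i \<le> j" for i j
    unfolding S_sum[symmetric] using that by (intro sum_mono2) auto
  have "ev M ?env (sndP (Var 0)) (narr m (\<lambda>i. if Q i then 1 else 0)) 2"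
    using ev_den[OF M(1), of "sndP (Var 0)" ?env] by (simp add: numeral_2_eq_2)
  moreover have "ev M (narr m (\<lambda>i. if Q i then 1 else 0) # ?env) (scanP NAdd) (narr m S) (100 * (L + 1))"
    using scan_run[where f = NAdd and enc = NatV and g = "\<lambda>i. if Q i then 1 else 0" and m = m, OF _ M less_imp_le[OF L]]
    by (simp add: S_sum)
  ultimately have 1: "ev M ?env (LetIn (sndP (Var 0)) (scanP NAdd)) (narr m S) (2 + 100 * (L + 1) + 1)"
    by (intro ev_Let M(1))
  let ?env1 = "narr m S # ?env"
  define len where "len = length (filter Q [0..<m])"
  have len: "len \<le> M" unfolding len_def using M length_filter_le[of Q "[0..<m]"] by simp
  let ?n = "Cond (Op1 Length (Var 0)) (Op2 Index (Var 0) (Op2 NSub (Op1 Length (Var 0)) (NConst 1))) (NConst 0)"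
  have 2: "ev M ?env1 ?n (NatV len) (cst ?n)"
    by (rule ev_den[OF M(1)]) (cases m; simp add: S_def len_def)
  have 3: "ev 1 (NatV i # ?env1)
     (Op2 Index (fstP (Var 2)) (LetIn (Op2 MkPair (Var 1) (Op2 NAdd (Var 0) (NConst 1))) searchP))
     (f (filter Q [0..<m] ! i)) (3 + ((5 + 100 * (L + 1)) + 1) + 1)" if i: "i < len" for i
  proof (rule ev_Op2)
    have e: "ev 1 (NatV i # ?env1) (fstP (Var 2)) (arr m f) (cst (fstP (Var 2)))"
      by (rule ev_den) simp_all
    show "ev 1 (NatV i # ?env1) (fstP (Var 2)) (arr m f) 3" by (rule ev_mono[OF e]) simp_all
    have "ev 1 (NatV i # ?env1) (Op2 MkPair (Var 1) (Op2 NAdd (Var 0) (NConst 1)))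
       (PairV (narr m S) (NatV (Suc i))) (cst (Op2 MkPair (Var 1) (Op2 NAdd (Var 0) (NConst 1))))"
      by (rule ev_den) simp_all
    then have a: "ev 1 (NatV i # ?env1) (Op2 MkPair (Var 1) (Op2 NAdd (Var 0) (NConst 1)))
       (PairV (narr m S) (NatV (Suc i))) 5"
      by (rule ev_mono) simp_all
    show "ev 1 (NatV i # ?env1) (LetIn (Op2 MkPair (Var 1) (Op2 NAdd (Var 0) (NConst 1))) searchP)
      (NatV (card {e. e < m \<and> S e < Suc i})) ((5 + 100 * (L + 1)) + 1)"
      by (rule ev_Let[OF _ a search_run]) (auto intro: S_mono L)
    show "app2 Index (arr m f) (NatV (card {e. e < m \<and> S e < Suc i})) = Some (f (filter Q [0..<m] ! i))"
      using filter_nth_count[of i Q m] i unfolding S_def len_def by simp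
  qed simp
  have 4: "ev M ?env packP (arr len (\<lambda>i. f (filter Q [0..<m] ! i)))
     ((2 + 100 * (L + 1) + 1) + (cst ?n + (3 + ((5 + 100 * (L + 1)) + 1) + 1) + 1) + 1)"
    unfolding packP_def by (intro ev_Let[OF M(1) 1] ev_Tab_arr(1)[OF M(1) len 2] 3)
  show ?thesis using ev_mono[OF 4 order_refl, of "300 * (L + 1)"]
    unfolding len_def arr_eq_ArrV by simp
qed

lemma pack_list_run:
  assumes M: "0 < M" "length us \<le> M" and L: "length us < 2 ^ L"
  shows "ev M (PairV (arr (length us) (\<lambda>t. f (us ! t))) (narr (length us) (\<lambda>t. if q (us ! t) then 1 else 0)) # env) packP
    (arr (length (filter q us)) (\<lambda>t. f (filter q us ! t))) (300 * (L + 1))"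
proof -
  have "map (\<lambda>t. f (us ! t)) (filter (\<lambda>t. q (us ! t)) [0..<length us]) = map f (filter q us)"
  proof -
    have "filter q us = filter q (map (\<lambda>t. us ! t) [0..<length us])" by (simp add: map_nth)
    also have "\<dots> = map (\<lambda>t. us ! t) (filter (\<lambda>t. q (us ! t)) [0..<length us])"
      by (simp add: filter_map comp_def)
    finally show ?thesis by (simp add: comp_def)
  qed
  then show ?thesis
    using pack_run[OF M L, of "\<lambda>t. f (us ! t)" "\<lambda>t. q (us ! t)" env] by (simp add: arr_eq_ArrV)
qed

section \<open>Radix sort\<close>

text \<open>The lowest bit of a number, as the model has no remainder operation.\<close>

definition bitP :: prg where
  "bitP = Op2 NSub (Var 0) (Op2 NAdd (Op1 Half (Var 0)) (Op1 Half (Var 0)))"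

text \<open>One round of radix sort: a stable partition by the lowest key bit, after which that bit is dropped.
  The state pairs an upper bound of all keys with the array, and the bound is halved along, so
  that it vanishes when all bits have been processed.\<close>

definition radixP :: prg where
  "radixP = LetIn (Tab (Op1 Length (sndP (Var 0))) (LetIn (fstP (Op2 Index (sndP (Var 1)) (Var 0))) bitP))
   (LetIn (LetIn (Op2 MkPair (sndP (Var 1)) (Tab (Op1 Length (Var 0)) (Op2 NSub (NConst 1) (Op2 Index (Var 1) (Var 0))))) packP)
   (LetIn (LetIn (Op2 MkPair (sndP (Var 2)) (Var 1)) packP)
     (Op2 MkPair (Op1 Half (fstP (Var 3)))
       (Tab (Op2 NAdd (Op1 Length (Var 1)) (Op1 Length (Var 0)))
         (LetIn (Cond (Op2 NLess (Var 0) (Op1 Length (Var 2))) (Op2 Index (Var 2) (Var 0))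
                      (Op2 Index (Var 1) (Op2 NSub (Var 0) (Op1 Length (Var 2)))))
           (Op2 MkPair (Op1 Half (fstP (Var 0))) (sndP (Var 0))))))))"

lemma radix_run:
  fixes k :: "nat \<Rightarrow> nat"
  assumes M: "0 < M" "length us \<le> M" and L: "length us < 2 ^ L"
  defines "us' \<equiv> filter (\<lambda>u. even (k u)) us @ filter (\<lambda>u. odd (k u)) us"
  shows "ev M (PairV (NatV B) (arr (length us) (\<lambda>t. PairV (NatV (k (us ! t))) (NatV (us ! t)))) # env) radixP
    (PairV (NatV (B div 2)) (arr (length us) (\<lambda>t. PairV (NatV (k (us' ! t) div 2)) (NatV (us' ! t)))))
    (1000 * (L + 1))"
proof -
  let ?f = "\<lambda>u. PairV (NatV (k u)) (NatV u)"
  let ?m = "length us"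
  define A where "A = arr ?m (\<lambda>t. ?f (us ! t))"
  let ?env = "PairV (NatV B) A # env"
  define bits where "bits = narr ?m (\<lambda>t. if odd (k (us ! t)) then 1 else 0)"
  let ?Z = "filter (\<lambda>u. even (k u)) us" and ?O = "filter (\<lambda>u. odd (k u)) us"
  define Z where "Z = arr (length ?Z) (\<lambda>t. ?f (?Z ! t))"
  define Od where "Od = arr (length ?O) (\<lambda>t. ?f (?O ! t))"
  have len: "length ?Z + length ?O = ?m"
    using sum_length_filter_compl[of "\<lambda>u. even (k u)" us] by simp
  let ?p1 = "Tab (Op1 Length (sndP (Var 0))) (LetIn (fstP (Op2 Index (sndP (Var 1)) (Var 0))) bitP)"
  have 1: "ev M ?env ?p1 bits (cst ?p1)"
    unfolding bits_def
  proof (rule ev_Tab_arr(2)[OF M])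
    fix i assume "i < ?m"
    moreover have "k - (k div 2 + k div 2) = (if odd k then 1 else 0)" for k :: nat by presburger
    ultimately show "den (LetIn (fstP (Op2 Index (sndP (Var 1)) (Var 0))) bitP) (NatV i # ?env) =
         Some (NatV (if odd (k (us ! i)) then 1 else 0))"
      by (simp add: A_def bitP_def)
  qed (simp add: A_def)
  let ?env1 = "bits # ?env"
  let ?t2 = "Tab (Op1 Length (Var 0)) (Op2 NSub (NConst 1) (Op2 Index (Var 1) (Var 0)))"
  have "ev M ?env1 ?t2 (narr ?m (\<lambda>t. if even (k (us ! t)) then 1 else 0)) (cst ?t2)"
    by (rule ev_Tab_arr(2)[OF M]) (simp_all add: bits_def)
  moreover have "ev M ?env1 (sndP (Var 1)) A (cst (sndP (Var 1)))" by (rule ev_den[OF M(1)]) simp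
  ultimately have "ev M ?env1 (Op2 MkPair (sndP (Var 1)) ?t2)
      (PairV A (narr ?m (\<lambda>t. if even (k (us ! t)) then 1 else 0))) (cst (sndP (Var 1)) + cst ?t2 + 1)"
    by (intro ev_Pair M(1))
  then have 2: "ev M ?env1 (LetIn (Op2 MkPair (sndP (Var 1)) ?t2) packP) Z
     (cst (sndP (Var 1)) + cst ?t2 + 1 + 300 * (L + 1) + 1)"
    unfolding A_def Z_def by (rule ev_Let[OF M(1) _ pack_list_run[OF M L]])
  let ?env2 = "Z # ?env1"
  have "ev M ?env2 (Op2 MkPair (sndP (Var 2)) (Var 1)) (PairV A bits) (cst (Op2 MkPair (sndP (Var 2)) (Var 1)))"
    by (rule ev_den[OF M(1)]) simp
  then have 3: "ev M ?env2 (LetIn (Op2 MkPair (sndP (Var 2)) (Var 1)) packP) Od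
     (cst (Op2 MkPair (sndP (Var 2)) (Var 1)) + 300 * (L + 1) + 1)"
    unfolding A_def Od_def bits_def by (rule ev_Let[OF M(1) _ pack_list_run[OF M L]])
  let ?env3 = "Od # ?env2"
  let ?b4 = "LetIn (Cond (Op2 NLess (Var 0) (Op1 Length (Var 2))) (Op2 Index (Var 2) (Var 0))
                      (Op2 Index (Var 1) (Op2 NSub (Var 0) (Op1 Length (Var 2)))))
           (Op2 MkPair (Op1 Half (fstP (Var 0))) (sndP (Var 0)))"
  let ?t4 = "Tab (Op2 NAdd (Op1 Length (Var 1)) (Op1 Length (Var 0))) ?b4"
  have 4: "ev M ?env3 ?t4 (arr ?m (\<lambda>t. PairV (NatV (k (us' ! t) div 2)) (NatV (us' ! t)))) (cst ?t4)"
  proof (rule ev_Tab_arr(2)[OF M])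
    show "den (Op2 NAdd (Op1 Length (Var 1)) (Op1 Length (Var 0))) ?env3 = Some (NatV ?m)"
      using len by (simp add: Z_def Od_def)
    fix i assume "i < ?m"
    then have "i - length ?Z < length ?O" if "\<not> i < length ?Z" using len that by simp
    then show "den ?b4 (NatV i # ?env3) = Some (PairV (NatV (k (us' ! i) div 2)) (NatV (us' ! i)))"
      by (cases "i < length ?Z") (simp_all add: Z_def Od_def us'_def nth_append)
  qed
  have 5: "ev M ?env3 (Op1 Half (fstP (Var 3))) (NatV (B div 2)) (cst (Op1 Half (fstP (Var 3))))"
    by (rule ev_den[OF M(1)]) simp
  note r = ev_Let[OF M(1) 1 ev_Let[OF M(1) 2 ev_Let[OF M(1) 3 ev_Pair[OF M(1) 5 4]]]]
  show ?thesis using ev_mono[OF r order_refl, of "1000 * (L + 1)"]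
    unfolding radixP_def A_def by (simp add: bitP_def)
qed

text \<open>Each key travels with its original position, so that the result is a permutation of positions.\<close>

definition sortP :: prg where
  "sortP = LetIn (Op2 MkPair (fstP (Var 0))
      (Tab (Op1 Length (sndP (Var 0))) (Op2 MkPair (Op2 Index (sndP (Var 1)) (Var 0)) (Var 0))))
    (LetIn (sndP (While (Op2 NLess (NConst 0) (fstP (Var 0))) radixP))
      (Tab (Op1 Length (Var 0)) (sndP (Op2 Index (Var 1) (Var 0)))))"

definition sorts :: "nat \<Rightarrow> (nat \<Rightarrow> nat) \<Rightarrow> nat list \<Rightarrow> bool" where
  "sorts m K us \<longleftrightarrow> distinct us \<and> set us = {..<m} \<and> sorted (map K us)"

lemma sorts_length: "sorts m K us \<Longrightarrow> length us = m"
  unfolding sorts_def using distinct_card by fastforce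

text \<open>After \<open>t\<close> rounds the positions are sorted by their keys modulo \<open>2 ^ t\<close>, because each partition is
  stable.\<close>

lemma sort_run:
  assumes M: "0 < M" "m \<le> M" and L: "m < 2 ^ L" "B < 2 ^ L" and K: "\<And>i. i < m \<Longrightarrow> K i \<le> B"
  shows "\<exists>us. sorts m K us \<and>
    ev M (PairV (NatV B) (narr m K) # env) sortP (narr m (\<lambda>t. us ! t)) (2000 * (L + 1)\<^sup>2)"
proof -
  define U where "U = rec_nat [0..<m] (\<lambda>t us. filter (\<lambda>u. even (K u div 2 ^ t)) us @ filter (\<lambda>u. odd (K u div 2 ^ t)) us)"
  have U0: "U 0 = [0..<m]"
    and US: "U (Suc t) = filter (\<lambda>u. even (K u div 2 ^ t)) (U t) @ filter (\<lambda>u. odd (K u div 2 ^ t)) (U t)" for t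
    by (simp_all add: U_def)
  have inv: "sorts m (\<lambda>u. K u mod 2 ^ t) (U t)" for t
  proof (induction t)
    case 0
    have "map (\<lambda>u. 0) [0..<m] = replicate m (0 :: nat)" by (simp add: map_replicate_const)
    then show ?case by (simp add: sorts_def U0 atLeast0LessThan)
  next
    case (Suc t)
    have m: "K u mod 2 ^ Suc t = 2 ^ t * (K u div 2 ^ t mod 2) + K u mod 2 ^ t" for u
      using mod_mult2_eq[of "K u" "2 ^ t" 2] by (simp add: mult.commute)
    have s: "sorted (map (\<lambda>u. K u mod 2 ^ t) (U t))" using Suc by (simp add: sorts_def)
    have "map (\<lambda>u. K u mod 2 ^ Suc t) (filter (\<lambda>u. even (K u div 2 ^ t)) (U t))
       = map (\<lambda>u. K u mod 2 ^ t) (filter (\<lambda>u. even (K u div 2 ^ t)) (U t))"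
      by (rule map_cong) (auto simp: m simp del: power_Suc)
    then have 1: "sorted (map (\<lambda>u. K u mod 2 ^ Suc t) (filter (\<lambda>u. even (K u div 2 ^ t)) (U t)))"
      using sorted_filter[OF s] by metis
    have "map (\<lambda>u. K u mod 2 ^ Suc t) (filter (\<lambda>u. odd (K u div 2 ^ t)) (U t))
       = map (\<lambda>k. 2 ^ t + k) (map (\<lambda>u. K u mod 2 ^ t) (filter (\<lambda>u. odd (K u div 2 ^ t)) (U t)))"
      by (auto simp: m odd_iff_mod_2_eq_one simp del: power_Suc)
    moreover have "sorted (map (\<lambda>k. 2 ^ t + k) ks)" if "sorted ks" for ks :: "nat list"
      using that by (simp add: sorted_map sorted_wrt_mono_rel[of ks "(\<le>)"])
    ultimately have 2: "sorted (map (\<lambda>u. K u mod 2 ^ Suc t) (filter (\<lambda>u. odd (K u div 2 ^ t)) (U t)))"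
      using sorted_filter[OF s] by metis
    have 3: "K u mod 2 ^ Suc t \<le> K v mod 2 ^ Suc t" if "even (K u div 2 ^ t)" "odd (K v div 2 ^ t)" for u v
    proof -
      have "K u mod 2 ^ Suc t = K u mod 2 ^ t" "K v mod 2 ^ Suc t = 2 ^ t + K v mod 2 ^ t"
        using that by (simp_all add: m odd_iff_mod_2_eq_one del: power_Suc)
      moreover have "K u mod 2 ^ t < 2 ^ t" by simp
      ultimately show ?thesis by linarith
    qed
    show ?case using Suc 1 2 3 unfolding sorts_def US by (auto simp: sorted_append simp del: power_Suc)
  qed
  have len: "length (U t) = m" for t using inv sorts_length by blast
  define s where "s t = PairV (NatV (B div 2 ^ t)) (arr m (\<lambda>i. PairV (NatV (K (U t ! i) div 2 ^ t)) (NatV (U t ! i))))" for t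
  let ?env = "PairV (NatV B) (narr m K) # env"
  let ?b = "Op2 NLess (NConst 0) (fstP (Var 0))"
  obtain T where T: "\<not> 0 < B div 2 ^ T" and
    run: "ev M (s 0 # ?env) (While ?b radixP) (s T) (Suc L * (cst ?b + 1000 * (L + 1) + 1))"
  proof (rule ev_While[where c = "\<lambda>t. 0 < B div 2 ^ t" and s = s and b = ?b and e = radixP and env = ?env
      and M = M and L = L and ?X1.0 = "cst ?b" and ?X2.0 = "1000 * (L + 1)"])
    show "0 < M" by fact
    show "ev M (s t # ?env) ?b (NatV (if 0 < B div 2 ^ t then 1 else 0)) (cst ?b)" for t
      by (rule ev_den) (use M in \<open>simp_all add: s_def\<close>)
    show "ev M (s t # ?env) radixP (s (Suc t)) (1000 * (L + 1))" for t
    proof -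
      have dd: "k div 2 ^ t div 2 = k div 2 ^ Suc t" for k :: nat
        by (simp only: power_Suc2 div_mult2_eq)
      show ?thesis
        using radix_run[of M "U t" L "B div 2 ^ t" "\<lambda>u. K u div 2 ^ t" ?env] M L
        unfolding len s_def US[symmetric] dd by simp
    qed
    show "\<not> 0 < B div 2 ^ L" using L by simp
  qed (use that in blast)
  have B: "B < 2 ^ T" using T by (simp add: div_eq_0_iff)
  have sorts: "sorts m K (U T)"
  proof -
    have eq: "map (\<lambda>u. K u mod 2 ^ T) (U T) = map K (U T)"
      using inv[of T] K B by (intro map_cong refl mod_less) (force simp: sorts_def)
    show ?thesis using inv[of T] unfolding sorts_def eq .
  qed
  let ?p1 = "Tab (Op1 Length (sndP (Var 0))) (Op2 MkPair (Op2 Index (sndP (Var 1)) (Var 0)) (Var 0))"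
  have p1: "ev M ?env ?p1 (arr m (\<lambda>i. PairV (NatV (K i)) (NatV i))) (cst ?p1)"
    by (rule ev_Tab_arr(2)[OF M]) simp_all
  have p0: "ev M ?env (fstP (Var 0)) (NatV B) (cst (fstP (Var 0)))" by (rule ev_den[OF M(1)]) simp
  have s0: "s 0 = PairV (NatV B) (arr m (\<lambda>i. PairV (NatV (K i)) (NatV i)))"
    unfolding s_def by (simp add: U0 cong: arr_cong)
  have 1: "ev M ?env (Op2 MkPair (fstP (Var 0)) ?p1) (s 0) (cst (fstP (Var 0)) + cst ?p1 + 1)"
    unfolding s0 by (rule ev_Pair[OF M(1) p0 p1])
  define A where "A = arr m (\<lambda>i. PairV (NatV (K (U T ! i) div 2 ^ T)) (NatV (U T ! i)))"
  have 2: "ev M (s 0 # ?env) (sndP (While ?b radixP)) A (Suc L * (cst ?b + 1000 * (L + 1) + 1) + 1)"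
    by (rule ev_Op1[OF M(1) run]) (simp add: s_def A_def)
  let ?p3 = "Tab (Op1 Length (Var 0)) (sndP (Op2 Index (Var 1) (Var 0)))"
  have 3: "ev M (A # s 0 # ?env) ?p3 (narr m (\<lambda>t. U T ! t)) (cst ?p3)"
    by (rule ev_Tab_arr(2)[OF M]) (simp_all add: A_def)
  note r = ev_Let[OF M(1) 1 ev_Let[OF M(1) 2 3]]
  have "ev M ?env sortP (narr m (\<lambda>t. U T ! t)) (2000 * (L + 1)\<^sup>2)"
    using ev_mono[OF r order_refl, of "2000 * (L + 1)\<^sup>2"]
    unfolding sortP_def by (simp add: power2_eq_square algebra_simps)
  with sorts show ?thesis by blast
qed

section \<open>Sums over groups\<close>

text \<open>The preprocessing for sums over equal keys: the sorting permutation together with, for every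
  element, the bounds of the segment that its key occupies in sorted order. With the
  bounds stored per element, the keys may be arbitrarily sparse.\<close>

definition groupP :: prg where
  "groupP = LetIn sortP
    (LetIn (Tab (Op1 Length (Var 0)) (Op2 Index (sndP (Var 2)) (Op2 Index (Var 1) (Var 0))))
      (Op2 MkPair (Var 1) (Tab (Op1 Length (Var 0))
        (Op2 MkPair (LetIn (Op2 MkPair (Var 1) (Op2 Index (sndP (Var 3)) (Var 0))) searchP)
           (LetIn (Op2 MkPair (Var 1) (Op2 NAdd (Op2 Index (sndP (Var 3)) (Var 0)) (NConst 1))) searchP)))))"

definition below :: "nat \<Rightarrow> (nat \<Rightarrow> nat) \<Rightarrow> nat list \<Rightarrow> nat \<Rightarrow> nat" where
  "below m K us k = card {t. t < m \<and> K (us ! t) < k}"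

definition groupV :: "nat \<Rightarrow> (nat \<Rightarrow> nat) \<Rightarrow> nat list \<Rightarrow> val" where
  "groupV m K us = PairV (narr m (\<lambda>t. us ! t))
     (arr m (\<lambda>e. PairV (NatV (below m K us (K e))) (NatV (below m K us (Suc (K e))))))"

lemma sorts_mono:
  assumes "sorts m K us" "i \<le> j" "j < m"
  shows "K (us ! i) \<le> K (us ! j)"
  using assms sorts_length[OF assms(1)] sorted_nth_mono[of "map K us" i j] by (simp add: sorts_def)

lemma sorts_nth_less: "sorts m K us \<Longrightarrow> t < m \<Longrightarrow> us ! t < m"
  using sorts_length[of m K us] nth_mem[of t us] by (auto simp: sorts_def)

lemma less_below_iff: "sorts m K us \<Longrightarrow> t < m \<Longrightarrow> t < below m K us k \<longleftrightarrow> K (us ! t) < k"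
  unfolding below_def by (rule card_less_iff[where K = "\<lambda>t. K (us ! t)"]) (auto intro: sorts_mono)

lemma below_le: "below m K us k \<le> m"
  unfolding below_def using card_mono[of "{..<m}" "{t. t < m \<and> K (us ! t) < k}"] by auto

lemma group_run:
  assumes M: "0 < M" "m \<le> M" and L: "m < 2 ^ L" "B < 2 ^ L" and K: "\<And>i. i < m \<Longrightarrow> K i \<le> B"
  shows "\<exists>us. sorts m K us \<and>
    ev M (PairV (NatV B) (narr m K) # env) groupP (groupV m K us) (3000 * (L + 1)\<^sup>2)"
proof -
  let ?env = "PairV (NatV B) (narr m K) # env"
  obtain us where us: "sorts m K us"
    and 1: "ev M ?env sortP (narr m (\<lambda>t. us ! t)) (2000 * (L + 1)\<^sup>2)"
    using sort_run[of M m L B K env, OF M L K] by blast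
  let ?env1 = "narr m (\<lambda>t. us ! t) # ?env"
  let ?p2 = "Tab (Op1 Length (Var 0)) (Op2 Index (sndP (Var 2)) (Op2 Index (Var 1) (Var 0)))"
  define SK where "SK = narr m (\<lambda>t. K (us ! t))"
  have 2: "ev M ?env1 ?p2 SK (cst ?p2)" unfolding SK_def
    by (rule ev_Tab_arr(2)[OF M]) (simp_all add: sorts_nth_less[OF us])
  let ?env2 = "SK # ?env1"
  have search: "ev 1 (PairV SK (NatV k) # env') searchP (NatV (below m K us k)) (100 * (L + 1))" for k env'
    unfolding SK_def below_def by (rule search_run) (auto intro: sorts_mono[OF us] L)
  let ?e1 = "Op2 MkPair (Var 1) (Op2 Index (sndP (Var 3)) (Var 0))"
  let ?e2 = "Op2 MkPair (Var 1) (Op2 NAdd (Op2 Index (sndP (Var 3)) (Var 0)) (NConst 1))"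
  have b: "ev 1 (NatV i # ?env2) (Op2 MkPair (LetIn ?e1 searchP) (LetIn ?e2 searchP))
     (PairV (NatV (below m K us (K i))) (NatV (below m K us (Suc (K i)))))
     ((cst ?e1 + 100 * (L + 1) + 1) + (cst ?e2 + 100 * (L + 1) + 1) + 1)" if i: "i < m" for i
  proof -
    have e1: "ev 1 (NatV i # ?env2) ?e1 (PairV SK (NatV (K i))) (cst ?e1)"
      by (rule ev_den) (use i in simp_all)
    have e2: "ev 1 (NatV i # ?env2) ?e2 (PairV SK (NatV (Suc (K i)))) (cst ?e2)"
      by (rule ev_den) (use i in simp_all)
    show ?thesis
      by (rule ev_Pair[OF _ ev_Let[OF _ e1 search] ev_Let[OF _ e2 search]]) simp_all
  qed
  have 3: "ev M ?env2 (Op2 MkPair (Var 1) (Tab (Op1 Length (Var 0)) (Op2 MkPair (LetIn ?e1 searchP) (LetIn ?e2 searchP))))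
    (groupV m K us) (1 + (2 + ((cst ?e1 + 100 * (L + 1) + 1) + (cst ?e2 + 100 * (L + 1) + 1) + 1) + 1) + 1)"
  proof -
    have a1: "ev M ?env2 (Var 1) (narr m (\<lambda>t. us ! t)) 1" using ev_den[OF M(1), of "Var 1" ?env2] by simp
    have a2: "ev M ?env2 (Op1 Length (Var 0)) (NatV m) 2"
      using ev_den[OF M(1), of "Op1 Length (Var 0)" ?env2] by (simp add: SK_def numeral_2_eq_2)
    show ?thesis unfolding groupV_def by (rule ev_Pair[OF M(1) a1 ev_Tab_arr(1)[OF M a2 b]])
  qed
  note r = ev_Let[OF M(1) 1 ev_Let[OF M(1) 2 3]]
  have "ev M ?env groupP (groupV m K us) (3000 * (L + 1)\<^sup>2)"
    using ev_mono[OF r order_refl, of "3000 * (L + 1)\<^sup>2"]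
    unfolding groupP_def by (simp add: power2_eq_square algebra_simps)
  with us show ?thesis by blast
qed

text \<open>Every element receives the sum over its group, as the difference of two prefix sums in sorted
  order. Arithmetic is exact, so no accuracy is lost by subtracting.\<close>

definition groupsumP :: prg where
  "groupsumP = LetIn (LetIn (Tab (Op1 Length (sndP (Var 0))) (Op2 Index (sndP (Var 1)) (Op2 Index (fstP (fstP (Var 1))) (Var 0)))) (scanP RAdd))
    (Tab (Op1 Length (Var 0))
      (LetIn (Op2 Index (sndP (fstP (Var 2))) (Var 0))
        (LetIn (Op2 Index (Var 2) (Op2 NSub (sndP (Var 0)) (NConst 1)))
          (Cond (fstP (Var 1)) (Op2 RSub (Var 0) (Op2 Index (Var 3) (Op2 NSub (fstP (Var 1)) (NConst 1)))) (Var 0)))))"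

lemma gsum_segment:
  assumes us: "sorts m K us"
  shows "gsum m K v k = (\<Sum>t<below m K us (Suc k). v (us ! t)) - (\<Sum>t<below m K us k. v (us ! t))"
proof -
  have len: "length us = m" by (rule sorts_length[OF us])
  have bij: "bij_betw (\<lambda>t. us ! t) {t. t < m \<and> K (us ! t) = k} {e. e < m \<and> K e = k}"
  proof (rule bij_betw_imageI)
    show "inj_on (\<lambda>t. us ! t) {t. t < m \<and> K (us ! t) = k}"
      using us len by (auto simp: sorts_def inj_on_def nth_eq_iff_index_eq)
    show "(\<lambda>t. us ! t) ` {t. t < m \<and> K (us ! t) = k} = {e. e < m \<and> K e = k}"
    proof -
      have "\<exists>t<m. e = us ! t" if "e < m" for e
      proof -
        have "e \<in> set us" using that us by (simp add: sorts_def)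
        then show ?thesis using len by (auto simp: in_set_conv_nth)
      qed
      then show ?thesis using sorts_nth_less[OF us] by blast
    qed
  qed
  have "gsum m K v k = (\<Sum>t | t < m \<and> K (us ! t) = k. v (us ! t))"
    unfolding gsum_def by (rule sum.reindex_bij_betw[OF bij, symmetric])
  moreover have le: "below m K us k \<le> below m K us (Suc k)"
    unfolding below_def by (rule card_mono) auto
  have "{t. t < m \<and> K (us ! t) = k} = {below m K us k..<below m K us (Suc k)}"
  proof (rule Set.set_eqI)
    fix t
    show "t \<in> {t. t < m \<and> K (us ! t) = k} \<longleftrightarrow> t \<in> {below m K us k..<below m K us (Suc k)}"
      using less_below_iff[OF us, of t k] less_below_iff[OF us, of t "Suc k"] below_le[of m K us "Suc k"]
      by (cases "t < m") auto
  qed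
  ultimately have "gsum m K v k = (\<Sum>t\<in>{below m K us k..<below m K us (Suc k)}. v (us ! t))" by simp
  also have "\<dots> = (\<Sum>t<below m K us (Suc k). v (us ! t)) - (\<Sum>t<below m K us k. v (us ! t))"
    using sum.atLeastLessThan_concat[of 0 "below m K us k" "below m K us (Suc k)" "\<lambda>t. v (us ! t)"] le
    by (simp add: lessThan_atLeast0)
  finally show ?thesis .
qed

lemma groupsum_run:
  assumes M: "0 < M" "m \<le> M" and L: "m < 2 ^ L" and us: "sorts m K us"
  shows "ev M (PairV (groupV m K us) (rarr m v) # env) groupsumP (rarr m (\<lambda>e. gsum m K v (K e))) (200 * (L + 1))"
proof -
  let ?env = "PairV (groupV m K us) (rarr m v) # env"
  let ?p1 = "Tab (Op1 Length (sndP (Var 0))) (Op2 Index (sndP (Var 1)) (Op2 Index (fstP (fstP (Var 1))) (Var 0)))"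
  have 1: "ev M ?env ?p1 (rarr m (\<lambda>t. v (us ! t))) (cst ?p1)"
    by (rule ev_Tab_arr(2)[OF M]) (simp_all add: groupV_def sorts_nth_less[OF us])
  define U where "U = rarr m (\<lambda>i. \<Sum>t\<le>i. v (us ! t))"
  have 2: "ev M (rarr m (\<lambda>t. v (us ! t)) # ?env) (scanP RAdd) U (100 * (L + 1))"
    unfolding U_def by (rule scan_run) (use M L in auto)
  let ?env1 = "U # ?env"
  let ?b = "LetIn (Op2 Index (sndP (fstP (Var 2))) (Var 0))
        (LetIn (Op2 Index (Var 2) (Op2 NSub (sndP (Var 0)) (NConst 1)))
          (Cond (fstP (Var 1)) (Op2 RSub (Var 0) (Op2 Index (Var 3) (Op2 NSub (fstP (Var 1)) (NConst 1)))) (Var 0)))"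
  have 3: "ev M ?env1 (Tab (Op1 Length (Var 0)) ?b) (rarr m (\<lambda>e. gsum m K v (K e))) (cst (Tab (Op1 Length (Var 0)) ?b))"
  proof (rule ev_Tab_arr(2)[OF M])
    show "den (Op1 Length (Var 0)) ?env1 = Some (NatV m)" by (simp add: U_def)
    fix e assume e: "e < m"
    define lo hi where "lo = below m K us (K e)" and "hi = below m K us (Suc (K e))"
    have hi: "hi \<le> m" "lo \<le> m" unfolding hi_def lo_def by (rule below_le)+
    have "e \<in> set us" using e us by (simp add: sorts_def)
    then obtain t where "t < m" "us ! t = e" using sorts_length[OF us] by (auto simp: in_set_conv_nth)
    then have "t < hi" using less_below_iff[OF us, of t "Suc (K e)"] by (simp add: hi_def)
    then have hi0: "0 < hi" by simp
    have pre: "(\<Sum>t\<le>h - 1. v (us ! t)) = (\<Sum>t<h. v (us ! t))" if "0 < h" for h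
      using that by (metis Suc_pred' lessThan_Suc_atMost)
    show "den ?b (NatV e # ?env1) = Some (RealV (gsum m K v (K e)))"
      using e hi hi0 pre[of lo] pre[OF hi0] unfolding gsum_segment[OF us]
      by (cases "lo = 0") (simp_all add: groupV_def U_def flip: lo_def hi_def)
  qed
  note r = ev_Let[OF M(1) ev_Let[OF M(1) 1 2] 3]
  show ?thesis using ev_mono[OF r order_refl, of "200 * (L + 1)"]
    unfolding groupsumP_def by simp
qed

definition totalP :: prg where
  "totalP = LetIn (scanP RAdd) (Op2 Index (Var 0) (Op2 NSub (Op1 Length (Var 0)) (NConst 1)))"

lemma total_run:
  assumes M: "0 < M" "m \<le> M" and L: "m < 2 ^ L" and m: "0 < m"
  shows "ev M (rarr m v # env) totalP (RealV (\<Sum>e<m. v e)) (200 * (L + 1))"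
proof -
  have 1: "ev M (rarr m v # env) (scanP RAdd) (rarr m (\<lambda>i. \<Sum>t\<le>i. v t)) (100 * (L + 1))"
    by (rule scan_run) (use M L in auto)
  let ?p = "Op2 Index (Var 0) (Op2 NSub (Op1 Length (Var 0)) (NConst 1))"
  have "(\<Sum>t\<le>m - 1. v t) = (\<Sum>e<m. v e)" using m by (metis Suc_pred' lessThan_Suc_atMost)
  then have 2: "ev M (rarr m (\<lambda>i. \<Sum>t\<le>i. v t) # rarr m v # env) ?p (RealV (\<Sum>e<m. v e)) (cst ?p)"
    by (intro ev_den[OF M(1)]) (use m in simp)
  show ?thesis using ev_mono[OF ev_Let[OF M(1) 1 2] order_refl, of "200 * (L + 1)"]
    unfolding totalP_def by simp
qed

lemma gsum_one_pos: "e < N \<Longrightarrow> 0 < gsum N key (\<lambda>_. 1) (key e)"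
  unfolding gsum_def by (intro sum_pos) auto

text \<open>A sum over the distinct keys, computed over the elements: dividing by the size of the group makes
  each key count once.\<close>

lemma sum_over_groups:
  "(\<Sum>e<N. g (key e) / gsum N key (\<lambda>_. 1) (key e)) = (\<Sum>k\<in>key ` {..<N}. g k)"
proof -
  have "gsum N key (\<lambda>_. 1) k \<noteq> 0" if "k \<in> key ` {..<N}" for k
    using that gsum_one_pos[of _ N key] by (force simp del: of_nat_0_less_iff)
  then have "(\<Sum>k\<in>key ` {..<N}. g k / gsum N key (\<lambda>_. 1) k * gsum N key (\<lambda>_. 1) k) = (\<Sum>k\<in>key ` {..<N}. g k)"
    by (intro sum.cong) auto
  then show ?thesis unfolding sum_mult_gsum by simp
qed

section \<open>Tuples\<close>

text \<open>Records are nested pairs, closed by a dummy so that all components are accessed alike.\<close>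

primrec tup :: "val list \<Rightarrow> val" where
  "tup [] = NatV 0"
| "tup (v # vs) = PairV v (tup vs)"

primrec tupP :: "prg list \<Rightarrow> prg" where
  "tupP [] = NConst 0"
| "tupP (e # es) = Op2 MkPair e (tupP es)"

primrec acc :: "nat \<Rightarrow> prg \<Rightarrow> prg" where
  "acc 0 e = fstP e"
| "acc (Suc k) e = acc k (sndP e)"

primrec proj :: "nat \<Rightarrow> val \<Rightarrow> val option" where
  "proj 0 v = app1 Fst v"
| "proj (Suc k) v = Option.bind (app1 Snd v) (proj k)"

lemma den_acc [simp]: "den (acc k e) env = Option.bind (den e env) (proj k)"
proof (induction k arbitrary: e)
  case 0
  then show ?case by (cases "den e env") auto
next
  case (Suc k)
  then show ?case by (cases "den e env") (auto simp: fun_eq_iff)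
qed

lemma cst_acc [simp]: "cst (acc k e) = cst e + k + 1"
  by (induction k arbitrary: e) auto

lemma proj_tup [simp]: "k < length vs \<Longrightarrow> proj k (tup vs) = Some (vs ! k)"
proof (induction vs arbitrary: k)
  case (Cons v vs)
  then show ?case by (cases k) auto
qed simp

text \<open>Tuples stay folded, so that the simplifier accesses components by position.\<close>

declare tup.simps [simp del] acc.simps [simp del] proj.simps [simp del]

lemma ev_tup_Nil: "0 < M \<Longrightarrow> ev M env (tupP []) (tup []) 1"
  using ev_den[of M "NConst 0" env] by (simp add: tup.simps)

lemma ev_tup_Cons:
  "0 < M \<Longrightarrow> ev M env e v X \<Longrightarrow> ev M env (tupP es) (tup vs) Y \<Longrightarrow> ev M env (tupP (e # es)) (tup (v # vs)) (X + Y + 1)"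
  by (simp only: tup.simps tupP.simps ev_Pair)

abbreviation "rc k \<equiv> Op1 RealOf (NConst k)"
abbreviation "ix a i \<equiv> Op2 Index a i"

lemma groupsum_call:
  assumes "0 < M" "m \<le> M" "m < 2 ^ L" "sorts m K us"
    and "ev M env g (groupV m K us) X1" "ev M env t (rarr m v) X2"
  shows "ev M env (LetIn (Op2 MkPair g t) groupsumP) (rarr m (\<lambda>e. gsum m K v (K e))) (X1 + X2 + 1 + 200 * (L + 1) + 1)"
  by (rule ev_Let[OF assms(1) ev_Pair[OF assms(1,5,6)] groupsum_run[OF assms(1-4)]])

section \<open>Dual extrapolation as a program\<close>

text \<open>One round of alternating minimization. Variable \<open>0\<close> is the state, consisting of the current error
  bound and of \<open>x\<close> and \<open>y\<close>; variable \<open>1\<close> holds the parameters and the linear function. Vectors indexed by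
  rows or columns are stored redundantly per entry.\<close>

definition altP :: prg where
  "altP =
    LetIn (LetIn (Op2 MkPair (acc 7 (acc 0 (Var 1)))
        (Tab (Op1 Length (acc 2 (Var 0))) (Op2 RMul (ix (acc 4 (acc 0 (Var 2))) (Var 0)) (ix (acc 2 (Var 1)) (Var 0))))) groupsumP)
    (LetIn (Tab (Op1 Length (Var 0))
        (LetIn (Op2 RDiv (Op2 RSub (rc 0) (ix (acc 1 (Var 3)) (Var 0))) (Op2 RMul (rc 12) (ix (Var 1) (Var 0))))
          (Cond (Op2 RLess (Var 0) (rc 0)) (rc 0) (Cond (Op2 RLess (rc 1) (Var 0)) (rc 1) (Var 0)))))
    (LetIn (LetIn (Op2 MkPair (acc 6 (acc 0 (Var 3)))
        (Tab (Op1 Length (Var 0)) (Op2 RMul (ix (acc 4 (acc 0 (Var 4))) (Var 0)) (Op2 RMul (ix (Var 1) (Var 0)) (ix (Var 1) (Var 0)))))) groupsumP)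
    (LetIn (Tab (Op1 Length (Var 0)) (Op1 Exp (Op2 RDiv
        (Op2 RSub (rc 0) (Op2 RAdd (ix (acc 2 (Var 5)) (Var 0)) (Op2 RMul (rc 6) (ix (Var 1) (Var 0)))))
        (Op2 RMul (rc 360) (acc 1 (acc 0 (Var 5)))))))
    (LetIn (LetIn (Tab (Op1 Length (Var 0)) (Op2 RDiv (ix (Var 1) (Var 0)) (ix (acc 5 (acc 0 (Var 6))) (Var 0)))) totalP)
      (tupP [Op2 RDiv (acc 0 (Var 5)) (rc 2), Var 3,
        Tab (Op1 Length (Var 1)) (Op2 RDiv (ix (Var 2) (Var 0)) (Var 1))])))))"

text \<open>Rounds of alternating minimization until the error bound is at most \<open>\<epsilon> / 4\<close>. The bound is tracked as
  a real number, as the model cannot convert reals to loop counters.\<close>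

definition proxP :: prg where
  "proxP = LetIn (tupP [acc 2 (acc 0 (Var 0)), acc 8 (acc 0 (Var 0)), acc 8 (acc 0 (Var 0))])
    (LetIn (While (Op2 RLess (Op2 RDiv (acc 0 (acc 0 (Var 1))) (rc 4)) (acc 0 (Var 0))) altP)
      (tupP [acc 1 (Var 0), acc 2 (Var 0)]))"

definition gradP :: prg where
  "gradP = LetIn (LetIn (Op2 MkPair (acc 6 (acc 0 (Var 0)))
        (Tab (Op1 Length (acc 1 (Var 0))) (Op2 RMul (ix (acc 3 (acc 0 (Var 1))) (Var 0)) (ix (acc 1 (Var 1)) (Var 0))))) groupsumP)
    (tupP [LetIn (Op2 MkPair (acc 7 (acc 0 (Var 1)))
        (Tab (Op1 Length (Var 0)) (Op2 RMul (ix (acc 3 (acc 0 (Var 2))) (Var 0)) (ix (acc 2 (Var 2)) (Var 0))))) groupsumP,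
      Tab (Op1 Length (Var 0)) (Op2 RSub (ix (acc 9 (acc 0 (Var 2))) (Var 0)) (ix (Var 1) (Var 0)))])"

text \<open>One step of dual extrapolation: a prox call, its gradient, a second prox call at twice that gradient,
  and the gradient there, which is added to the dual vectors. The state counts the steps and sums up
  the second points.\<close>

definition stepP :: prg where
  "stepP =
    LetIn (LetIn (tupP [Var 1, acc 1 (Var 0), acc 2 (Var 0)]) proxP)
    (LetIn (LetIn (tupP [Var 2, acc 0 (Var 0), acc 1 (Var 0)]) gradP)
    (LetIn (LetIn (tupP [Var 3,
        Tab (Op1 Length (acc 1 (Var 2))) (Op2 RAdd (ix (acc 1 (Var 3)) (Var 0)) (Op2 RMul (rc 2) (ix (acc 0 (Var 1)) (Var 0)))),
        Tab (Op1 Length (acc 1 (Var 2))) (Op2 RAdd (ix (acc 2 (Var 3)) (Var 0)) (Op2 RMul (rc 2) (ix (acc 1 (Var 1)) (Var 0))))]) proxP)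
    (LetIn (LetIn (tupP [Var 4, acc 0 (Var 0), acc 1 (Var 0)]) gradP)
      (tupP [Op2 RAdd (acc 0 (Var 4)) (rc 1),
        Tab (Op1 Length (acc 1 (Var 4))) (Op2 RAdd (ix (acc 1 (Var 5)) (Var 0)) (ix (acc 0 (Var 1)) (Var 0))),
        Tab (Op1 Length (acc 1 (Var 4))) (Op2 RAdd (ix (acc 2 (Var 5)) (Var 0)) (ix (acc 1 (Var 1)) (Var 0))),
        Tab (Op1 Length (acc 1 (Var 4))) (Op2 RAdd (ix (acc 3 (Var 5)) (Var 0)) (ix (acc 0 (Var 2)) (Var 0)))]))))"

definition loopP :: prg where
  "loopP = LetIn (tupP [rc 0, Tab (Op1 Length (acc 3 (Var 0))) (rc 0), Tab (Op1 Length (acc 3 (Var 0))) (rc 0),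
      Tab (Op1 Length (acc 3 (Var 0))) (rc 0)])
    (While (Op2 RLess (Op2 RMul (acc 0 (Var 0)) (acc 0 (Var 1))) (Op2 RAdd (acc 2 (Var 1)) (acc 2 (Var 1)))) stepP)"

text \<open>\<open>Li\<close> and \<open>Lm\<close> bound the rounds of the inner and the steps of the outer loop, \<open>L\<close> the logarithm of
  the number of entries.\<close>

locale solver = sparse_game N ri ci co b W
  for N :: nat and ri ci :: "nat \<Rightarrow> nat" and co b :: "nat \<Rightarrow> real" and W :: real +
  fixes \<epsilon> :: real and usR usC :: "nat list" and L Li Lm :: nat
  assumes eps: "0 < \<epsilon>" "\<epsilon> < 1"
    and usR: "sorts N ri usR" and usC: "sorts N ci usC"
    and L: "N < 2 ^ L"
    and Li: "360 * W * (1 + ln N) / 2 ^ Li \<le> \<epsilon> / 4"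
    and Lm: "2 * (360 * W * (1 + ln N)) \<le> real Lm * \<epsilon>"
begin

text \<open>An upper bound both of the initial error of alternating minimization and of the range of the
  regularizer. The summand \<open>1\<close> guarantees at least one round, also for \<open>N = 1\<close>.\<close>

definition budget where "budget = 360 * W * (1 + ln N)"

text \<open>The size of the row of an entry.\<close>

definition cnt :: "nat \<Rightarrow> real" where "cnt e = gsum N ri (\<lambda>_. 1) (ri e)"

lemma cnt_pos: "e < N \<Longrightarrow> 0 < cnt e"
  unfolding cnt_def by (rule gsum_one_pos)

lemma sum_over_rows: "(\<Sum>e<N. g (ri e) / cnt e) = (\<Sum>i\<in>R. g i)"
  unfolding cnt_def R_def by (rule sum_over_groups)

definition paramsV :: val where
  "paramsV = tup [RealV \<epsilon>, RealV W, RealV budget, rarr N co, rarr N (\<lambda>e. \<bar>co e\<bar>), rarr N cnt,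
     groupV N ri usR, groupV N ci usC, rarr N (\<lambda>e. y0 (ri e)), rarr N (\<lambda>e. b (ri e))]"

abbreviation "colA x \<equiv> rarr N (\<lambda>e. x (ci e))"
abbreviation "rowA y \<equiv> rarr N (\<lambda>e. y (ri e))"

lemma N_le: "0 < N" "N \<le> N" using N_pos by auto

lemma alt_run:
  fixes l q y :: "nat \<Rightarrow> real" and r :: real
  assumes y: "\<And>i. i \<in> R \<Longrightarrow> 0 < y i"
  defines "x' \<equiv> best_x l y"
  shows "ev N (tup [RealV r, X, rowA y] # tup [paramsV, colA l, rowA q] # env) altP
    (tup [RealV (r / 2), colA x', rowA (best_y q x')]) (1000 * (L + 1))"
proof -
  let ?st = "tup [RealV r, X, rowA y]" and ?A = "tup [paramsV, colA l, rowA q]"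
  let ?env0 = "?st # ?A # env"
  note M = N_le and T = ev_Tab_arr(2)[OF N_le]
  define a where "a j = gsum N ci (\<lambda>e. \<bar>co e\<bar> * y (ri e)) j" for j
  define h where "h i = gsum N ri (\<lambda>e. \<bar>co e\<bar> * (x' (ci e))\<^sup>2) i" for i
  have apos: "0 < a (ci e)" if "e < N" for e
    unfolding a_def gsum_def using that y co_nonzero by (intro sum_pos) auto
  let ?t1 = "Tab (Op1 Length (acc 2 (Var 0))) (Op2 RMul (ix (acc 4 (acc 0 (Var 2))) (Var 0)) (ix (acc 2 (Var 1)) (Var 0)))"
  have t1: "ev N ?env0 ?t1 (rarr N (\<lambda>e. \<bar>co e\<bar> * y (ri e))) (cst ?t1)"
    by (rule T) (simp_all add: paramsV_def)
  have g1: "ev N ?env0 (acc 7 (acc 0 (Var 1))) (groupV N ci usC) (cst (acc 7 (acc 0 (Var 1))))"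
    by (rule ev_den[OF M(1)]) (simp add: paramsV_def)
  note s1 = groupsum_call[OF M L usC g1 t1, folded a_def]
  let ?env1 = "colA a # ?env0"
  let ?t2 = "Tab (Op1 Length (Var 0))
        (LetIn (Op2 RDiv (Op2 RSub (rc 0) (ix (acc 1 (Var 3)) (Var 0))) (Op2 RMul (rc 12) (ix (Var 1) (Var 0))))
          (Cond (Op2 RLess (Var 0) (rc 0)) (rc 0) (Cond (Op2 RLess (rc 1) (Var 0)) (rc 1) (Var 0))))"
  have s2: "ev N ?env1 ?t2 (colA x') (cst ?t2)"
  proof (rule T)
    fix e assume e: "e < N"
    show "den (LetIn (Op2 RDiv (Op2 RSub (rc 0) (ix (acc 1 (Var 3)) (Var 0))) (Op2 RMul (rc 12) (ix (Var 1) (Var 0))))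
          (Cond (Op2 RLess (Var 0) (rc 0)) (rc 0) (Cond (Op2 RLess (rc 1) (Var 0)) (rc 1) (Var 0)))) (NatV e # ?env1)
      = Some (RealV (x' (ci e)))"
      using e apos[OF e] unfolding x'_def best_x_def Let_def by (simp flip: a_def)
  qed simp
  let ?env2 = "colA x' # ?env1"
  let ?t3 = "Tab (Op1 Length (Var 0)) (Op2 RMul (ix (acc 4 (acc 0 (Var 4))) (Var 0)) (Op2 RMul (ix (Var 1) (Var 0)) (ix (Var 1) (Var 0))))"
  have t3: "ev N ?env2 ?t3 (rarr N (\<lambda>e. \<bar>co e\<bar> * (x' (ci e))\<^sup>2)) (cst ?t3)"
    by (rule T) (simp_all add: paramsV_def power2_eq_square)
  have g3: "ev N ?env2 (acc 6 (acc 0 (Var 3))) (groupV N ri usR) (cst (acc 6 (acc 0 (Var 3))))"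
    by (rule ev_den[OF M(1)]) (simp add: paramsV_def)
  note s3 = groupsum_call[OF M L usR g3 t3, folded h_def]
  let ?env3 = "rowA h # ?env2"
  let ?t4 = "Tab (Op1 Length (Var 0)) (Op1 Exp (Op2 RDiv
        (Op2 RSub (rc 0) (Op2 RAdd (ix (acc 2 (Var 5)) (Var 0)) (Op2 RMul (rc 6) (ix (Var 1) (Var 0)))))
        (Op2 RMul (rc 360) (acc 1 (acc 0 (Var 5))))))"
  have s4: "ev N ?env3 ?t4 (rowA (weight_y q x')) (cst ?t4)"
    by (rule T) (use W_ge_1 in \<open>simp_all add: paramsV_def weight_y_def flip: h_def\<close>)
  let ?env4 = "rowA (weight_y q x') # ?env3"
  let ?t5 = "Tab (Op1 Length (Var 0)) (Op2 RDiv (ix (Var 1) (Var 0)) (ix (acc 5 (acc 0 (Var 6))) (Var 0)))"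
  have t5: "ev N ?env4 ?t5 (rarr N (\<lambda>e. weight_y q x' (ri e) / cnt e)) (cst ?t5)"
  proof (rule T)
    fix e assume e: "e < N"
    show "den (Op2 RDiv (ix (Var 1) (Var 0)) (ix (acc 5 (acc 0 (Var 6))) (Var 0))) (NatV e # ?env4)
      = Some (RealV (weight_y q x' (ri e) / cnt e))"
      using e cnt_pos[OF e] by (simp add: paramsV_def)
  qed simp
  define Z where "Z = (\<Sum>k\<in>R. weight_y q x' k)"
  have Z: "Z \<noteq> 0" using sum_weight_pos[of q x'] by (simp add: Z_def)
  note s5 = ev_Let[OF M(1) t5 total_run[OF M L M(1)], unfolded sum_over_rows, folded Z_def]
  let ?env5 = "RealV Z # ?env4"
  let ?t6 = "Tab (Op1 Length (Var 1)) (Op2 RDiv (ix (Var 2) (Var 0)) (Var 1))"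
  have c: "ev N ?env5 ?t6 (rowA (best_y q x')) (cst ?t6)"
    by (rule T) (use Z in \<open>simp_all add: best_y_def flip: Z_def\<close>)
  have a: "ev N ?env5 (Op2 RDiv (acc 0 (Var 5)) (rc 2)) (RealV (r / 2)) (cst (Op2 RDiv (acc 0 (Var 5)) (rc 2)))"
    by (rule ev_den[OF M(1)]) simp
  have b: "ev N ?env5 (Var 3) (colA x') (cst (Var 3))"
    by (rule ev_den[OF M(1)]) simp
  note s6 = ev_tup_Cons[OF M(1) a ev_tup_Cons[OF M(1) b ev_tup_Cons[OF M(1) c ev_tup_Nil[OF M(1)]]]]
  note r = ev_Let[OF M(1) s1 ev_Let[OF M(1) s2 ev_Let[OF M(1) s3 ev_Let[OF M(1) s4 ev_Let[OF M(1) s5 s6]]]]]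
  show ?thesis unfolding altP_def by (rule ev_mono[OF r order_refl]) simp
qed

definition rounds :: nat where "rounds = (LEAST k. budget / 2 ^ k \<le> \<epsilon> / 4)"

definition prox :: "(nat \<Rightarrow> real) \<Rightarrow> (nat \<Rightarrow> real) \<Rightarrow> (nat \<Rightarrow> real) \<times> (nat \<Rightarrow> real)" where
  "prox l q = alt l q rounds"

lemma rounds_pos: "budget / 2 ^ rounds \<le> \<epsilon> / 4" "0 < rounds"
proof -
  show 1: "budget / 2 ^ rounds \<le> \<epsilon> / 4" unfolding rounds_def by (rule LeastI[of _ Li]) (use Li in \<open>simp add: budget_def\<close>)
  have "0 \<le> ln (real N)" using N_pos by simp
  then have "360 * 1 * (1 + 0) \<le> 360 * W * (1 + ln N)"
    using W_ge_1 by (intro mult_mono) auto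
  then have "\<not> budget / 2 ^ 0 \<le> \<epsilon> / 4" using eps by (simp add: budget_def)
  then show "0 < rounds" using 1 by (metis gr0I)
qed

lemma prox_near_min: "near_min l q (\<epsilon> / 4) (fst (prox l q)) (snd (prox l q))"
proof -
  obtain k where k: "rounds = Suc k" using rounds_pos(2) by (cases rounds) auto
  have "360 * W * ln N / 2 ^ Suc k \<le> budget / 2 ^ Suc k"
    using W_ge_1 by (intro divide_right_mono) (auto simp: budget_def)
  then have "360 * W * ln N / 2 ^ Suc k \<le> \<epsilon> / 4" using rounds_pos(1) unfolding k by linarith
  then show ?thesis using alternating_minimization[of l q k] unfolding prox_def k near_min_def
    by (meson add_left_mono order_trans)
qed

lemma prox_run:
  "ev N (tup [paramsV, colA l, rowA q] # env) proxP
    (tup [colA (fst (prox l q)), rowA (snd (prox l q))]) (1200 * (Li + 1) * (L + 1))"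
proof -
  let ?A = "tup [paramsV, colA l, rowA q]"
  note M = N_le
  define X where "X t = (case t of 0 \<Rightarrow> rowA y0 | Suc k \<Rightarrow> colA (fst (alt l q t)))" for t
  define s where "s t = tup [RealV (budget / 2 ^ t), X t, rowA (snd (alt l q t))]" for t
  let ?env = "?A # env"
  let ?b = "Op2 RLess (Op2 RDiv (acc 0 (acc 0 (Var 1))) (rc 4)) (acc 0 (Var 0))"
  obtain T where T: "\<And>t. t < T \<Longrightarrow> \<epsilon> / 4 < budget / 2 ^ t" "\<not> \<epsilon> / 4 < budget / 2 ^ T" and
    run: "ev N (s 0 # ?env) (While ?b altP) (s T) (Suc Li * (cst ?b + 1000 * (L + 1) + 1))"
  proof (rule ev_While[where c = "\<lambda>t. \<epsilon> / 4 < budget / 2 ^ t" and s = s and b = ?b and e = altP and env = ?env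
      and M = N and L = Li and ?X1.0 = "cst ?b" and ?X2.0 = "1000 * (L + 1)"])
    show "0 < N" by fact
    show "ev N (s t # ?env) ?b (NatV (if \<epsilon> / 4 < budget / 2 ^ t then 1 else 0)) (cst ?b)" for t
      by (rule ev_den[OF M(1)]) (simp add: s_def paramsV_def)
    show "ev N (s t # ?env) altP (s (Suc t)) (1000 * (L + 1))" for t
    proof -
      have "s (Suc t) = tup [RealV (budget / 2 ^ t / 2), colA (best_x l (snd (alt l q t))),
          rowA (best_y q (best_x l (snd (alt l q t))))]"
        by (simp add: s_def X_def Let_def mult.commute)
      then show ?thesis unfolding s_def[of t] by (simp only:) (intro alt_run alt_y)
    qed
    show "\<not> \<epsilon> / 4 < budget / 2 ^ Li" using Li by (simp add: budget_def)
  qed (use that in blast)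
  have rounds: "rounds = T" unfolding rounds_def
    by (rule Least_equality) (use T in \<open>force simp: not_less not_le[symmetric]\<close>)+
  obtain k where k: "T = Suc k" using rounds_pos(2) rounds by (cases T) auto
  have sT: "s T = tup [RealV (budget / 2 ^ T), colA (fst (prox l q)), rowA (snd (prox l q))]"
    unfolding s_def X_def prox_def rounds k by simp
  have a: "ev N ?env (acc 2 (acc 0 (Var 0))) (RealV budget) (cst (acc 2 (acc 0 (Var 0))))"
    and b: "ev N ?env (acc 8 (acc 0 (Var 0))) (rowA y0) (cst (acc 8 (acc 0 (Var 0))))"
    by (rule ev_den[OF M(1)], simp add: paramsV_def)+
  have s0: "s 0 = tup [RealV budget, rowA y0, rowA y0]" by (simp add: s_def X_def)
  note s1 = ev_tup_Cons[OF M(1) a ev_tup_Cons[OF M(1) b ev_tup_Cons[OF M(1) b ev_tup_Nil[OF M(1)]]], folded s0]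
  have a2: "ev N (s T # s 0 # ?env) (acc 1 (Var 0)) (colA (fst (prox l q))) (cst (acc 1 (Var 0)))"
    and b2: "ev N (s T # s 0 # ?env) (acc 2 (Var 0)) (rowA (snd (prox l q))) (cst (acc 2 (Var 0)))"
    by (rule ev_den[OF M(1)], simp add: sT)+
  note s3 = ev_tup_Cons[OF M(1) a2 ev_tup_Cons[OF M(1) b2 ev_tup_Nil[OF M(1)]]]
  note r = ev_Let[OF M(1) s1 ev_Let[OF M(1) run s3]]
  show ?thesis unfolding proxP_def by (rule ev_mono[OF r order_refl]) (simp add: algebra_simps)
qed

lemma grad_run:
  "ev N (tup [paramsV, colA x, rowA y] # env) gradP (tup [colA (gx y), rowA (gy x)]) (1000 * (L + 1))"
proof -
  note M = N_le and T = ev_Tab_arr(2)[OF N_le]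
  let ?env = "tup [paramsV, colA x, rowA y] # env"
  define a where "a i = gsum N ri (\<lambda>e. co e * x (ci e)) i" for i
  let ?t1 = "Tab (Op1 Length (acc 1 (Var 0))) (Op2 RMul (ix (acc 3 (acc 0 (Var 1))) (Var 0)) (ix (acc 1 (Var 1)) (Var 0)))"
  have t1: "ev N ?env ?t1 (rarr N (\<lambda>e. co e * x (ci e))) (cst ?t1)"
    by (rule T) (simp_all add: paramsV_def)
  have g1: "ev N ?env (acc 6 (acc 0 (Var 0))) (groupV N ri usR) (cst (acc 6 (acc 0 (Var 0))))"
    by (rule ev_den[OF M(1)]) (simp add: paramsV_def)
  note s1 = groupsum_call[OF M L usR g1 t1, folded a_def]
  let ?env1 = "rowA a # ?env"
  let ?t2 = "Tab (Op1 Length (Var 0)) (Op2 RMul (ix (acc 3 (acc 0 (Var 2))) (Var 0)) (ix (acc 2 (Var 2)) (Var 0)))"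
  have t2: "ev N ?env1 ?t2 (rarr N (\<lambda>e. co e * y (ri e))) (cst ?t2)"
    by (rule T) (simp_all add: paramsV_def)
  have g2: "ev N ?env1 (acc 7 (acc 0 (Var 1))) (groupV N ci usC) (cst (acc 7 (acc 0 (Var 1))))"
    by (rule ev_den[OF M(1)]) (simp add: paramsV_def)
  note s2 = groupsum_call[OF M L usC g2 t2, folded gx_def]
  let ?t3 = "Tab (Op1 Length (Var 0)) (Op2 RSub (ix (acc 9 (acc 0 (Var 2))) (Var 0)) (ix (Var 1) (Var 0)))"
  have s3: "ev N ?env1 ?t3 (rowA (gy x)) (cst ?t3)"
    by (rule T) (simp_all add: paramsV_def gy_def a_def)
  note r = ev_Let[OF M(1) s1 ev_tup_Cons[OF M(1) s2 ev_tup_Cons[OF M(1) s3 ev_tup_Nil[OF M(1)]]]]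
  show ?thesis unfolding gradP_def by (rule ev_mono[OF r order_refl]) simp
qed

text \<open>The dual vectors after \<open>t\<close> steps: the sums of the gradients at the second points.\<close>

fun duals :: "nat \<Rightarrow> (nat \<Rightarrow> real) \<times> (nat \<Rightarrow> real)" where
  "duals 0 = (\<lambda>_. 0, \<lambda>_. 0)"
| "duals (Suc t) = (let (l, q) = duals t; z = prox l q;
     w = prox (\<lambda>j. l j + 2 * gx (snd z) j) (\<lambda>i. q i + 2 * gy (fst z) i)
   in (\<lambda>j. l j + 1 * gx (snd w) j, \<lambda>i. q i + 1 * gy (fst w) i))"

definition zs where "zs t = prox (fst (duals t)) (snd (duals t))"
definition ws where "ws t = prox (\<lambda>j. fst (duals t) j + 2 * gx (snd (zs t)) j) (\<lambda>i. snd (duals t) i + 2 * gy (fst (zs t)) i)"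
definition xsum where "xsum t j = (\<Sum>s<t. fst (ws s) j)"

lemma duals_Suc: "fst (duals (Suc t)) = (\<lambda>j. fst (duals t) j + 1 * gx (snd (ws t)) j)"
  "snd (duals (Suc t)) = (\<lambda>i. snd (duals t) i + 1 * gy (fst (ws t)) i)"
  by (simp_all add: Let_def ws_def zs_def case_prod_beta)

definition stV where
  "stV t = tup [RealV (real t), colA (fst (duals t)), rowA (snd (duals t)), colA (xsum t)]"

lemma step_run: "ev N (stV t # paramsV # env) stepP (stV (Suc t)) (8000 * (Li + 1) * (L + 1))"
proof -
  note M = N_le and T = ev_Tab_arr(2)[OF N_le] and D = ev_den[OF N_le(1)]
  define l q where "l = fst (duals t)" and "q = snd (duals t)"
  have st: "stV t = tup [RealV (real t), colA l, rowA q, colA (xsum t)]" by (simp add: stV_def l_def q_def)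
  let ?env0 = "stV t # paramsV # env"
  define z where "z = tup [colA (fst (zs t)), rowA (snd (zs t))]"
  have e1: "ev N ?env0 (Var 1) paramsV (cst (Var 1))" "ev N ?env0 (acc 1 (Var 0)) (colA l) (cst (acc 1 (Var 0)))"
    "ev N ?env0 (acc 2 (Var 0)) (rowA q) (cst (acc 2 (Var 0)))"
    by (rule D, simp add: st)+
  note s1 = ev_Let[OF M(1) ev_tup_Cons[OF M(1) e1(1) ev_tup_Cons[OF M(1) e1(2) ev_tup_Cons[OF M(1) e1(3) ev_tup_Nil[OF M(1)]]]] prox_run,
    unfolded l_def q_def, folded zs_def, folded z_def, folded l_def q_def]
  let ?env1 = "z # ?env0"
  have e2: "ev N ?env1 (Var 2) paramsV (cst (Var 2))" "ev N ?env1 (acc 0 (Var 0)) (colA (fst (zs t))) (cst (acc 0 (Var 0)))"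
    "ev N ?env1 (acc 1 (Var 0)) (rowA (snd (zs t))) (cst (acc 1 (Var 0)))"
    by (rule D, simp add: z_def)+
  define g where "g = tup [colA (gx (snd (zs t))), rowA (gy (fst (zs t)))]"
  note s2 = ev_Let[OF M(1) ev_tup_Cons[OF M(1) e2(1) ev_tup_Cons[OF M(1) e2(2) ev_tup_Cons[OF M(1) e2(3) ev_tup_Nil[OF M(1)]]]] grad_run,
    folded g_def]
  let ?env2 = "g # ?env1"
  let ?l = "\<lambda>j. l j + 2 * gx (snd (zs t)) j" and ?q = "\<lambda>i. q i + 2 * gy (fst (zs t)) i"
  let ?t1 = "Tab (Op1 Length (acc 1 (Var 2))) (Op2 RAdd (ix (acc 1 (Var 3)) (Var 0)) (Op2 RMul (rc 2) (ix (acc 0 (Var 1)) (Var 0))))"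
  let ?t2 = "Tab (Op1 Length (acc 1 (Var 2))) (Op2 RAdd (ix (acc 2 (Var 3)) (Var 0)) (Op2 RMul (rc 2) (ix (acc 1 (Var 1)) (Var 0))))"
  have e3: "ev N ?env2 (Var 3) paramsV (cst (Var 3))" by (rule D) simp
  have t1: "ev N ?env2 ?t1 (colA ?l) (cst ?t1)" by (rule T) (simp_all add: st g_def)
  have t2: "ev N ?env2 ?t2 (rowA ?q) (cst ?t2)" by (rule T) (simp_all add: st g_def)
  define w where "w = tup [colA (fst (ws t)), rowA (snd (ws t))]"
  have ws: "prox ?l ?q = ws t" by (simp add: ws_def l_def q_def)
  note s3 = ev_Let[OF M(1) ev_tup_Cons[OF M(1) e3 ev_tup_Cons[OF M(1) t1 ev_tup_Cons[OF M(1) t2 ev_tup_Nil[OF M(1)]]]] prox_run,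
    unfolded ws, folded w_def]
  let ?env3 = "w # ?env2"
  have e4: "ev N ?env3 (Var 4) paramsV (cst (Var 4))" "ev N ?env3 (acc 0 (Var 0)) (colA (fst (ws t))) (cst (acc 0 (Var 0)))"
    "ev N ?env3 (acc 1 (Var 0)) (rowA (snd (ws t))) (cst (acc 1 (Var 0)))"
    by (rule D, simp add: w_def)+
  define g' where "g' = tup [colA (gx (snd (ws t))), rowA (gy (fst (ws t)))]"
  note s4 = ev_Let[OF M(1) ev_tup_Cons[OF M(1) e4(1) ev_tup_Cons[OF M(1) e4(2) ev_tup_Cons[OF M(1) e4(3) ev_tup_Nil[OF M(1)]]]] grad_run,
    folded g'_def]
  let ?env4 = "g' # ?env3"
  let ?e5 = "Op2 RAdd (acc 0 (Var 4)) (rc 1)"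
  let ?t3 = "Tab (Op1 Length (acc 1 (Var 4))) (Op2 RAdd (ix (acc 1 (Var 5)) (Var 0)) (ix (acc 0 (Var 1)) (Var 0)))"
  let ?t4 = "Tab (Op1 Length (acc 1 (Var 4))) (Op2 RAdd (ix (acc 2 (Var 5)) (Var 0)) (ix (acc 1 (Var 1)) (Var 0)))"
  let ?t5 = "Tab (Op1 Length (acc 1 (Var 4))) (Op2 RAdd (ix (acc 3 (Var 5)) (Var 0)) (ix (acc 0 (Var 2)) (Var 0)))"
  have e5: "ev N ?env4 ?e5 (RealV (real (Suc t))) (cst ?e5)" by (rule D) (simp add: st add.commute)
  have t3: "ev N ?env4 ?t3 (colA (fst (duals (Suc t)))) (cst ?t3)"
    by (rule T) (simp_all add: st g'_def duals_Suc l_def del: duals.simps)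
  have t4: "ev N ?env4 ?t4 (rowA (snd (duals (Suc t)))) (cst ?t4)"
    by (rule T) (simp_all add: st g'_def duals_Suc q_def del: duals.simps)
  have t5: "ev N ?env4 ?t5 (colA (xsum (Suc t))) (cst ?t5)"
    by (rule T) (simp_all add: st w_def xsum_def)
  note s5 = ev_tup_Cons[OF M(1) e5 ev_tup_Cons[OF M(1) t3 ev_tup_Cons[OF M(1) t4 ev_tup_Cons[OF M(1) t5 ev_tup_Nil[OF M(1)]]]],
    folded stV_def]
  note r = ev_Let[OF M(1) s1 ev_Let[OF M(1) s2 ev_Let[OF M(1) s3 ev_Let[OF M(1) s4 s5]]]]
  show ?thesis unfolding stepP_def by (rule ev_mono[OF r order_refl]) (simp add: algebra_simps)
qed

lemma loop_run:
  obtains T where "2 * budget \<le> real T * \<epsilon>"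
    "ev N (paramsV # env) loopP (stV T) (9000 * (Lm + 1) * (Li + 1) * (L + 1))"
proof -
  note M = N_le and Tb = ev_Tab_arr(2)[OF N_le] and D = ev_den[OF N_le(1)]
  let ?b = "Op2 RLess (Op2 RMul (acc 0 (Var 0)) (acc 0 (Var 1))) (Op2 RAdd (acc 2 (Var 1)) (acc 2 (Var 1)))"
  let ?env = "paramsV # env"
  obtain T where T: "\<not> real T * \<epsilon> < budget + budget" and
    run: "ev N (stV 0 # ?env) (While ?b stepP) (stV T) (Suc Lm * (cst ?b + 8000 * (Li + 1) * (L + 1) + 1))"
  proof (rule ev_While[where c = "\<lambda>t. real t * \<epsilon> < budget + budget" and s = stV and b = ?b and e = stepP and env = ?env
      and M = N and L = Lm and ?X1.0 = "cst ?b" and ?X2.0 = "8000 * (Li + 1) * (L + 1)"])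
    show "0 < N" by fact
    show "ev N (stV t # ?env) ?b (NatV (if real t * \<epsilon> < budget + budget then 1 else 0)) (cst ?b)" for t
      by (rule D) (simp add: stV_def paramsV_def)
    show "ev N (stV t # ?env) stepP (stV (Suc t)) (8000 * (Li + 1) * (L + 1))" for t
      by (rule step_run)
    show "\<not> real Lm * \<epsilon> < budget + budget" using Lm by (simp add: budget_def)
  qed (use that in blast)
  let ?z = "Tab (Op1 Length (acc 3 (Var 0))) (rc 0)"
  have z: "ev N ?env ?z (rarr N (\<lambda>_. 0)) (cst ?z)" by (rule Tb) (simp_all add: paramsV_def)
  have r0: "ev N ?env (rc 0) (RealV 0) (cst (rc 0))" by (rule D) simp
  have st0: "stV 0 = tup [RealV 0, rarr N (\<lambda>_. 0), rarr N (\<lambda>_. 0), rarr N (\<lambda>_. 0)]"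
    by (simp add: stV_def xsum_def)
  note s1 = ev_tup_Cons[OF M(1) r0 ev_tup_Cons[OF M(1) z ev_tup_Cons[OF M(1) z ev_tup_Cons[OF M(1) z ev_tup_Nil[OF M(1)]]]],
    folded st0]
  note r = ev_Let[OF M(1) s1 run]
  have "ev N ?env loopP (stV T) (9000 * (Lm + 1) * (Li + 1) * (L + 1))"
    unfolding loopP_def by (rule ev_mono[OF r order_refl]) (simp add: algebra_simps)
  then show ?thesis using that[of T] T by simp
qed

lemma xsum_box: "0 \<le> xsum T j \<and> xsum T j \<le> real T"
proof -
  have "feas (fst (ws s)) (snd (ws s))" for s using prox_near_min unfolding ws_def near_min_def by blast
  then have "0 \<le> fst (ws s) j \<and> fst (ws s) j \<le> 1" for s by (simp add: feas_def)
  then show ?thesis unfolding xsum_def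
    using sum_nonneg[of "{..<T}" "\<lambda>s. fst (ws s) j"] sum_mono[of "{..<T}" "\<lambda>s. fst (ws s) j" "\<lambda>_. 1"] by simp
qed

text \<open>Once the number of steps is at least \<open>2 budget / \<epsilon>\<close>, the averaged regret contributes at most \<open>\<epsilon> / 2\<close> and
  the oracle errors another \<open>\<epsilon> / 2\<close>.\<close>

theorem average_solves:
  assumes T: "2 * budget \<le> real T * \<epsilon>"
    and x: "\<And>j. 0 \<le> x j \<and> x j \<le> 1"
    and sol: "\<And>k. k \<in> R \<Longrightarrow> gsum N ri (\<lambda>e. co e * x (ci e)) k \<le> b k"
    and i: "i \<in> R"
  shows "gsum N ri (\<lambda>e. co e * (xsum T (ci e) / real T)) i \<le> b i + \<epsilon>"
proof -
  have nm: "near_min (fst (duals t)) (snd (duals t)) (\<epsilon> / 4) (fst (zs t)) (snd (zs t))"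
    "near_min (\<lambda>j. fst (duals t) j + 2 * gx (snd (zs t)) j) (\<lambda>i. snd (duals t) i + 2 * gy (fst (zs t)) i) (\<epsilon> / 4)
      (fst (ws t)) (snd (ws t))" for t
    unfolding zs_def ws_def by (rule prox_near_min)+
  have "(\<Sum>t<T. gsum N ri (\<lambda>e. co e * fst (ws t) (ci e)) i)
    \<le> real T * b i + 6 * W + 360 * W * ln N + 2 * (\<epsilon> / 4) * T"
    by (rule dual_extrapolation[where l = "\<lambda>t. fst (duals t)" and q = "\<lambda>t. snd (duals t)" and x = x
          and xz = "\<lambda>t. fst (zs t)" and yz = "\<lambda>t. snd (zs t)" and xw = "\<lambda>t. fst (ws t)" and yw = "\<lambda>t. snd (ws t)"])
       (use nm x sol i in \<open>simp_all add: duals_Suc del: duals.simps(2)\<close>)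
  also have "\<dots> \<le> real T * b i + budget + real T * \<epsilon> / 2"
    using W_ge_1 by (simp add: budget_def algebra_simps)
  also have "\<dots> \<le> real T * (b i + \<epsilon>)" using T by (simp add: algebra_simps)
  finally have le: "(\<Sum>t<T. gsum N ri (\<lambda>e. co e * fst (ws t) (ci e)) i) \<le> real T * (b i + \<epsilon>)" .
  have "0 < budget" using W_ge_1 N_pos unfolding budget_def by (intro mult_pos_pos add_pos_nonneg) auto
  then have Tp: "0 < real T" using T by (cases "T = 0") auto
  have "gsum N ri (\<lambda>e. co e * (xsum T (ci e) / real T)) i = (\<Sum>t<T. gsum N ri (\<lambda>e. co e * fst (ws t) (ci e)) i) / real T"
  proof -
    have "(\<Sum>t<T. gsum N ri (\<lambda>e. co e * fst (ws t) (ci e)) i) = gsum N ri (\<lambda>e. co e * xsum T (ci e)) i"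
      unfolding gsum_def xsum_def by (subst sum.swap) (simp add: sum_distrib_left)
    then show ?thesis by (simp add: gsum_def sum_divide_distrib)
  qed
  then show ?thesis using le Tp by (simp only: pos_divide_le_eq mult.commute)
qed

end

section \<open>Preprocessing and output\<close>

definition tripV :: "nat \<times> nat \<times> real \<Rightarrow> val" where
  "tripV = (\<lambda>(i, j, a). PairV (NatV i) (PairV (NatV j) (RealV a)))"

text \<open>Packing and covering rows become constraints of the same form, by negating the covering rows and
  numbering them after the packing rows.\<close>

definition merge :: "nat \<Rightarrow> (nat \<times> nat \<times> real) list \<Rightarrow> (nat \<times> nat \<times> real) list \<Rightarrow> (nat \<times> nat \<times> real) list" where
  "merge p es fs = es @ map (\<lambda>(i, j, a). (p + i, j, - a)) fs"

lemma entriesV_arr: "entriesV es = arr (length es) (\<lambda>e. tripV (es ! e))"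
  by (simp add: entriesV_def arr_eq_ArrV tripV_def)

definition mergeP :: prg where
  "mergeP = Tab (Op2 NAdd (Op1 Length (Var 4)) (Op1 Length (Var 5)))
    (Cond (Op2 NLess (Var 0) (Op1 Length (Var 5))) (ix (Var 5) (Var 0))
      (LetIn (ix (Var 6) (Op2 NSub (Var 0) (Op1 Length (Var 5))))
        (Op2 MkPair (Op2 NAdd (Var 4) (fstP (Var 0)))
          (Op2 MkPair (fstP (sndP (Var 0))) (Op2 RSub (rc 0) (sndP (sndP (Var 0))))))))"

lemma merge_run:
  assumes "0 < M" "length (merge p es fs) \<le> M"
  shows "ev M (mpc_input \<epsilon> n p c es fs) mergeP
    (arr (length (merge p es fs)) (\<lambda>e. tripV (merge p es fs ! e))) 50"
proof -
  let ?env = "mpc_input \<epsilon> n p c es fs"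
  have "ev M ?env mergeP (arr (length (merge p es fs)) (\<lambda>e. tripV (merge p es fs ! e))) (cst mergeP)"
    unfolding mergeP_def
  proof (rule ev_Tab_arr(2)[OF assms])
    fix e assume "e < length (merge p es fs)"
    then have "e - length es < length fs" if "\<not> e < length es" using that by (simp add: merge_def)
    then show "den (Cond (Op2 NLess (Var 0) (Op1 Length (Var 5))) (ix (Var 5) (Var 0))
      (LetIn (ix (Var 6) (Op2 NSub (Var 0) (Op1 Length (Var 5))))
        (Op2 MkPair (Op2 NAdd (Var 4) (fstP (Var 0)))
          (Op2 MkPair (fstP (sndP (Var 0))) (Op2 RSub (rc 0) (sndP (sndP (Var 0)))))))) (NatV e # ?env)
      = Some (tripV (merge p es fs ! e))"
      by (cases "e < length es")
         (simp_all add: mpc_input_def entriesV_arr merge_def nth_append tripV_def split: prod.splits)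
  qed (simp add: mpc_input_def entriesV_arr merge_def)
  then show ?thesis by (rule ev_mono) (simp_all add: mergeP_def)
qed

definition prepP :: prg where
  "prepP = LetIn (Tab (Op1 Length (Var 0)) (fstP (ix (Var 1) (Var 0))))
    (LetIn (Tab (Op1 Length (Var 0)) (fstP (sndP (ix (Var 2) (Var 0)))))
    (LetIn (LetIn (Op2 MkPair (Op2 NAdd (Var 5) (Var 6)) (Var 1)) groupP)
    (LetIn (LetIn (Op2 MkPair (Var 5) (Var 1)) groupP)
    (LetIn (LetIn (Op2 MkPair (Var 1) (Tab (Op1 Length (Var 4)) (rc 1))) groupsumP)
      (tupP [Var 4, Var 3, Tab (Op1 Length (Var 5)) (sndP (sndP (ix (Var 6) (Var 0)))), Var 2, Var 1, Var 0])))))"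

text \<open>Row keys, column keys, coefficients, the two groupings and the row sizes.\<close>

definition dataV where
  "dataV N ri ci co usR usC = tup [narr N ri, narr N ci, rarr N co, groupV N ri usR, groupV N ci usC,
     rarr N (\<lambda>e. gsum N ri (\<lambda>_. 1) (ri e))]"

lemma prep_run:
  fixes N :: nat and ri ci :: "nat \<Rightarrow> nat" and co :: "nat \<Rightarrow> real"
  assumes N: "0 < N" and L: "N < 2 ^ L" "p + c < 2 ^ L" "n < 2 ^ L"
    and ri: "\<And>e. e < N \<Longrightarrow> ri e \<le> p + c" and ci: "\<And>e. e < N \<Longrightarrow> ci e \<le> n"
  shows "\<exists>usR usC. sorts N ri usR \<and> sorts N ci usC \<and>
    ev N (arr N (\<lambda>e. tripV (ri e, ci e, co e)) # RealV \<epsilon> # NatV n # NatV p # NatV c # env) prepP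
      (dataV N ri ci co usR usC) (10000 * (L + 1)\<^sup>2)"
proof -
  note M = N order_refl[of N]
  note T = ev_Tab_arr(2)[OF M] and D = ev_den[OF M(1)]
  define E where "E = arr N (\<lambda>e. tripV (ri e, ci e, co e))"
  let ?env0 = "E # RealV \<epsilon> # NatV n # NatV p # NatV c # env"
  let ?t1 = "Tab (Op1 Length (Var 0)) (fstP (ix (Var 1) (Var 0)))"
  have 1: "ev N ?env0 ?t1 (narr N ri) (cst ?t1)"
    by (rule T) (simp_all add: E_def tripV_def)
  let ?env1 = "narr N ri # ?env0"
  let ?t2 = "Tab (Op1 Length (Var 0)) (fstP (sndP (ix (Var 2) (Var 0))))"
  have 2: "ev N ?env1 ?t2 (narr N ci) (cst ?t2)"
    by (rule T) (simp_all add: E_def tripV_def)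
  let ?env2 = "narr N ci # ?env1"
  let ?e3 = "Op2 MkPair (Op2 NAdd (Var 5) (Var 6)) (Var 1)"
  have e3: "ev N ?env2 ?e3 (PairV (NatV (p + c)) (narr N ri)) (cst ?e3)" by (rule D) simp
  obtain usR where usR: "sorts N ri usR" and
    g3: "ev N (PairV (NatV (p + c)) (narr N ri) # ?env2) groupP (groupV N ri usR) (3000 * (L + 1)\<^sup>2)"
    using group_run[of N N L "p + c" ri ?env2, OF M L(1,2) ri] by blast
  note s3 = ev_Let[OF M(1) e3 g3]
  let ?env3 = "groupV N ri usR # ?env2"
  let ?e4 = "Op2 MkPair (Var 5) (Var 1)"
  have e4: "ev N ?env3 ?e4 (PairV (NatV n) (narr N ci)) (cst ?e4)" by (rule D) simp
  obtain usC where usC: "sorts N ci usC" and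
    g4: "ev N (PairV (NatV n) (narr N ci) # ?env3) groupP (groupV N ci usC) (3000 * (L + 1)\<^sup>2)"
    using group_run[of N N L n ci ?env3, OF M L(1,3) ci] by blast
  note s4 = ev_Let[OF M(1) e4 g4]
  let ?env4 = "groupV N ci usC # ?env3"
  let ?t5 = "Tab (Op1 Length (Var 4)) (rc 1)"
  have t5: "ev N ?env4 ?t5 (rarr N (\<lambda>_. 1)) (cst ?t5)" by (rule T) (simp_all add: E_def)
  have g5: "ev N ?env4 (Var 1) (groupV N ri usR) (cst (Var 1))" by (rule D) simp
  note s5 = groupsum_call[OF M L(1) usR g5 t5]
  let ?env5 = "rarr N (\<lambda>e. gsum N ri (\<lambda>_. 1) (ri e)) # ?env4"
  let ?t6 = "Tab (Op1 Length (Var 5)) (sndP (sndP (ix (Var 6) (Var 0))))"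
  have t6: "ev N ?env5 ?t6 (rarr N co) (cst ?t6)" by (rule T) (simp_all add: E_def tripV_def)
  have v: "ev N ?env5 (Var 4) (narr N ri) (cst (Var 4))" "ev N ?env5 (Var 3) (narr N ci) (cst (Var 3))"
    "ev N ?env5 (Var 2) (groupV N ri usR) (cst (Var 2))" "ev N ?env5 (Var 1) (groupV N ci usC) (cst (Var 1))"
    "ev N ?env5 (Var 0) (rarr N (\<lambda>e. gsum N ri (\<lambda>_. 1) (ri e))) (cst (Var 0))"
    by (rule D, simp)+
  note s6 = ev_tup_Cons[OF M(1) v(1) ev_tup_Cons[OF M(1) v(2) ev_tup_Cons[OF M(1) t6 ev_tup_Cons[OF M(1) v(3)
    ev_tup_Cons[OF M(1) v(4) ev_tup_Cons[OF M(1) v(5) ev_tup_Nil[OF M(1)]]]]]], folded dataV_def]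
  note r = ev_Let[OF M(1) 1 ev_Let[OF M(1) 2 ev_Let[OF M(1) s3 ev_Let[OF M(1) s4 ev_Let[OF M(1) s5 s6]]]]]
  have "ev N ?env0 prepP (dataV N ri ci co usR usC) (10000 * (L + 1)\<^sup>2)"
    unfolding prepP_def by (rule ev_mono[OF r order_refl]) (simp add: power2_eq_square algebra_simps)
  then show ?thesis using usR usC unfolding E_def by blast
qed

text \<open>A covering row without nonzero entries does not occur in the input at all, and makes the instance
  infeasible. Such rows are detected by counting the covering rows that do occur.\<close>

definition coverP :: prg where
  "coverP = Op2 RLess (LetIn (Tab (Op1 Length (acc 0 (Var 0)))
      (Cond (Op2 NLess (ix (acc 0 (Var 1)) (Var 0)) (Var 5)) (rc 0) (Op2 RDiv (rc 1) (ix (acc 5 (Var 1)) (Var 0))))) totalP)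
    (Op1 RealOf (Var 5))"

lemma cover_run:
  assumes N: "0 < N" and L: "N < 2 ^ L"
  shows "ev N (dataV N ri ci co usR usC # E # RealV \<epsilon> # NatV n # NatV p # NatV c # env) coverP
    (NatV (if card {i \<in> ri ` {..<N}. p \<le> i} < c then 1 else 0)) (300 * (L + 1))"
proof -
  note M = N order_refl[of N]
  let ?D = "dataV N ri ci co usR usC"
  let ?env = "?D # E # RealV \<epsilon> # NatV n # NatV p # NatV c # env"
  let ?b = "Cond (Op2 NLess (ix (acc 0 (Var 1)) (Var 0)) (Var 5)) (rc 0) (Op2 RDiv (rc 1) (ix (acc 5 (Var 1)) (Var 0)))"
  let ?t = "Tab (Op1 Length (acc 0 (Var 0))) ?b"
  have 1: "ev N ?env ?t (rarr N (\<lambda>e. (if ri e < p then 0 else 1) / gsum N ri (\<lambda>_. 1) (ri e))) (cst ?t)"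
  proof (rule ev_Tab_arr(2)[OF M])
    fix e assume e: "e < N"
    then have "gsum N ri (\<lambda>_. 1) (ri e) \<noteq> 0" using gsum_one_pos[of e N ri] by simp
    then show "den ?b (NatV e # ?env) = Some (RealV ((if ri e < p then 0 else 1) / gsum N ri (\<lambda>_. 1) (ri e)))"
      using e by (simp add: dataV_def)
  qed (simp add: dataV_def)
  have "(\<Sum>i\<in>ri ` {..<N}. if i < p then 0 else 1) = real (card {i \<in> ri ` {..<N}. p \<le> i})"
    by (simp add: sum.If_cases not_less Int_def)
  then have eq: "(\<Sum>e<N. (if ri e < p then 0 else 1) / gsum N ri (\<lambda>_. 1) (ri e)) = real (card {i \<in> ri ` {..<N}. p \<le> i})"
    using sum_over_groups[of "\<lambda>i. if i < p then 0 else 1" ri N] by simp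
  note s1 = ev_Let[OF M(1) 1 total_run[OF M L N], unfolded eq]
  have 2: "ev N ?env (Op1 RealOf (Var 5)) (RealV c) (cst (Op1 RealOf (Var 5)))"
    by (rule ev_den[OF N]) simp
  have "ev N ?env coverP (NatV (if card {i \<in> ri ` {..<N}. p \<le> i} < c then 1 else 0))
     (cst ?t + 200 * (L + 1) + 1 + cst (Op1 RealOf (Var 5)) + 1)"
    unfolding coverP_def by (rule ev_Op2[OF N s1 2]) simp
  then show ?thesis by (rule ev_mono) simp_all
qed

definition countP :: prg where
  "countP = LetIn (Tab (Op1 Length (acc 5 (Var 1))) (Op1 RealOf (Op2 RLess (Var 1) (ix (acc 5 (Var 2)) (Var 0))))) totalP"

text \<open>The maximal row size by counting upwards. This takes as many rounds as the width, which is within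
  the time bound.\<close>

definition widthP :: prg where
  "widthP = LetIn (rc 0) (While (Op2 RLess (rc 0) countP) (Op2 RAdd (Var 0) (rc 1)))"

lemma width_run:
  assumes N: "0 < N" and L: "N < 2 ^ L"
    and w: "\<And>e. e < N \<Longrightarrow> gsum N ri (\<lambda>_. 1) (ri e) \<le> real w"
  obtains T where "T \<le> w" "\<And>e. e < N \<Longrightarrow> gsum N ri (\<lambda>_. 1) (ri e) \<le> real T"
    "ev N (dataV N ri ci co usR usC # env) widthP (RealV (real T)) (400 * (w + 1) * (L + 1))"
proof -
  note M = N order_refl[of N]
  define D where "D = dataV N ri ci co usR usC"
  define v where "v e = gsum N ri (\<lambda>_. 1) (ri e)" for e
  define flag where "flag t e = (if real t < v e then 1 else 0 :: real)" for t e
  let ?env = "D # env"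
  let ?b = "Op2 RLess (rc 0) countP"
  let ?e = "Op2 RAdd (Var 0) (rc 1)"
  let ?t = "Tab (Op1 Length (acc 5 (Var 1))) (Op1 RealOf (Op2 RLess (Var 1) (ix (acc 5 (Var 2)) (Var 0))))"
  obtain T where T: "T \<le> w" "\<not> (\<exists>e<N. real T < v e)" and
    run: "ev N (RealV (real 0) # ?env) (While ?b ?e) (RealV (real T)) (Suc w * (cst (rc 0) + (cst ?t + 200 * (L + 1) + 1) + 1 + cst ?e + 1))"
  proof (rule ev_While[where c = "\<lambda>t. \<exists>e<N. real t < v e" and s = "\<lambda>t. RealV (real t)" and b = ?b and e = ?e and env = ?env
      and M = N and L = w and ?X1.0 = "cst (rc 0) + (cst ?t + 200 * (L + 1) + 1) + 1" and ?X2.0 = "cst ?e"])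
    show "0 < N" by fact
    show "ev N (RealV (real t) # ?env) ?b (NatV (if \<exists>e<N. real t < v e then 1 else 0))
       (cst (rc 0) + (cst ?t + 200 * (L + 1) + 1) + 1)" for t
    proof -
      have 1: "ev N (RealV (real t) # ?env) ?t (rarr N (flag t)) (cst ?t)"
        by (rule ev_Tab_arr(2)[OF M]) (simp_all add: D_def dataV_def flag_def v_def)
      have 2: "ev N (RealV (real t) # ?env) (rc 0) (RealV 0) (cst (rc 0))" by (rule ev_den[OF N]) simp
      have "0 < (\<Sum>e<N. flag t e) \<longleftrightarrow> (\<exists>e<N. real t < v e)"
      proof
        assume "0 < (\<Sum>e<N. flag t e)"
        then obtain e where "e < N" "flag t e \<noteq> 0" by (metis lessThan_iff less_irrefl sum.neutral)
        then show "\<exists>e<N. real t < v e" by (auto simp: flag_def split: if_splits)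
      next
        assume "\<exists>e<N. real t < v e"
        then obtain e where "e < N" "real t < v e" by blast
        then show "0 < (\<Sum>e<N. flag t e)" by (intro sum_pos2[of _ e]) (auto simp: flag_def)
      qed
      then show ?thesis unfolding countP_def
        by (intro ev_Op2[OF N 2 ev_Let[OF N 1 total_run[OF M L N]]]) simp
    qed
    show "ev N (RealV (real t) # ?env) ?e (RealV (real (Suc t))) (cst ?e)" for t
      by (rule ev_den[OF N]) (simp add: add.commute)
    show "\<not> (\<exists>e<N. real w < v e)" using w unfolding v_def by (meson not_less)
  qed (use that in blast)
  have r0: "ev N ?env (rc 0) (RealV (real 0)) (cst (rc 0))" by (rule ev_den[OF N]) simp
  have "ev N ?env widthP (RealV (real T)) (400 * (w + 1) * (L + 1))"
    unfolding widthP_def by (rule ev_mono[OF ev_Let[OF N r0 run] order_refl]) (simp add: algebra_simps)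
  moreover have "gsum N ri (\<lambda>_. 1) (ri e) \<le> real T" if "e < N" for e
    using T(2) that unfolding v_def by (meson not_less)
  ultimately show ?thesis using T(1) unfolding D_def by (intro that)
qed

definition setupP :: prg where
  "setupP = tupP [Var 3, Var 0,
    Op2 RMul (Op2 RMul (rc 360) (Var 0)) (Op2 RAdd (rc 1) (Op1 Ln (Op1 RealOf (Op1 Length (acc 0 (Var 1)))))),
    acc 2 (Var 1),
    Tab (Op1 Length (acc 0 (Var 1))) (LetIn (ix (acc 2 (Var 2)) (Var 0)) (Cond (Op2 RLess (Var 0) (rc 0)) (Op2 RSub (rc 0) (Var 0)) (Var 0))),
    acc 5 (Var 1), acc 3 (Var 1), acc 4 (Var 1),
    Tab (Op1 Length (acc 0 (Var 1))) (Op2 RDiv (ix (acc 5 (Var 2)) (Var 0)) (Op1 RealOf (Op1 Length (acc 0 (Var 2))))),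
    Tab (Op1 Length (acc 0 (Var 1))) (Cond (Op2 NLess (ix (acc 0 (Var 2)) (Var 0)) (Var 6)) (rc 1) (Op2 RSub (rc 0) (rc 1)))]"

text \<open>Selects one representative per column: the first entry of its segment in sorted order. The value
  is \<open>1\<close> minus the absolute difference of two positions, truncated at \<open>0\<close>.\<close>

definition firstP :: prg where
  "firstP = LetIn (ix (fstP (acc 4 (Var 6))) (fstP (ix (sndP (acc 4 (Var 6))) (Var 0))))
     (Op2 NSub (NConst 1) (Op2 NAdd (Op2 NSub (Var 0) (Var 1)) (Op2 NSub (Var 1) (Var 0))))"

text \<open>Averages the iterates, and checks whether some row is violated by more than \<open>\<epsilon>\<close>. By the regret bound this
  happens only for infeasible instances, so the check decides which answer is correct.\<close>

definition finishP :: prg where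
  "finishP = LetIn (Tab (Op1 Length (acc 3 (Var 0))) (Op2 RDiv (ix (acc 3 (Var 1)) (Var 0)) (acc 0 (Var 1))))
    (LetIn (LetIn (Op2 MkPair (acc 3 (Var 4)) (Tab (Op1 Length (Var 0)) (Op2 RMul (ix (acc 2 (Var 5)) (Var 0)) (ix (Var 1) (Var 0))))) groupsumP)
    (Cond (Op2 RLess (rc 0) (LetIn (Tab (Op1 Length (Var 0))
          (Op1 RealOf (Op2 RLess (acc 0 (Var 4)) (Op2 RSub (ix (Var 1) (Var 0)) (ix (acc 9 (Var 4)) (Var 0)))))) totalP))
      (NConst 0)
      (LetIn (Op2 MkPair (Tab (Op1 Length (Var 0)) (Op2 MkPair (ix (acc 1 (Var 6)) (Var 0)) (ix (Var 2) (Var 0))))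
               (Tab (Op1 Length (Var 0)) firstP)) packP)))"

definition mainP :: prg where
  "mainP = LetIn mergeP (Cond (Op1 Length (Var 0))
    (LetIn prepP (Cond coverP (NConst 0) (LetIn widthP (LetIn setupP (LetIn loopP finishP)))))
    (Cond (Var 4) (NConst 0) (Tab (NConst 0) (NConst 0))))"

context solver
begin

abbreviation "DV \<equiv> dataV N ri ci co usR usC"

lemma setup_run:
  assumes b: "b = (\<lambda>i. if i < p then 1 else - 1)"
  shows "ev N (RealV W # DV # E # RealV \<epsilon> # NatV n # NatV p # env) setupP paramsV 500"
proof -
  note M = N_le and T = ev_Tab_arr(2)[OF N_le] and D = ev_den[OF N_le(1)]
  let ?env = "RealV W # DV # E # RealV \<epsilon> # NatV n # NatV p # env"
  let ?eB = "Op2 RMul (Op2 RMul (rc 360) (Var 0)) (Op2 RAdd (rc 1) (Op1 Ln (Op1 RealOf (Op1 Length (acc 0 (Var 1))))))"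
  have v: "ev N ?env (Var 3) (RealV \<epsilon>) (cst (Var 3))" "ev N ?env (Var 0) (RealV W) (cst (Var 0))"
    "ev N ?env ?eB (RealV budget) (cst ?eB)"
    "ev N ?env (acc 2 (Var 1)) (rarr N co) (cst (acc 2 (Var 1)))"
    "ev N ?env (acc 5 (Var 1)) (rarr N cnt) (cst (acc 5 (Var 1)))"
    "ev N ?env (acc 3 (Var 1)) (groupV N ri usR) (cst (acc 3 (Var 1)))"
    "ev N ?env (acc 4 (Var 1)) (groupV N ci usC) (cst (acc 4 (Var 1)))"
    by (rule D, use N_pos in \<open>simp add: dataV_def budget_def cnt_def\<close>)+
  let ?t1 = "Tab (Op1 Length (acc 0 (Var 1))) (LetIn (ix (acc 2 (Var 2)) (Var 0)) (Cond (Op2 RLess (Var 0) (rc 0)) (Op2 RSub (rc 0) (Var 0)) (Var 0)))"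
  have t1: "ev N ?env ?t1 (rarr N (\<lambda>e. \<bar>co e\<bar>)) (cst ?t1)" by (rule T) (simp_all add: dataV_def abs_if)
  let ?t2 = "Tab (Op1 Length (acc 0 (Var 1))) (Op2 RDiv (ix (acc 5 (Var 2)) (Var 0)) (Op1 RealOf (Op1 Length (acc 0 (Var 2)))))"
  have t2: "ev N ?env ?t2 (rowA y0) (cst ?t2)"
    by (rule T) (use N_pos in \<open>simp_all add: dataV_def y0_def gsum_def\<close>)
  let ?t3 = "Tab (Op1 Length (acc 0 (Var 1))) (Cond (Op2 NLess (ix (acc 0 (Var 2)) (Var 0)) (Var 6)) (rc 1) (Op2 RSub (rc 0) (rc 1)))"
  have t3: "ev N ?env ?t3 (rowA b) (cst ?t3)" by (rule T) (simp_all add: dataV_def b)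
  note r = ev_tup_Cons[OF M(1) v(1) ev_tup_Cons[OF M(1) v(2) ev_tup_Cons[OF M(1) v(3) ev_tup_Cons[OF M(1) v(4)
    ev_tup_Cons[OF M(1) t1 ev_tup_Cons[OF M(1) v(5) ev_tup_Cons[OF M(1) v(6) ev_tup_Cons[OF M(1) v(7)
    ev_tup_Cons[OF M(1) t2 ev_tup_Cons[OF M(1) t3 ev_tup_Nil[OF M(1)]]]]]]]]]], folded paramsV_def]
  show ?thesis unfolding setupP_def by (rule ev_mono[OF r order_refl]) simp
qed

definition first_in_col :: "nat \<Rightarrow> bool" where
  "first_in_col e \<longleftrightarrow> usC ! below N ci usC (ci e) = e"

lemma below_less: "e < N \<Longrightarrow> below N ci usC (ci e) < N \<and> ci (usC ! below N ci usC (ci e)) = ci e"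
proof -
  assume e: "e < N"
  let ?t = "below N ci usC (ci e)"
  have "e \<in> set usC" using e usC by (simp add: sorts_def)
  then obtain s where s: "s < N" "usC ! s = e" using sorts_length[OF usC] by (auto simp: in_set_conv_nth)
  have "?t \<le> s" using less_below_iff[OF usC s(1), of "ci e"] s by simp
  then have t: "?t < N" using s by simp
  have "\<not> ci (usC ! ?t) < ci e" using less_below_iff[OF usC t, of "ci e"] by simp
  moreover have "ci (usC ! ?t) \<le> ci e" using sorts_mono[OF usC \<open>?t \<le> s\<close> s(1)] s by simp
  ultimately show ?thesis using t by simp
qed

definition xbar :: "nat \<Rightarrow> nat \<Rightarrow> real" where "xbar T j = xsum T j / real T"

definition bad :: "nat \<Rightarrow> bool" where
  "bad T \<longleftrightarrow> (\<exists>e<N. \<epsilon> < gsum N ri (\<lambda>e. co e * xbar T (ci e)) (ri e) - b (ri e))"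

definition resultV :: "nat \<Rightarrow> val" where
  "resultV T = (if bad T then NatV 0
     else ArrV (map (\<lambda>e. PairV (NatV (ci e)) (RealV (xbar T (ci e)))) (filter first_in_col [0..<N])))"

lemma finish_run:
  assumes T: "0 < T"
  shows "ev N (stV T # paramsV # RealV W # DV # env) finishP (resultV T) (2000 * (L + 1))"
proof -
  note M = N_le and Tb = ev_Tab_arr(2)[OF N_le] and D = ev_den[OF N_le(1)]
  let ?env0 = "stV T # paramsV # RealV W # DV # env"
  let ?t1 = "Tab (Op1 Length (acc 3 (Var 0))) (Op2 RDiv (ix (acc 3 (Var 1)) (Var 0)) (acc 0 (Var 1)))"
  have 1: "ev N ?env0 ?t1 (colA (xbar T)) (cst ?t1)"
    by (rule Tb) (use T in \<open>simp_all add: stV_def xbar_def\<close>)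
  let ?env1 = "colA (xbar T) # ?env0"
  define ax where "ax i = gsum N ri (\<lambda>e. co e * xbar T (ci e)) i" for i
  let ?t2 = "Tab (Op1 Length (Var 0)) (Op2 RMul (ix (acc 2 (Var 5)) (Var 0)) (ix (Var 1) (Var 0)))"
  have t2: "ev N ?env1 ?t2 (rarr N (\<lambda>e. co e * xbar T (ci e))) (cst ?t2)"
    by (rule Tb) (simp_all add: dataV_def)
  have g2: "ev N ?env1 (acc 3 (Var 4)) (groupV N ri usR) (cst (acc 3 (Var 4)))"
    by (rule D) (simp add: dataV_def)
  note s2 = groupsum_call[OF M L usR g2 t2, folded ax_def]
  let ?env2 = "rowA ax # ?env1"
  define flag where "flag e = (if \<epsilon> < ax (ri e) - b (ri e) then 1 else 0 :: real)" for e
  let ?t3 = "Tab (Op1 Length (Var 0))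
          (Op1 RealOf (Op2 RLess (acc 0 (Var 4)) (Op2 RSub (ix (Var 1) (Var 0)) (ix (acc 9 (Var 4)) (Var 0)))))"
  have t3: "ev N ?env2 ?t3 (rarr N flag) (cst ?t3)"
    by (rule Tb) (simp_all add: paramsV_def flag_def)
  have "0 < (\<Sum>e<N. flag e) \<longleftrightarrow> bad T"
  proof
    assume "0 < (\<Sum>e<N. flag e)"
    then obtain e where "e < N" "flag e \<noteq> 0" by (metis lessThan_iff less_irrefl sum.neutral)
    then show "bad T" by (auto simp: flag_def bad_def ax_def split: if_splits)
  next
    assume "bad T"
    then obtain e where "e < N" "\<epsilon> < ax (ri e) - b (ri e)" by (auto simp: bad_def ax_def)
    then show "0 < (\<Sum>e<N. flag e)" by (intro sum_pos2[of _ e]) (auto simp: flag_def)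
  qed
  then have eq: "app2 RLess (RealV 0) (RealV (\<Sum>e<N. flag e)) = Some (NatV (if bad T then 1 else 0))" by simp
  have r0: "ev N ?env2 (rc 0) (RealV 0) (cst (rc 0))" by (rule D) simp
  note s3 = ev_Op2[OF M(1) r0 ev_Let[OF M(1) t3 total_run[OF M L M(1)]] eq]
  let ?t4 = "Tab (Op1 Length (Var 0)) (Op2 MkPair (ix (acc 1 (Var 6)) (Var 0)) (ix (Var 2) (Var 0)))"
  let ?f = "\<lambda>e. PairV (NatV (ci e)) (RealV (xbar T (ci e)))"
  have t4: "ev N ?env2 ?t4 (arr N ?f) (cst ?t4)"
    by (rule Tb) (simp_all add: dataV_def)
  let ?t5 = "Tab (Op1 Length (Var 0)) firstP"
  have t5: "ev N ?env2 ?t5 (narr N (\<lambda>e. if first_in_col e then 1 else 0)) (cst ?t5)"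
  proof (rule Tb)
    fix e assume e: "e < N"
    then show "den firstP (NatV e # ?env2) = Some (NatV (if first_in_col e then 1 else 0))"
      using below_less[OF e] by (auto simp: dataV_def groupV_def firstP_def first_in_col_def)
  qed simp
  note s4 = ev_Let[OF M(1) ev_Pair[OF M(1) t4 t5] pack_run[OF M L]]
  have s0: "ev N ?env2 (NConst 0) (NatV 0) 1" using D[of "NConst 0" ?env2] by simp
  let ?p4 = "LetIn (Op2 MkPair ?t4 ?t5) packP"
  let ?X = "cst ?t4 + cst ?t5 + 1 + 300 * (L + 1) + 1"
  have s5: "ev N ?env2 (if (if bad T then 1 else 0 :: nat) \<noteq> 0 then NConst 0 else ?p4) (resultV T) ?X"
  proof (cases "bad T")
    case True
    then show ?thesis using ev_mono[OF s0 order_refl, of ?X] by (simp add: resultV_def)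
  next
    case False
    then show ?thesis using s4 by (simp only: resultV_def if_False) simp
  qed
  note r = ev_Let[OF M(1) 1 ev_Let[OF M(1) s2 ev_Cond[OF M(1) s3 s5]]]
  show ?thesis unfolding finishP_def by (rule ev_mono[OF r order_refl]) (simp add: firstP_def)
qed

end

section \<open>Correctness for sparse matrices\<close>

lemma gsum_outside: "k \<notin> key ` {..<N} \<Longrightarrow> gsum N key v k = 0"
proof -
  assume "k \<notin> key ` {..<N}"
  then have "{e. e < N \<and> key e = k} = {}" by auto
  then show ?thesis unfolding gsum_def by (simp only: sum.empty)
qed

lemma entry_nth:
  assumes A: "A \<in> carrier_mat r n" and es: "lists_entries A es" and e: "e < length es"
  shows "fst (es ! e) < r" "fst (snd (es ! e)) < n" "snd (snd (es ! e)) = A $$ (fst (es ! e), fst (snd (es ! e)))"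
    "A $$ (fst (es ! e), fst (snd (es ! e))) \<noteq> 0"
proof -
  have "es ! e \<in> {(i, j, A $$ (i, j)) | i j. i < r \<and> j < n \<and> A $$ (i, j) \<noteq> 0}"
    using es A nth_mem[OF e] unfolding lists_entries_def by auto
  then show "fst (es ! e) < r" "fst (snd (es ! e)) < n" "snd (snd (es ! e)) = A $$ (fst (es ! e), fst (snd (es ! e)))"
    "A $$ (fst (es ! e), fst (snd (es ! e))) \<noteq> 0" by auto
qed

text \<open>The nonzero positions of a row correspond to the listed entries of that row, as the list contains
  each position once.\<close>

lemma entries_bij:
  assumes A: "A \<in> carrier_mat r n" and es: "lists_entries A es" and i: "i < r"
  shows "bij_betw (\<lambda>e. fst (snd (es ! e))) {e. e < length es \<and> fst (es ! e) = i} {j. j < n \<and> A $$ (i, j) \<noteq> 0}"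
proof (rule bij_betw_imageI)
  show "inj_on (\<lambda>e. fst (snd (es ! e))) {e. e < length es \<and> fst (es ! e) = i}"
  proof (rule inj_onI)
    fix e e' assume e: "e \<in> {e. e < length es \<and> fst (es ! e) = i}" and e': "e' \<in> {e. e < length es \<and> fst (es ! e) = i}"
      and eq: "fst (snd (es ! e)) = fst (snd (es ! e'))"
    then have "es ! e = es ! e'"
      using entry_nth(3)[OF A es, of e] entry_nth(3)[OF A es, of e'] by (simp add: prod_eq_iff)
    then show "e = e'" using e e' es by (simp add: lists_entries_def nth_eq_iff_index_eq)
  qed
  show "(\<lambda>e. fst (snd (es ! e))) ` {e. e < length es \<and> fst (es ! e) = i} = {j. j < n \<and> A $$ (i, j) \<noteq> 0}"
  proof (intro equalityI subsetI)
    fix j assume "j \<in> (\<lambda>e. fst (snd (es ! e))) ` {e. e < length es \<and> fst (es ! e) = i}"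
    then obtain e where "e < length es" "fst (es ! e) = i" "j = fst (snd (es ! e))" by blast
    then show "j \<in> {j. j < n \<and> A $$ (i, j) \<noteq> 0}" using entry_nth[OF A es, of e] by auto
  next
    fix j assume "j \<in> {j. j < n \<and> A $$ (i, j) \<noteq> 0}"
    then have "(i, j, A $$ (i, j)) \<in> set es" using es A i by (auto simp: lists_entries_def)
    then obtain e where "e < length es" "es ! e = (i, j, A $$ (i, j))" by (auto simp: in_set_conv_nth)
    then show "j \<in> (\<lambda>e. fst (snd (es ! e))) ` {e. e < length es \<and> fst (es ! e) = i}"
      by (intro image_eqI[of _ _ e]) auto
  qed
qed

lemma entries_row_card:
  assumes "A \<in> carrier_mat r n" "lists_entries A es" "i < r"
  shows "card {e. e < length es \<and> fst (es ! e) = i} \<le> mat_width A"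
proof -
  have "card {e. e < length es \<and> fst (es ! e) = i} = row_nnz A i"
    using bij_betw_same_card[OF entries_bij[OF assms]] assms(1) by (simp add: row_nnz_def)
  also have "\<dots> \<le> mat_width A" unfolding mat_width_def using assms by (intro Max_ge) auto
  finally show ?thesis .
qed

lemma entries_row_sum:
  assumes A: "A \<in> carrier_mat r n" and es: "lists_entries A es" and i: "i < r"
  shows "(\<Sum>e | e < length es \<and> fst (es ! e) = i. snd (snd (es ! e)) * x (fst (snd (es ! e))))
    = (A *\<^sub>v vec n x) $ i"
proof -
  have "(\<Sum>e | e < length es \<and> fst (es ! e) = i. snd (snd (es ! e)) * x (fst (snd (es ! e))))
      = (\<Sum>e | e < length es \<and> fst (es ! e) = i. A $$ (i, fst (snd (es ! e))) * x (fst (snd (es ! e))))"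
    by (intro sum.cong refl) (use entry_nth(3)[OF A es] in auto)
  also have "\<dots> = (\<Sum>j | j < n \<and> A $$ (i, j) \<noteq> 0. A $$ (i, j) * x j)"
    by (rule sum.reindex_bij_betw[OF entries_bij[OF A es i]])
  also have "\<dots> = (\<Sum>j\<in>{0..<n}. A $$ (i, j) * x j)"
    by (rule sum.mono_neutral_left) auto
  also have "\<dots> = (A *\<^sub>v vec n x) $ i"
    using A i by (simp add: scalar_prod_def)
  finally show ?thesis .
qed

lemma entries_length:
  assumes A: "A \<in> carrier_mat r n" and es: "lists_entries A es"
  shows "length es = mat_nnz A"
proof -
  have "inj_on (\<lambda>(i, j). (i, j, A $$ (i, j))) {(i, j). i < r \<and> j < n \<and> A $$ (i, j) \<noteq> 0}"
    by (auto simp: inj_on_def)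
  moreover have "set es = (\<lambda>(i, j). (i, j, A $$ (i, j))) ` {(i, j). i < r \<and> j < n \<and> A $$ (i, j) \<noteq> 0}"
    using es A by (auto simp: lists_entries_def)
  ultimately have "card (set es) = mat_nnz A" using A by (simp add: card_image mat_nnz_def)
  moreover have "distinct es" using es by (simp add: lists_entries_def)
  ultimately show ?thesis using distinct_card[of es] by simp
qed

text \<open>An instance together with its sparse representation, seen as one list of constraint entries.\<close>

locale sparse_instance =
  fixes n p c :: nat and P C :: "real mat" and es fs :: "(nat \<times> nat \<times> real) list"
  assumes inst: "mpc_instance n p c P C" and es: "lists_entries P es" and fs: "lists_entries C fs"
begin

lemma P: "P \<in> carrier_mat p n" and C: "C \<in> carrier_mat c n"
  using inst by (auto simp: mpc_instance_def)

definition "N = length (merge p es fs)"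
definition "ri e = fst (merge p es fs ! e)"
definition "ci e = fst (snd (merge p es fs ! e))"
definition "co e = snd (snd (merge p es fs ! e))"
definition b :: "nat \<Rightarrow> real" where "b = (\<lambda>i. if i < p then 1 else - 1)"

lemma N_nnz: "N = nnz P C"
  using entries_length[OF P es] entries_length[OF C fs] by (simp add: N_def merge_def nnz_def)

lemma N_len: "N = length es + length fs" by (simp add: N_def merge_def)

lemma left: "e < length es \<Longrightarrow> ri e = fst (es ! e) \<and> ci e = fst (snd (es ! e)) \<and> co e = snd (snd (es ! e))"
  by (simp add: ri_def ci_def co_def merge_def nth_append)

lemma right: "e < length fs \<Longrightarrow> ri (length es + e) = p + fst (fs ! e) \<and> ci (length es + e) = fst (snd (fs ! e))
    \<and> co (length es + e) = - snd (snd (fs ! e))"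
  by (simp add: ri_def ci_def co_def merge_def nth_append split: prod.splits)

lemma entry_cases:
  assumes "e < N"
  obtains "e < length es" | e' where "e = length es + e'" "e' < length fs"
  using assms by (cases "e < length es") (auto simp: N_len not_less le_iff_add)

lemma entry_props:
  assumes e: "e < N"
  shows "ri e < p + c" "ci e < n" "co e \<noteq> 0" "\<bar>co e\<bar> \<le> 1"
proof -
  have "ri e < p + c \<and> ci e < n \<and> co e \<noteq> 0 \<and> \<bar>co e\<bar> \<le> 1"
    using e
  proof (cases rule: entry_cases)
    case 1
    show ?thesis using left[OF 1] entry_nth[OF P es 1] inst by (auto simp: mpc_instance_def)
  next
    case (2 e')
    show ?thesis using right[OF 2(2)] entry_nth[OF C fs 2(2)] inst unfolding 2(1) by (auto simp: mpc_instance_def)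
  qed
  then show "ri e < p + c" "ci e < n" "co e \<noteq> 0" "\<bar>co e\<bar> \<le> 1" by auto
qed

lemma rows_P: "i < p \<Longrightarrow> {e. e < N \<and> ri e = i} = {e. e < length es \<and> fst (es ! e) = i}"
proof -
  assume i: "i < p"
  have l: "e < length es" if "e < N" "ri e = i" for e
    using that(1)
  proof (cases rule: entry_cases)
    case (2 e')
    then show ?thesis using right[OF 2(2)] that i by simp
  qed
  show ?thesis
  proof (rule Set.set_eqI)
    fix e
    show "e \<in> {e. e < N \<and> ri e = i} \<longleftrightarrow> e \<in> {e. e < length es \<and> fst (es ! e) = i}"
      using l[of e] left[of e] by (cases "e < length es") (auto simp: N_len)
  qed
qed

lemma rows_C: "{e. e < N \<and> ri e = p + i} = (\<lambda>e. length es + e) ` {e. e < length fs \<and> fst (fs ! e) = i}"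
proof -
  have l: "e \<in> (\<lambda>e. length es + e) ` {e. e < length fs \<and> fst (fs ! e) = i}" if "e < N" "ri e = p + i" for e
    using that(1)
  proof (cases rule: entry_cases)
    case 1
    then show ?thesis using left[OF 1] entry_nth(1)[OF P es 1] that by simp
  next
    case (2 e')
    then show ?thesis using right[OF 2(2)] that by auto
  qed
  show ?thesis
  proof (intro equalityI subsetI)
    fix e assume "e \<in> (\<lambda>e. length es + e) ` {e. e < length fs \<and> fst (fs ! e) = i}"
    then obtain e' where "e = length es + e'" "e' < length fs" "fst (fs ! e') = i" by blast
    then show "e \<in> {e. e < N \<and> ri e = p + i}" using right[of e'] by (simp add: N_len)
  qed (use l in simp)
qed

lemma row_card_width: "card {e. e < N \<and> ri e = i} \<le> width P C"
proof (cases "i < p")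
  case True
  then show ?thesis unfolding rows_P[OF True] using entries_row_card[OF P es True] by (simp add: width_def)
next
  case False
  define i' where "i' = i - p"
  have i: "i = p + i'" using False by (simp add: i'_def)
  show ?thesis
  proof (cases "i' < c")
    case True
    have "card {e. e < N \<and> ri e = i} = card {e. e < length fs \<and> fst (fs ! e) = i'}"
      unfolding i rows_C by (rule card_image) (auto simp: inj_on_def)
    then show ?thesis using entries_row_card[OF C fs True] by (simp add: width_def)
  next
    case False
    then have "{e. e < N \<and> ri e = i} = {}" using entry_props(1) by (fastforce simp: i)
    then show ?thesis by (simp only: card.empty le0)
  qed
qed

lemma row_sum_P: "i < p \<Longrightarrow> gsum N ri (\<lambda>e. co e * x (ci e)) i = (P *\<^sub>v vec n x) $ i"
proof -
  assume i: "i < p"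
  show ?thesis unfolding gsum_def rows_P[OF i] entries_row_sum[OF P es i, symmetric]
    by (intro sum.cong refl) (use left in auto)
qed

lemma row_sum_C: "i < c \<Longrightarrow> gsum N ri (\<lambda>e. co e * x (ci e)) (p + i) = - (C *\<^sub>v vec n x) $ i"
proof -
  assume i: "i < c"
  have "gsum N ri (\<lambda>e. co e * x (ci e)) (p + i)
    = (\<Sum>e | e < length fs \<and> fst (fs ! e) = i. - (snd (snd (fs ! e)) * x (fst (snd (fs ! e)))))"
    unfolding gsum_def rows_C by (subst sum.reindex) (use right in \<open>auto simp: inj_on_def intro!: sum.cong\<close>)
  then show ?thesis using entries_row_sum[OF C fs i] by (simp add: sum_negf)
qed

lemma solution_bounds:
  assumes x: "mpc_solution n p c P C x"
  defines "xf \<equiv> (\<lambda>j. if j < n then x $ j else 0)"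
  shows "0 \<le> xf j \<and> xf j \<le> 1"
    and "i < p + c \<Longrightarrow> gsum N ri (\<lambda>e. co e * xf (ci e)) i \<le> b i"
proof -
  have xv: "x \<in> carrier_vec n" and box: "0\<^sub>v n \<le> x" "\<And>j. j < n \<Longrightarrow> \<bar>x $ j\<bar> \<le> 1"
    and Px: "P *\<^sub>v x \<le> ones p" and Cx: "ones c \<le> C *\<^sub>v x"
    using x by (auto simp: mpc_solution_def)
  have xeq: "vec n xf = x" using xv by (auto simp: xf_def)
  show "0 \<le> xf j \<and> xf j \<le> 1" using box xv unfolding xf_def by (force simp: less_eq_vec_def abs_le_iff)
  assume i: "i < p + c"
  show "gsum N ri (\<lambda>e. co e * xf (ci e)) i \<le> b i"
  proof (cases "i < p")
    case True
    then show ?thesis using Px P unfolding row_sum_P[OF True] xeq b_def by (auto simp: less_eq_vec_def)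
  next
    case False
    define i' where "i' = i - p"
    have i': "i = p + i'" "i' < c" using False i by (auto simp: i'_def)
    then show ?thesis using Cx C unfolding i'(1) row_sum_C[OF i'(2)] xeq b_def by (auto simp: less_eq_vec_def)
  qed
qed

text \<open>Fewer than \<open>c\<close> covering rows occur, so one of them is missing; its product with any vector is \<open>0\<close>.\<close>

lemma uncovered_infeasible:
  assumes "card {i \<in> ri ` {..<N}. p \<le> i} < c"
  shows "\<not> mpc_solution n p c P C x"
proof
  assume x: "mpc_solution n p c P C x"
  have "\<not> (\<lambda>i. p + i) ` {..<c} \<subseteq> {i \<in> ri ` {..<N}. p \<le> i}"
  proof
    assume "(\<lambda>i. p + i) ` {..<c} \<subseteq> {i \<in> ri ` {..<N}. p \<le> i}"
    then have "card ((\<lambda>i. p + i) ` {..<c}) \<le> card {i \<in> ri ` {..<N}. p \<le> i}" by (intro card_mono) auto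
    then show False using assms by (simp add: card_image)
  qed
  then obtain i where i: "i < c" "p + i \<notin> ri ` {..<N}" by auto
  then show False using solution_bounds(2)[OF x, of "p + i"] by (simp add: b_def gsum_outside)
qed

lemma covered:
  assumes "\<not> card {i \<in> ri ` {..<N}. p \<le> i} < c" "i < c"
  shows "p + i \<in> ri ` {..<N}"
proof -
  have sub: "{i \<in> ri ` {..<N}. p \<le> i} \<subseteq> {p..<p + c}" using entry_props(1) by auto
  have "{i \<in> ri ` {..<N}. p \<le> i} = {p..<p + c}"
    by (rule card_seteq[OF _ sub]) (use assms in auto)
  then show ?thesis using assms(2) by auto
qed

lemma approx_solutionI:
  assumes box: "\<And>j. 0 \<le> x j \<and> x j \<le> 1"
    and rows: "\<And>i. i < p + c \<Longrightarrow> gsum N ri (\<lambda>e. co e * x (ci e)) i \<le> b i + \<epsilon>"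
  shows "mpc_approx_solution \<epsilon> n p c P C (vec n x)"
proof -
  have "(P *\<^sub>v vec n x) $ i \<le> 1 + \<epsilon>" if "i < p" for i
    using rows[of i] that by (simp add: row_sum_P b_def)
  moreover have "1 - \<epsilon> \<le> (C *\<^sub>v vec n x) $ i" if "i < c" for i
    using rows[of "p + i"] that by (simp add: row_sum_C b_def)
  ultimately show ?thesis
    using box P C by (auto simp: mpc_approx_solution_def less_eq_vec_def abs_le_iff intro: order_trans[of _ 0])
qed

end

lemma map_of_graph: "map_of (map (\<lambda>e. (f e, g (f e))) xs) j = (if j \<in> f ` set xs then Some (g j) else None)"
  by (induction xs) auto

locale instance_solver = sparse_instance n p c P C es fs + solver N ri ci co b W \<epsilon> usR usC L Li Lm
  for n p c P C es fs W \<epsilon> usR usC L Li Lm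
begin

text \<open>If the check fails, a feasible point would contradict the regret bound. If it succeeds, the rows
  that occur are fine by the check, and those that do not occur are packing rows, as all covering rows
  occur.\<close>

lemma result_correct:
  assumes T: "2 * budget \<le> real T * \<epsilon>" "0 < T"
    and cover: "\<not> card {i \<in> ri ` {..<N}. p \<le> i} < c"
  shows "mpc_correct_output \<epsilon> n p c P C (resultV T)"
proof (cases "bad T")
  case True
  have "\<not> mpc_solution n p c P C x" for x
  proof
    assume x: "mpc_solution n p c P C x"
    obtain e where e: "e < N" "\<epsilon> < gsum N ri (\<lambda>e. co e * xbar T (ci e)) (ri e) - b (ri e)"
      using True by (auto simp: bad_def)
    have "gsum N ri (\<lambda>e. co e * (xsum T (ci e) / real T)) (ri e) \<le> b (ri e) + \<epsilon>"
      by (rule average_solves[OF T(1) solution_bounds(1)[OF x] solution_bounds(2)[OF x]])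
         (use entry_props(1) e in \<open>auto simp: R_def\<close>)
    then show False using e by (simp add: xbar_def)
  qed
  then show ?thesis using True by (auto simp: mpc_correct_output_def outputs_infeasible_def resultV_def)
next
  case False
  define F where "F = filter first_in_col [0..<N]"
  define js where "js = map (\<lambda>e. (ci e, xbar T (ci e))) F"
  define xo where "xo j = (if j \<in> ci ` {..<N} then xbar T j else 0)" for j
  have "ci ` set F = ci ` {..<N}"
  proof
    show "ci ` {..<N} \<subseteq> ci ` set F"
    proof
      fix j assume "j \<in> ci ` {..<N}"
      then obtain e where e: "e < N" "j = ci e" by auto
      define f where "f = usC ! below N ci usC (ci e)"
      have f: "ci f = ci e" "f < N" using below_less[OF e(1)] sorts_nth_less[OF usC] by (auto simp: f_def)
      then have "f \<in> set F" by (simp add: F_def first_in_col_def) (simp add: f_def)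
      then show "j \<in> ci ` set F" using f e by (metis imageI)
    qed
  qed (auto simp: F_def)
  then have "map_of js j = (if j \<in> ci ` {..<N} then Some (xbar T j) else None)" for j
    unfolding js_def map_of_graph by simp
  then have "(case map_of js j of None \<Rightarrow> 0 | Some r \<Rightarrow> r) = xo j" for j
    by (simp add: xo_def)
  then have x: "vec n (\<lambda>j. case map_of js j of None \<Rightarrow> 0 | Some r \<Rightarrow> r) = vec n xo" by presburger
  have "inj_on ci (set F)"
  proof (rule inj_onI)
    fix e f assume "e \<in> set F" "f \<in> set F" "ci e = ci f"
    then show "e = f" by (simp add: F_def first_in_col_def)
  qed
  then have d: "distinct (map fst js)" by (simp add: js_def comp_def distinct_map F_def)
  have l: "\<forall>(j, r) \<in> set js. j < n" using entry_props(2) by (auto simp: js_def F_def)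
  have "resultV T = ArrV (map (\<lambda>(j, r). PairV (NatV j) (RealV r)) js)"
    using False by (simp add: resultV_def js_def F_def comp_def)
  then have out: "outputs_vec n (resultV T) (vec n xo)"
    unfolding outputs_vec_def using d l x by (intro exI[of _ js]) auto
  have "mpc_approx_solution \<epsilon> n p c P C (vec n xo)"
  proof (rule approx_solutionI)
    show "0 \<le> xo j \<and> xo j \<le> 1" for j
      using xsum_box[of T j] T(2) by (auto simp: xo_def xbar_def divide_le_eq)
    fix i assume i: "i < p + c"
    have eq: "gsum N ri (\<lambda>e. co e * xo (ci e)) i = gsum N ri (\<lambda>e. co e * xbar T (ci e)) i"
      unfolding gsum_def by (intro sum.cong) (auto simp: xo_def)
    show "gsum N ri (\<lambda>e. co e * xo (ci e)) i \<le> b i + \<epsilon>"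
    proof (cases "i \<in> ri ` {..<N}")
      case True
      then show ?thesis using False unfolding eq bad_def by force
    next
      case out: False
      have "i < p"
      proof (rule ccontr)
        assume "\<not> i < p"
        then have "i - p < c" "p + (i - p) = i" using i by auto
        then show False using covered[OF cover, of "i - p"] out by simp
      qed
      then show ?thesis using eps out by (simp add: b_def gsum_outside)
    qed
  qed
  then show ?thesis using out by (auto simp: mpc_correct_output_def)
qed

end

context sparse_instance
begin

lemma main_run:
  assumes N: "0 < N" and eps: "0 < \<epsilon>" "\<epsilon> < 1"
    and L: "N < 2 ^ L" "p + c < 2 ^ L" "n < 2 ^ L"
    and Li: "360 * real (width P C) * (1 + ln N) / 2 ^ Li \<le> \<epsilon> / 4"
    and Lm: "2 * (360 * real (width P C) * (1 + ln N)) \<le> real Lm * \<epsilon>"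
  shows "\<exists>v. mpc_correct_output \<epsilon> n p c P C v \<and>
    ev N (mpc_input \<epsilon> n p c es fs) mainP v
      (20000 * (L + 1)\<^sup>2 + 400 * (width P C + 1) * (L + 1) + 9000 * (Lm + 1) * (Li + 1) * (L + 1))"
proof -
  note M = N order_refl[of N] and D = ev_den[OF N]
  let ?X = "20000 * (L + 1)\<^sup>2 + 400 * (width P C + 1) * (L + 1) + 9000 * (Lm + 1) * (Li + 1) * (L + 1)"
  define E where "E = arr N (\<lambda>e. tripV (ri e, ci e, co e))"
  let ?in = "mpc_input \<epsilon> n p c es fs"
  have in_eq: "?in = RealV \<epsilon> # NatV n # NatV p # NatV c # [entriesV es, entriesV fs]" by (simp add: mpc_input_def)
  have E: "ev N ?in mergeP E 50"
    using merge_run[of N p es fs \<epsilon> n c] N by (simp add: N_def E_def ri_def ci_def co_def)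
  have lenE: "ev N (E # ?in) (Op1 Length (Var 0)) (NatV N) (cst (Op1 Length (Var 0)))"
    by (rule D) (simp add: E_def)
  obtain usR usC where us: "sorts N ri usR" "sorts N ci usC" and
    prep: "ev N (E # ?in) prepP (dataV N ri ci co usR usC) (10000 * (L + 1)\<^sup>2)"
    using prep_run[OF N L, of ri ci co \<epsilon> "[entriesV es, entriesV fs]"] entry_props(1,2)
    unfolding in_eq E_def by (meson less_imp_le)
  let ?D = "dataV N ri ci co usR usC"
  have cover: "ev N (?D # E # ?in) coverP (NatV (if card {i \<in> ri ` {..<N}. p \<le> i} < c then 1 else 0)) (300 * (L + 1))"
    unfolding in_eq by (rule cover_run[OF N L(1)])
  let ?rest = "LetIn widthP (LetIn setupP (LetIn loopP finishP))"
  let ?Y = "400 * (width P C + 1) * (L + 1) + (500 + (9000 * (Lm + 1) * (Li + 1) * (L + 1) + 2000 * (L + 1) + 1) + 1) + 1"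
  have wrap: "ev N ?in mainP v ?X"
    if "ev N (?D # E # ?in) (if (if card {i \<in> ri ` {..<N}. p \<le> i} < c then 1 else 0 :: nat) \<noteq> 0 then NConst 0 else ?rest) v ?Y" for v
  proof -
    have "ev N (E # ?in) (if N \<noteq> 0 then LetIn prepP (Cond coverP (NConst 0) ?rest)
        else Cond (Var 4) (NConst 0) (Tab (NConst 0) (NConst 0))) v (10000 * (L + 1)\<^sup>2 + (300 * (L + 1) + ?Y + 1) + 1)"
      using ev_Let[OF N prep ev_Cond[OF N cover that]] N by simp
    note r = ev_Let[OF N E ev_Cond[OF N lenE this]]
    show ?thesis unfolding mainP_def by (rule ev_mono[OF r order_refl]) (simp add: power2_eq_square algebra_simps)
  qed
  show ?thesis
  proof (cases "card {i \<in> ri ` {..<N}. p \<le> i} < c")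
    case True
    have "ev N (?D # E # ?in) (NConst 0) (NatV 0) ?Y"
      by (rule ev_mono[OF D[of "NConst 0"] order_refl]) simp_all
    then have "ev N ?in mainP (NatV 0) ?X" by (intro wrap) (simp only: True if_True, simp)
    moreover have "mpc_correct_output \<epsilon> n p c P C (NatV 0)"
      using uncovered_infeasible[OF True] by (auto simp: mpc_correct_output_def outputs_infeasible_def)
    ultimately show ?thesis by blast
  next
    case False
    have g1: "gsum N ri (\<lambda>_. 1) i = real (card {e. e < N \<and> ri e = i})" for i by (simp add: gsum_def)
    obtain T where T: "T \<le> width P C" "\<And>e. e < N \<Longrightarrow> gsum N ri (\<lambda>_. 1) (ri e) \<le> real T" and
      width: "ev N (?D # E # ?in) widthP (RealV (real T)) (400 * (width P C + 1) * (L + 1))"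
      by (rule width_run[of N L ri "width P C", OF N L(1), where ci = ci and co = co and usR = usR and usC = usC
            and env = "E # ?in"])
         (use row_card_width in \<open>auto simp: g1\<close>)
    have card_T: "real (card {e. e < N \<and> ri e = i}) \<le> real T" for i
    proof (cases "i \<in> ri ` {..<N}")
      case True
      then show ?thesis using T(2) unfolding g1 by auto
    next
      case False
      then have "{e. e < N \<and> ri e = i} = {}" by auto
      then show ?thesis by (simp only: card.empty of_nat_0 of_nat_0_le_iff)
    qed
    have ln0: "0 \<le> ln (real N)" using N by simp
    have le: "360 * real T * (1 + ln N) \<le> 360 * real (width P C) * (1 + ln N)"
      using T(1) ln0 by (intro mult_right_mono) auto
    interpret instance_solver n p c P C es fs "real T" \<epsilon> usR usC L Li Lm
    proof
      show "0 < N" by fact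
      show "co e \<noteq> 0" "\<bar>co e\<bar> \<le> 1" if "e < N" for e using entry_props[OF that] by auto
      show "real (card {e. e < N \<and> ri e = i}) \<le> real T" for i by (rule card_T)
      show "0 < \<epsilon>" "\<epsilon> < 1" by fact+
      show "sorts N ri usR" "sorts N ci usC" by fact+
      show "N < 2 ^ L" by fact
      show "360 * real T * (1 + ln (real N)) / 2 ^ Li \<le> \<epsilon> / 4"
        by (rule order_trans[OF divide_right_mono[OF le] Li]) simp
      show "2 * (360 * real T * (1 + ln (real N))) \<le> real Lm * \<epsilon>" using le Lm by linarith
    qed
    have set_up: "ev N (RealV (real T) # ?D # E # ?in) setupP paramsV 500"
      unfolding in_eq by (rule setup_run) (simp add: b_def)
    obtain t where t: "2 * budget \<le> real t * \<epsilon>" and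
      loop: "ev N (paramsV # RealV (real T) # ?D # E # ?in) loopP (stV t) (9000 * (Lm + 1) * (Li + 1) * (L + 1))"
      by (rule loop_run)
    have "0 < budget" using W_ge_1 ln0 unfolding budget_def by (intro mult_pos_pos add_pos_nonneg) auto
    then have t0: "0 < t" using t by (cases "t = 0") auto
    have "ev N (?D # E # ?in) ?rest (resultV t) ?Y"
      by (rule ev_Let[OF N width ev_Let[OF N set_up ev_Let[OF N loop finish_run[OF t0]]]])
    then have "ev N ?in mainP (resultV t) ?X" by (intro wrap) (simp only: False if_False, simp)
    moreover have "mpc_correct_output \<epsilon> n p c P C (resultV t)" by (rule result_correct[OF t t0 False])
    ultimately show ?thesis by blast
  qed
qed

lemma main_run_empty:
  assumes N: "N = 0" and eps: "0 < \<epsilon>" "\<epsilon> < 1"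
  shows "\<exists>v. mpc_correct_output \<epsilon> n p c P C v \<and> ev 1 (mpc_input \<epsilon> n p c es fs) mainP v 100"
proof -
  let ?in = "mpc_input \<epsilon> n p c es fs"
  have mer: "merge p es fs = []" using N by (simp add: N_def)
  define E where "E = arr 0 (\<lambda>e. tripV (ri e, ci e, co e))"
  have E: "ev 1 ?in mergeP E 50"
    using merge_run[of 1 p es fs \<epsilon> n c] mer by (simp add: E_def arr_def)
  have lenE: "ev 1 (E # ?in) (Op1 Length (Var 0)) (NatV 0) (cst (Op1 Length (Var 0)))"
    by (rule ev_den) (simp_all add: E_def)
  have vc: "ev 1 (E # ?in) (Var 4) (NatV c) (cst (Var 4))" by (rule ev_den) (simp_all add: mpc_input_def)
  define v where "v = (if c = 0 then ArrV [] else NatV 0)"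
  have "ev 1 (E # ?in) (if c \<noteq> 0 then NConst 0 else Tab (NConst 0) (NConst 0)) v 3"
  proof (cases "c = 0")
    case True
    have "ev 1 (E # ?in) (Tab (NConst 0) (NConst 0)) (ArrV (map (\<lambda>_. NatV 0) [0..<0])) (cst (Tab (NConst 0) (NConst 0)))"
      by (rule ev_Tab_den) simp_all
    then show ?thesis using True by (auto simp: v_def elim: ev_mono)
  next
    case False
    have "ev 1 (E # ?in) (NConst 0) (NatV 0) 1" using ev_den[of 1 "NConst 0" "E # ?in"] by simp
    then show ?thesis using False by (auto simp: v_def elim: ev_mono)
  qed
  note c = ev_Cond[OF _ vc this]
  have "ev 1 (E # ?in) (Cond (Op1 Length (Var 0))
      (LetIn prepP (Cond coverP (NConst 0) (LetIn widthP (LetIn setupP (LetIn loopP finishP)))))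
      (Cond (Var 4) (NConst 0) (Tab (NConst 0) (NConst 0)))) v
      (cst (Op1 Length (Var 0)) + (cst (Var 4) + 3 + 1) + 1)"
    by (rule ev_Cond[where m = 0]) (use c lenE in simp_all)
  note r = ev_Let[OF _ E this]
  have run: "ev 1 ?in mainP v 100" unfolding mainP_def by (rule ev_mono[OF r order_refl]) simp_all
  have g0: "gsum N ri w i = 0" for w i using N by (simp add: gsum_def)
  have "mpc_correct_output \<epsilon> n p c P C v"
  proof (cases "c = 0")
    case True
    have "mpc_approx_solution \<epsilon> n p c P C (vec n (\<lambda>_. 0))"
      by (rule approx_solutionI) (use True eps in \<open>auto simp: g0 b_def\<close>)
    moreover have "outputs_vec n v (vec n (\<lambda>_. 0))"
      unfolding outputs_vec_def by (rule exI[of _ "[]"]) (simp add: v_def True)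
    ultimately show ?thesis by (auto simp: mpc_correct_output_def)
  next
    case False
    then have "card {i \<in> ri ` {..<N}. p \<le> i} < c" using N by simp
    then show ?thesis using uncovered_infeasible False
      by (auto simp: mpc_correct_output_def outputs_infeasible_def v_def)
  qed
  with run show ?thesis by blast
qed

end

section \<open>Work and depth bounds\<close>

lemma exp_le_power_two:
  assumes "2 * x \<le> real L"
  shows "exp x \<le> 2 ^ L"
proof -
  have "exp (1 / 2 :: real) ^ 2 = exp 1" by (simp flip: exp_of_nat_mult)
  also have "\<dots> \<le> 2 ^ 2" using exp_le by simp
  finally have h: "exp (1 / 2 :: real) \<le> 2" by (rule power2_le_imp_le) simp
  have "exp x \<le> exp (real L * (1 / 2))" using assms by simp
  also have "\<dots> = exp (1 / 2) ^ L" by (rule exp_of_nat_mult)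
  also have "\<dots> \<le> 2 ^ L" using h by (intro power_mono) auto
  finally show ?thesis .
qed

lemma log_size_ge_1:
  assumes "0 < \<epsilon>" "\<epsilon> < 1"
  shows "1 \<le> log_size \<epsilon> n p c N"
proof -
  have "1 < 1 / \<epsilon>" using assms by simp
  then have s: "3 \<le> real n + real p + real c + real N + 1 / \<epsilon> + 2" by simp
  then have "exp 1 \<le> real n + real p + real c + real N + 1 / \<epsilon> + 2" using exp_le by linarith
  then show ?thesis unfolding log_size_def using s by (subst ln_ge_iff) auto
qed

text \<open>With \<open>s\<close> the argument of the logarithm, the inner loop has to shrink an error of at most
  \<open>360 s\<^sup>2\<close> to \<open>1 / (4 s)\<close>, hence the comparison with \<open>s ^ 10\<close>, where \<open>3 ^ 7\<close> outweighs the numerical constant.\<close>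

lemma parameters_exist:
  fixes n p c N w :: nat and \<epsilon> :: real
  assumes eps: "0 < \<epsilon>" "\<epsilon> < 1" and N: "0 < N" and w: "0 < w" "w \<le> N"
  defines "lg \<equiv> log_size \<epsilon> n p c N"
  obtains L Li Lm :: nat where "N < 2 ^ L" "p + c < 2 ^ L" "n < 2 ^ L"
    "360 * real w * (1 + ln N) / 2 ^ Li \<le> \<epsilon> / 4"
    "2 * (360 * real w * (1 + ln N)) \<le> real Lm * \<epsilon>"
    "1 \<le> lg" "real (L + 1) \<le> 4 * lg" "real (Li + 1) \<le> 22 * lg" "real (Lm + 1) \<le> 1442 * (real w / \<epsilon>) * lg"
proof -
  define s where "s = real n + real p + real c + real N + 1 / \<epsilon> + 2"
  have e1: "1 < 1 / \<epsilon>" using eps by simp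
  have s3: "3 \<le> s" and sN: "real N + 1 \<le> s" "1 / \<epsilon> \<le> s" using e1 N by (auto simp: s_def)
  have lam: "lg = ln s" by (simp add: lg_def log_size_def s_def)
  have es: "exp lg = s" using s3 by (simp add: lam)
  have l1: "1 \<le> lg" unfolding lg_def by (rule log_size_ge_1[OF eps])
  define L where "L = nat \<lceil>2 * lg\<rceil>"
  have L: "2 * lg \<le> real L" "real L \<le> 2 * lg + 1" using l1 unfolding L_def by linarith+
  have "s \<le> 2 ^ L" using exp_le_power_two[OF L(1)] es by simp
  then have "real N < 2 ^ L" "real (p + c) < 2 ^ L" "real n < 2 ^ L"
    using e1 unfolding s_def of_nat_add by linarith+
  then have 1: "N < 2 ^ L" "p + c < 2 ^ L" "n < 2 ^ L"
    by (metis of_nat_less_iff of_nat_numeral of_nat_power)+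
  have lnN: "0 \<le> ln (real N)" "1 + ln (real N) \<le> real N" "ln (real N) \<le> lg"
    using N ln_le_minus_one[of "real N"] sN by (auto simp: lam)
  define Li where "Li = nat \<lceil>20 * lg\<rceil>"
  have Li: "2 * (10 * lg) \<le> real Li" "real Li \<le> 20 * lg + 1" using l1 unfolding Li_def by linarith+
  have "s ^ 10 \<le> 2 ^ Li" using exp_le_power_two[OF Li(1)] exp_of_nat_mult[of 10 lg] es by simp
  moreover have "1440 * real w * (1 + ln N) / \<epsilon> \<le> s ^ 10"
  proof -
    have "(1440 * real w) * (1 + ln N) * (1 / \<epsilon>) \<le> (s ^ 7 * s) * s * s"
    proof (intro mult_mono)
      have "(1440 :: real) \<le> 3 ^ 7" by simp
      also have "\<dots> \<le> s ^ 7" using s3 by (intro power_mono) auto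
      finally show "1440 \<le> s ^ 7" .
    qed (use s3 w sN lnN eps in auto)
    also have "\<dots> = s ^ 10" by (simp add: eval_nat_numeral)
    finally show ?thesis by simp
  qed
  ultimately have "1440 * real w * (1 + ln N) / \<epsilon> \<le> 2 ^ Li" by linarith
  then have 2: "360 * real w * (1 + ln N) / 2 ^ Li \<le> \<epsilon> / 4" using eps by (simp add: field_simps)
  define Lm where "Lm = nat \<lceil>720 * real w * (1 + ln N) / \<epsilon>\<rceil>"
  have nn: "0 \<le> 720 * real w * (1 + ln N) / \<epsilon>" using eps lnN by simp
  have Lm: "720 * real w * (1 + ln N) / \<epsilon> \<le> real Lm" "real Lm \<le> 720 * real w * (1 + ln N) / \<epsilon> + 1"
    using nn unfolding Lm_def by linarith+
  have 3: "2 * (360 * real w * (1 + ln N)) \<le> real Lm * \<epsilon>" using Lm(1) eps by (simp add: field_simps)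
  have q: "1 \<le> real w / \<epsilon>" using w eps by (simp add: le_divide_eq)
  have "720 * real w * (1 + ln N) / \<epsilon> = 720 * (real w / \<epsilon>) * (1 + ln N)" by simp
  also have "\<dots> \<le> 720 * (real w / \<epsilon>) * (2 * lg)" using q l1 lnN by (intro mult_left_mono) auto
  finally have "real Lm \<le> 1440 * ((real w / \<epsilon>) * lg) + 1" using Lm(2) by simp
  moreover have "1 \<le> (real w / \<epsilon>) * lg" using mult_mono[OF q l1] q by simp
  moreover have "y + 1 \<le> 1442 * z" if "y \<le> 1440 * z + 1" "1 \<le> z" for y z :: real using that by linarith
  ultimately have 4: "real (Lm + 1) \<le> 1442 * (real w / \<epsilon>) * lg"
    unfolding of_nat_add of_nat_1 mult.assoc by blast
  show ?thesis using that[OF 1 2 3 l1 _ _ 4] L(2) Li(2) l1 by simp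
qed

lemma cost_bound:
  fixes q lg :: real and w L Li Lm :: nat
  assumes q: "1 \<le> q" "real w \<le> q" and l: "1 \<le> lg"
    and L: "real (L + 1) \<le> 4 * lg" "real (Li + 1) \<le> 22 * lg" "real (Lm + 1) \<le> 1442 * q * lg"
  shows "real (20000 * (L + 1)\<^sup>2 + 400 * (w + 1) * (L + 1) + 9000 * (Lm + 1) * (Li + 1) * (L + 1))
    \<le> 10 ^ 10 * q * lg ^ 3"
proof -
  define u where "u = q * lg ^ 3"
  have l2: "lg \<le> lg ^ 3" "lg ^ 2 \<le> lg ^ 3" using l self_le_power[OF l, of 3] power_increasing[of 2 3 lg] by auto
  have qu: "lg ^ 3 \<le> u" "q * lg \<le> u"
    using q l l2 mult_right_mono[OF q(1), of "lg ^ 3"] unfolding u_def by auto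
  have "real (L + 1) ^ 2 \<le> (4 * lg) ^ 2" using L(1) by (intro power_mono) auto
  then have 1: "20000 * real (L + 1) ^ 2 \<le> 320000 * u" using l2 qu by (simp add: power_mult_distrib)
  have "real (w + 1) * real (L + 1) \<le> (2 * q) * (4 * lg)" using q L(1) by (intro mult_mono) auto
  also have "\<dots> = 8 * (q * lg)" by simp
  finally have 2: "400 * (real (w + 1) * real (L + 1)) \<le> 3200 * u" using qu(2) by linarith
  have "real (Lm + 1) * real (Li + 1) * real (L + 1) \<le> (1442 * q * lg) * (22 * lg) * (4 * lg)"
    using L q l by (intro mult_mono) auto
  also have "\<dots> = 126896 * u" by (simp add: u_def power3_eq_cube)
  finally have 3: "9000 * (real (Lm + 1) * real (Li + 1) * real (L + 1)) \<le> 1142064000 * u" by linarith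
  have u0: "0 \<le> u" using q l by (simp add: u_def)
  have add: "x + y + z \<le> 10 ^ 10 * u" if "x \<le> 320000 * u" "y \<le> 3200 * u" "z \<le> 1142064000 * u" for x y z
    using that u0 by simp
  have "real (20000 * (L + 1)\<^sup>2 + 400 * (w + 1) * (L + 1) + 9000 * (Lm + 1) * (Li + 1) * (L + 1))
    = 20000 * real (L + 1) ^ 2 + 400 * (real (w + 1) * real (L + 1)) + 9000 * (real (Lm + 1) * real (Li + 1) * real (L + 1))"
    by (simp only: of_nat_add of_nat_mult of_nat_power of_nat_numeral mult.assoc)
  also have "\<dots> \<le> 10 ^ 10 * u" by (rule add[OF 1 2 3])
  finally show ?thesis by (simp add: u_def mult.assoc)
qed

lemma mat_width_le_nnz: "mat_width A \<le> mat_nnz A"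
proof -
  have "row_nnz A i \<le> mat_nnz A" if "i < dim_row A" for i
  proof -
    let ?S = "{(i, j). i < dim_row A \<and> j < dim_col A \<and> A $$ (i, j) \<noteq> 0}"
    have "?S \<subseteq> {..<dim_row A} \<times> {..<dim_col A}" by auto
    then have "finite ?S" by (rule finite_subset) simp
    moreover have "Pair i ` {j. j < dim_col A \<and> A $$ (i, j) \<noteq> 0} \<subseteq> ?S" using that by auto
    ultimately have "card (Pair i ` {j. j < dim_col A \<and> A $$ (i, j) \<noteq> 0}) \<le> card ?S" by (rule card_mono)
    then show ?thesis by (simp add: row_nnz_def mat_nnz_def card_image inj_on_def)
  qed
  then show ?thesis unfolding mat_width_def by (intro Max.boundedI) auto
qed

lemma width_le_nnz: "width P C \<le> nnz P C"
  using mat_width_le_nnz[of P] mat_width_le_nnz[of C] by (simp add: width_def nnz_def)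

context sparse_instance
begin

lemma mainP_solves:
  assumes eps: "0 < \<epsilon>" "\<epsilon> < 1"
  shows "\<exists>v work depth. run (mpc_input \<epsilon> n p c es fs) mainP v work depth \<and>
    mpc_correct_output \<epsilon> n p c P C v \<and>
    real depth \<le> 10 ^ 10 * max 1 (real (width P C) / \<epsilon>) * log_size \<epsilon> n p c (nnz P C) ^ 3 \<and>
    real work \<le> 10 ^ 10 * max 1 (real (width P C) * real (nnz P C) / \<epsilon>) * log_size \<epsilon> n p c (nnz P C) ^ 3"
proof -
  define lg where "lg = log_size \<epsilon> n p c N"
  define w where "w = width P C"
  have nnz: "nnz P C = N" by (rule N_nnz[symmetric])
  have l1: "1 \<le> lg" unfolding lg_def by (rule log_size_ge_1[OF eps])
  show ?thesis
  proof (cases "N = 0")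
    case True
    obtain v where v: "mpc_correct_output \<epsilon> n p c P C v" "ev 1 (mpc_input \<epsilon> n p c es fs) mainP v 100"
      using main_run_empty[OF True eps] by blast
    then obtain work depth where r: "run (mpc_input \<epsilon> n p c es fs) mainP v work depth" "work \<le> 100" "depth \<le> 100"
      by (auto simp: ev_def)
    have "100 \<le> 10 ^ 10 * max 1 x * lg ^ 3" for x :: real
    proof -
      have "1 * 1 \<le> max 1 x * lg ^ 3" using one_le_power[OF l1, of 3] by (intro mult_mono) auto
      then show ?thesis by simp
    qed
    then have "real depth \<le> 10 ^ 10 * max 1 x * lg ^ 3" "real work \<le> 10 ^ 10 * max 1 x * lg ^ 3" for x :: real
      using r(2,3) by (meson of_nat_le_numeral_iff order_trans)+
    then show ?thesis using r(1) v(1) unfolding nnz lg_def by blast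
  next
    case False
    then have N: "0 < N" by simp
    have w0: "0 < w"
    proof -
      have "0 < card {e. e < N \<and> ri e = ri 0}" using N by (subst card_gt_0_iff) auto
      then show ?thesis using row_card_width[of "ri 0"] unfolding w_def by linarith
    qed
    have q: "1 \<le> real w / \<epsilon>" using w0 eps by (simp add: le_divide_eq)
    have wN: "w \<le> N" unfolding w_def nnz[symmetric] by (rule width_le_nnz)
    obtain L Li Lm where p: "N < 2 ^ L" "p + c < 2 ^ L" "n < 2 ^ L"
      "360 * real w * (1 + ln N) / 2 ^ Li \<le> \<epsilon> / 4" "2 * (360 * real w * (1 + ln N)) \<le> real Lm * \<epsilon>"
      and b: "real (L + 1) \<le> 4 * lg" "real (Li + 1) \<le> 22 * lg" "real (Lm + 1) \<le> 1442 * (real w / \<epsilon>) * lg"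
      using parameters_exist[OF eps N w0 wN, of p c n] unfolding lg_def by blast
    define X where "X = 20000 * (L + 1)\<^sup>2 + 400 * (w + 1) * (L + 1) + 9000 * (Lm + 1) * (Li + 1) * (L + 1)"
    obtain v where v: "mpc_correct_output \<epsilon> n p c P C v" "ev N (mpc_input \<epsilon> n p c es fs) mainP v X"
      using main_run[OF N eps p(1-3) p(4,5)[unfolded w_def]] unfolding X_def w_def by blast
    then obtain work depth where r: "run (mpc_input \<epsilon> n p c es fs) mainP v work depth" "work \<le> N * X" "depth \<le> X"
      by (auto simp: ev_def)
    have "real w \<le> real w / \<epsilon>" using eps by (simp add: le_divide_eq mult_left_le)
    then have X: "real X \<le> 10 ^ 10 * (real w / \<epsilon>) * lg ^ 3"
      unfolding X_def by (intro cost_bound q l1 b)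
    have "real depth \<le> 10 ^ 10 * max 1 (real w / \<epsilon>) * lg ^ 3"
      using X r(3) q by (simp add: max_def)
    moreover have "real work \<le> 10 ^ 10 * max 1 (real w * real N / \<epsilon>) * lg ^ 3"
    proof -
      have "real work \<le> real N * real X" using r(2) by (metis of_nat_le_iff of_nat_mult)
      also have "\<dots> \<le> real N * (10 ^ 10 * (real w / \<epsilon>) * lg ^ 3)" using X by (intro mult_left_mono) auto
      also have "\<dots> = 10 ^ 10 * (real w * real N / \<epsilon>) * lg ^ 3" by simp
      also have "\<dots> \<le> 10 ^ 10 * max 1 (real w * real N / \<epsilon>) * lg ^ 3"
        using l1 by (intro mult_right_mono mult_left_mono) auto
      finally show ?thesis .
    qed
    ultimately show ?thesis using r(1) v(1) unfolding nnz lg_def w_def by blast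
  qed
qed

end

(* One program e and one pair of constants K, k serve all instances. The maxima with 1 are relevant
   only if there are no nonzero entries: otherwise w and N are at least 1 and 1 / \<epsilon> > 1. *)
theorem theorem1p1:
  shows "\<exists>(e :: prg) (K :: real) (k :: nat).
    \<forall>(\<epsilon> :: real) (n :: nat) (p :: nat) (c :: nat) (P :: real mat) (C :: real mat) es fs.
      0 < \<epsilon> \<and> \<epsilon> < 1 \<and> mpc_instance n p c P C \<and> lists_entries P es \<and> lists_entries C fs \<longrightarrow>
      (\<exists>v work depth.
        run (mpc_input \<epsilon> n p c es fs) e v work depth \<and>
        mpc_correct_output \<epsilon> n p c P C v \<and>
        real depth \<le> K * max 1 (real (width P C) / \<epsilon>)
                       * log_size \<epsilon> n p c (nnz P C) ^ k \<and>
        real work \<le> K * max 1 (real (width P C) * real (nnz P C) / \<epsilon>)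
                      * log_size \<epsilon> n p c (nnz P C) ^ k)"
proof (rule exI[of _ mainP], rule exI[of _ "10 ^ 10"], rule exI[of _ 3], intro allI impI)
  fix \<epsilon> :: real and n p c P C es fs
  assume A: "0 < \<epsilon> \<and> \<epsilon> < 1 \<and> mpc_instance n p c P C \<and> lists_entries P es \<and> lists_entries C fs"
  then interpret sparse_instance n p c P C es fs by unfold_locales auto
  show "\<exists>v work depth.
        run (mpc_input \<epsilon> n p c es fs) mainP v work depth \<and>
        mpc_correct_output \<epsilon> n p c P C v \<and>
        real depth \<le> 10 ^ 10 * max 1 (real (width P C) / \<epsilon>) * log_size \<epsilon> n p c (nnz P C) ^ 3 \<and>
        real work \<le> 10 ^ 10 * max 1 (real (width P C) * real (nnz P C) / \<epsilon>) * log_size \<epsilon> n p c (nnz P C) ^ 3"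
    using A by (intro mainP_solves) auto
qed

end
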